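(* Algorithm 3, the procedure Order$(A,B,v)$ written out in full in the context, runs in polynomial space of the size of $(A,B)$; in particular, its output $N$ has size (binary length) polynomial in the size of $(A,B)$.
   Context: Conventions. A procedure runs in polynomial space if the deterministic Turing machine executing it runs in space bounded by some polynomial in the size indicated. Integers are encoded in binary. Input. A vertex $v\in E_A^0$ (see below) and a Katsura pair $(A,B)$, i.e. square integer matrices of the same dimension $\mathfrak N\ge1$, where $A$ has nonnegative entries and no zero row, and $A_{u,v}=0$ implies $B_{u,v}=0$. Graphs. $E_A$ is the directed graph with vertex set $E_A^0=\{1,\dots,\mathfrak N\}$ and, for all $u,v$, exactly $A_{u,v}$ edges with range $u$ and source $v$. Its underlying simple graph $\overline E_A$ is obtained by collapsing multiple edges: it has the same vertices and one edge with range $u$ and source $v$ whenever $A_{u,v}\ne0$. For an edge $e$ with range $u$ and source $v$ put $A_e=A_{u,v}$, $B_e=B_{u,v}$. A path $p=e_1\cdots e_n$ is a sequence of edges with source of $e_i$ equal to range of $e_{i+1}$; its range $\mathbf r(p)$ is the range of $e_1$ and its source $\mathbf s(p)$ is the source of $e_n$. Vertices are paths of length $0$, each being its own range and source. Put $A_p=\prod_l A_{e_l}$, $B_p=\prod_l B_{e_l}$, and $A_v=B_v=1$ for a vertex $v$. $v\overline E_A^*$ is the set of finite paths of $\overline E_A$ with range $v$, and $v\overline E_A^*v$ the set of those with range and source $v$. A cycle is a path of positive length with equal range and source. A path is simple if it contains no cycle as a subsequence of edges; a cycle is simple if it contains no cycle as a proper subsequence of edges. In the algorithms, paths of $\overline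 E_A$ are encoded as their vertex sequences, and simple paths and simple cycles are cycled through in lexicographic order. Algorithm 1, procedure Faithful$(A,B,v)$: - For all simple paths $p\in v\overline E_A^*$ with $B_p\ne0$: -- For all simple cycles $c\in \mathbf s(p)\overline E_A^*\mathbf s(p)$: --- If $B_c/A_c\notin\mathbb Z$: halt and return TRUE. - Return FALSE. Algorithm 3, procedure Order$(A,B,v)$: - If Faithful$(A,B,v)$ = TRUE: return $0$. - Else: -- Set $N\gets1$. -- For each simple path $p\in v\overline E_A^*$ with $B_p\ne0$: set $N\gets\operatorname{lcm}\left(N,\frac{A_p}{\gcd(A_p,|B_p|)}\right)$. -- Return $N$. *)

theory Defs
  imports
    "Jordan_Normal_Form.Matrix"
    "HOL-Computational_Algebra.Polynomial"
    "HOL-Library.Sublist"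
    "HOL-Library.List_Lexorder"
begin

text \<open>Rows and columns of \<^typ>\<open>int mat\<close> are indexed from \<open>0\<close>, so the vertices of the graph are
  \<open>0, \<dots>, n - 1\<close> instead of \<open>1, \<dots>, n\<close>.\<close>

definition katsura_pair :: "nat \<Rightarrow> int mat \<Rightarrow> int mat \<Rightarrow> bool" where
  "katsura_pair n A B \<longleftrightarrow>
     1 \<le> n \<and> A \<in> carrier_mat n n \<and> B \<in> carrier_mat n n \<and>
     (\<forall>u<n. \<forall>v<n. 0 \<le> A $$ (u, v)) \<and>
     (\<forall>u<n. \<exists>v<n. A $$ (u, v) \<noteq> 0) \<and>
     (\<forall>u<n. \<forall>v<n. A $$ (u, v) = 0 \<longrightarrow> B $$ (u, v) = 0)"

text \<open>The algorithms only use the underlying simple graph of \<open>E\<^sub>A\<close>. Its edge with range \<open>u\<close> and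
  source \<open>v\<close> is the pair \<open>(u, v)\<close>.\<close>

definition edges :: "int mat \<Rightarrow> (nat \<times> nat) set" where
  "edges A = {(u, v). u < dim_row A \<and> v < dim_row A \<and> A $$ (u, v) \<noteq> 0}"

abbreviation edge_range :: "nat \<times> nat \<Rightarrow> nat" where "edge_range \<equiv> fst"
abbreviation edge_source :: "nat \<times> nat \<Rightarrow> nat" where "edge_source \<equiv> snd"

definition edge_path :: "int mat \<Rightarrow> (nat \<times> nat) list \<Rightarrow> bool" where
  "edge_path A es \<longleftrightarrow> set es \<subseteq> edges A \<and>
     (\<forall>i. Suc i < length es \<longrightarrow> edge_source (es ! i) = edge_range (es ! Suc i))"

definition edge_cycle :: "int mat \<Rightarrow> (nat \<times> nat) list \<Rightarrow> bool" where
  "edge_cycle A es \<longleftrightarrow> es \<noteq> [] \<and> edge_path A es \<and> edge_range (hd es) = edge_source (last es)"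

text \<open>A path is given by its vertex sequence: a nonempty list that starts with the range and ends
  with the source of the path. The path of length \<open>0\<close> at \<open>v\<close> is \<open>[v]\<close>.\<close>

type_synonym path = "nat list"

definition path_edges :: "path \<Rightarrow> (nat \<times> nat) list" where
  "path_edges p = zip p (tl p)"

definition is_path :: "int mat \<Rightarrow> path \<Rightarrow> bool" where
  "is_path A p \<longleftrightarrow> p \<noteq> [] \<and> set p \<subseteq> {..<dim_row A} \<and> edge_path A (path_edges p)"

definition path_range :: "path \<Rightarrow> nat" where "path_range p = hd p"
definition path_source :: "path \<Rightarrow> nat" where "path_source p = last p"

definition simple_path :: "int mat \<Rightarrow> path \<Rightarrow> bool" where
  "simple_path A p \<longleftrightarrow> is_path A p \<and> (\<nexists>es. subseq es (path_edges p) \<and> edge_cycle A es)"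

definition simple_cycle :: "int mat \<Rightarrow> path \<Rightarrow> bool" where
  "simple_cycle A c \<longleftrightarrow> is_path A c \<and> edge_cycle A (path_edges c) \<and>
     (\<nexists>es. strict_subseq es (path_edges c) \<and> edge_cycle A es)"

definition path_prod :: "int mat \<Rightarrow> path \<Rightarrow> int" where
  "path_prod M p = prod_list (map (\<lambda>e. M $$ e) (path_edges p))"

text \<open>The lists are sorted by the lexicographic order on vertex sequences. By the two finiteness
  lemmas below they contain all elements of the sets.\<close>

definition simple_paths :: "int mat \<Rightarrow> nat \<Rightarrow> path list" where
  "simple_paths A v = sorted_list_of_set {p. simple_path A p \<and> path_range p = v}"

definition simple_cycles :: "int mat \<Rightarrow> nat \<Rightarrow> path list" where
  "simple_cycles A v =
     sorted_list_of_set {c. simple_cycle A c \<and> path_range c = v \<and> path_source c = v}"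

lemma path_edges_append: "q \<noteq> [] \<Longrightarrow> path_edges (xs @ q) = path_edges (xs @ [hd q]) @ path_edges q"
  by (cases q; induction xs rule: induct_list012) (auto simp: path_edges_def)

lemma edge_path_appendD:
  assumes "edge_path A (xs @ ys @ zs)"
  shows "edge_path A ys"
  unfolding edge_path_def
proof (intro conjI allI impI)
  show "set ys \<subseteq> edges A"
    using assms by (auto simp: edge_path_def)
  fix i assume i: "Suc i < length ys"
  have "Suc (length xs + i) < length (xs @ ys @ zs)" using i by simp
  then have "edge_source ((xs @ ys @ zs) ! (length xs + i)) =
      edge_range ((xs @ ys @ zs) ! Suc (length xs + i))"
    using assms unfolding edge_path_def by blast
  moreover have "(xs @ ys @ zs) ! (length xs + i) = ys ! i"
    and "(xs @ ys @ zs) ! Suc (length xs + i) = ys ! Suc i"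
    using i by (simp_all add: nth_append)
  ultimately show "edge_source (ys ! i) = edge_range (ys ! Suc i)" by simp
qed

lemma repetition_imp_cycle:
  assumes "is_path A (xs @ y # ys @ y # zs)"
  obtains es fs gs where "path_edges (xs @ y # ys @ y # zs) = fs @ es @ gs"
    and "length fs = length xs" and "length gs = length zs" and "edge_cycle A es"
proof -
  define fs where "fs = path_edges (xs @ [y])"
  define es where "es = path_edges (y # ys @ [y])"
  define gs where "gs = path_edges (y # zs)"
  have eq: "path_edges (xs @ y # ys @ y # zs) = fs @ es @ gs"
    using path_edges_append[of "y # ys @ y # zs" xs] path_edges_append[of "y # zs" "y # ys"]
    by (simp add: fs_def es_def gs_def)
  then have "edge_path A es"
    using assms edge_path_appendD by (auto simp: is_path_def)
  moreover have "es \<noteq> []" "edge_range (hd es) = y"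
    unfolding es_def path_edges_def by (cases ys; simp)+
  moreover have "edge_source (last es) = y"
    unfolding es_def path_edges_def by (simp add: last_conv_nth nth_append)
  ultimately have "edge_cycle A es" by (simp add: edge_cycle_def)
  then show thesis
    using that eq by (simp add: fs_def gs_def path_edges_def)
qed

lemma simple_path_distinct:
  assumes "simple_path A p"
  shows "distinct p"
proof (rule ccontr)
  assume "\<not> distinct p"
  then obtain xs ys zs y where p: "p = xs @ y # ys @ y # zs"
    using not_distinct_decomp by fastforce
  then obtain es fs gs where "path_edges p = fs @ es @ gs" "edge_cycle A es"
    using assms repetition_imp_cycle[of A xs y ys zs] unfolding simple_path_def by metis
  then show False
    using assms by (auto simp: simple_path_def)
qed

lemma simple_cycle_distinct_tl:
  assumes "simple_cycle A c"
  shows "distinct (tl c)"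
proof (rule ccontr)
  assume nd: "\<not> distinct (tl c)"
  then obtain xs ys zs y where "tl c = xs @ y # ys @ y # zs"
    using not_distinct_decomp by fastforce
  then have c: "c = (hd c # xs) @ y # ys @ y # zs"
    using nd by (cases c) auto
  then obtain es fs gs where *: "path_edges c = fs @ es @ gs" "length fs = Suc (length xs)"
      "edge_cycle A es"
    using assms repetition_imp_cycle[of A "hd c # xs" y ys zs]
    by (metis simple_cycle_def length_Cons)
  have "length es < length (path_edges c)" using *(1,2) by simp
  then have "es \<noteq> path_edges c" by blast
  then have "strict_subseq es (path_edges c)"
    using *(1) by (auto simp: strict_subseq_def)
  then show False
    using assms * by (auto simp: simple_cycle_def)
qed

lemma finite_simple_paths: "finite {p. simple_path A p \<and> path_range p = v}"
proof (rule finite_subset)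
  show "{p. simple_path A p \<and> path_range p = v} \<subseteq>
      {p. set p \<subseteq> {..<dim_row A} \<and> length p \<le> dim_row A}"
  proof safe
    fix p assume p: "simple_path A p"
    then show "length p \<le> dim_row A"
      using card_mono[of "{..<dim_row A}" "set p"] distinct_card[OF simple_path_distinct[OF p]]
      by (auto simp: simple_path_def is_path_def)
  qed (auto simp: simple_path_def is_path_def)
qed (simp add: finite_lists_length_le)

lemma finite_simple_cycles:
  "finite {c. simple_cycle A c \<and> path_range c = v \<and> path_source c = v}"
proof (rule finite_subset)
  show "{c. simple_cycle A c \<and> path_range c = v \<and> path_source c = v} \<subseteq>
      {c. set c \<subseteq> {..<dim_row A} \<and> length c \<le> Suc (dim_row A)}"
  proof safe
    fix c assume c: "simple_cycle A c"
    then have "set (tl c) \<subseteq> {..<dim_row A}"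
      by (cases c) (auto simp: simple_cycle_def is_path_def)
    then show "length c \<le> Suc (dim_row A)"
      using card_mono[of "{..<dim_row A}" "set (tl c)"]
        distinct_card[OF simple_cycle_distinct_tl[OF c]] by auto
  qed (auto simp: simple_cycle_def is_path_def)
qed (simp add: finite_lists_length_le)

text \<open>Each procedure returns its result together with the list of snapshots of its execution. A
  snapshot is taken at every entry of a loop body and at the return of \<open>Order\<close>. It records the
  current values of the program variables.\<close>

datatype snapshot =
    Faithful_Path path
  | Faithful_Cycle path path
  | Order_Path path int
  | Order_Return int

primrec faithful_cycle_loop ::
    "int mat \<Rightarrow> int mat \<Rightarrow> path \<Rightarrow> path list \<Rightarrow> snapshot list \<times> bool" where
  "faithful_cycle_loop A B p [] = ([], False)"
| "faithful_cycle_loop A B p (c # cs) =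
    (if (of_int (path_prod B c) / of_int (path_prod A c) :: rat) \<notin> \<int>
     then ([Faithful_Cycle p c], True)
     else let (tr, r) = faithful_cycle_loop A B p cs in (Faithful_Cycle p c # tr, r))"

primrec faithful_path_loop ::
    "int mat \<Rightarrow> int mat \<Rightarrow> path list \<Rightarrow> snapshot list \<times> bool" where
  "faithful_path_loop A B [] = ([], False)"
| "faithful_path_loop A B (p # ps) =
    (let (tr, r) = faithful_cycle_loop A B p (simple_cycles A (path_source p)) in
     if r then (Faithful_Path p # tr, True)
     else let (tr', r') = faithful_path_loop A B ps in (Faithful_Path p # tr @ tr', r'))"

definition loop_paths :: "int mat \<Rightarrow> int mat \<Rightarrow> nat \<Rightarrow> path list" where
  "loop_paths A B v = filter (\<lambda>p. path_prod B p \<noteq> 0) (simple_paths A v)"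

definition faithful_run :: "int mat \<Rightarrow> int mat \<Rightarrow> nat \<Rightarrow> snapshot list \<times> bool" where
  "faithful_run A B v = faithful_path_loop A B (loop_paths A B v)"

primrec order_loop ::
    "int mat \<Rightarrow> int mat \<Rightarrow> int \<Rightarrow> path list \<Rightarrow> snapshot list \<times> int" where
  "order_loop A B N [] = ([], N)"
| "order_loop A B N (p # ps) =
    (let N' = lcm N (path_prod A p div gcd (path_prod A p) \<bar>path_prod B p\<bar>);
         (tr, r) = order_loop A B N' ps
     in (Order_Path p N # tr, r))"

definition order_run :: "int mat \<Rightarrow> int mat \<Rightarrow> nat \<Rightarrow> snapshot list \<times> int" where
  "order_run A B v =
    (let (tr, r) = faithful_run A B v in
     if r then (tr @ [Order_Return 0], 0)
     else let (tr', N) = order_loop A B 1 (loop_paths A B v) in (tr @ tr' @ [Order_Return N], N))"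

definition order_trace :: "int mat \<Rightarrow> int mat \<Rightarrow> nat \<Rightarrow> snapshot list" where
  "order_trace A B v = fst (order_run A B v)"

definition order_value :: "int mat \<Rightarrow> int mat \<Rightarrow> nat \<Rightarrow> int" where
  "order_value A B v = snd (order_run A B v)"

text \<open>Multitape machines with tapes that are infinite in both directions. Control states and tape
  symbols are numbers below a bound; the symbol \<open>0\<close> is the blank.\<close>

datatype move = Move_Left | Move_Stay | Move_Right

record tm =
  tapes :: nat
  states :: nat
  symbols :: nat
  start :: nat
  halt :: nat
  delta :: "nat \<Rightarrow> nat list \<Rightarrow> nat \<times> (nat \<times> move) list"

definition tm_wf :: "tm \<Rightarrow> bool" where
  "tm_wf M \<longleftrightarrow> 0 < tapes M \<and> 0 < symbols M \<and> start M < states M \<and> halt M < states M \<and>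
     (\<forall>q ss q' acts. q < states M \<and> length ss = tapes M \<and> set ss \<subseteq> {..<symbols M} \<and>
        delta M q ss = (q', acts) \<longrightarrow>
        q' < states M \<and> length acts = tapes M \<and> fst ` set acts \<subseteq> {..<symbols M})"

text \<open>A tape is its content together with the head position.\<close>

type_synonym tape = "(int \<Rightarrow> nat) \<times> int"
type_synonym config = "nat \<times> tape list"

fun tape_read :: "tape \<Rightarrow> nat" where
  "tape_read (f, h) = f h"

fun tape_act :: "nat \<times> move \<Rightarrow> tape \<Rightarrow> tape" where
  "tape_act (s, m) (f, h) =
    (f(h := s), case m of Move_Left \<Rightarrow> h - 1 | Move_Stay \<Rightarrow> h | Move_Right \<Rightarrow> h + 1)"

fun tm_step :: "tm \<Rightarrow> config \<Rightarrow> config" where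
  "tm_step M (q, ts) = (let (q', acts) = delta M q (map tape_read ts) in (q', map2 tape_act acts ts))"

definition word_at :: "int \<Rightarrow> nat list \<Rightarrow> int \<Rightarrow> nat" where
  "word_at a w = (\<lambda>i. if a \<le> i \<and> i < a + int (length w) then w ! nat (i - a) else 0)"

definition tape_holds :: "tape \<Rightarrow> nat list \<Rightarrow> bool" where
  "tape_holds t w \<longleftrightarrow> (\<exists>a. fst t = word_at a w)"

definition tm_init :: "tm \<Rightarrow> nat list \<Rightarrow> config" where
  "tm_init M w = (start M, (word_at 0 w, 0) # replicate (tapes M - 1) (\<lambda>_. 0, 0))"

definition tm_config :: "tm \<Rightarrow> nat list \<Rightarrow> nat \<Rightarrow> config" where
  "tm_config M w t = (tm_step M ^^ t) (tm_init M w)"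

definition tm_halts_at :: "tm \<Rightarrow> nat list \<Rightarrow> nat \<Rightarrow> bool" where
  "tm_halts_at M w T \<longleftrightarrow>
     fst (tm_config M w T) = halt M \<and> (\<forall>t<T. fst (tm_config M w t) \<noteq> halt M)"

text \<open>The number of cells visited up to time \<open>T\<close>, over all tapes, the input tape included.\<close>

definition tm_space :: "tm \<Rightarrow> nat list \<Rightarrow> nat \<Rightarrow> nat" where
  "tm_space M w T = (\<Sum>i<tapes M. card ((\<lambda>t. snd (snd (tm_config M w t) ! i)) ` {..T}))"

text \<open>Symbols: \<open>0\<close> blank, \<open>1\<close> the digit zero, \<open>2\<close> the digit one, \<open>3\<close> the minus sign, \<open>4\<close> end of a
  number, \<open>5\<close> end of a row, \<open>6\<close> end of a matrix.\<close>

fun enc_nat :: "nat \<Rightarrow> nat list" where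
  "enc_nat n = (if n < 2 then [n + 1] else enc_nat (n div 2) @ [n mod 2 + 1])"

declare enc_nat.simps [simp del]

definition enc_int :: "int \<Rightarrow> nat list" where
  "enc_int k = (if k < 0 then [3] else []) @ enc_nat (nat \<bar>k\<bar>)"

definition enc_mat :: "int mat \<Rightarrow> nat list" where
  "enc_mat A =
     concat (map (\<lambda>r. concat (map (\<lambda>k. enc_int k @ [4]) (list_of_vec r)) @ [5]) (rows A)) @ [6]"

definition enc_pair :: "int mat \<Rightarrow> int mat \<Rightarrow> nat list" where
  "enc_pair A B = enc_mat A @ enc_mat B"

definition enc_input :: "int mat \<Rightarrow> int mat \<Rightarrow> nat \<Rightarrow> nat list" where
  "enc_input A B v = enc_pair A B @ enc_nat v"

definition enc_path :: "path \<Rightarrow> nat list" where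
  "enc_path p = concat (map (\<lambda>v. enc_nat v @ [4]) p)"

definition pair_size :: "int mat \<Rightarrow> int mat \<Rightarrow> nat" where
  "pair_size A B = length (enc_pair A B)"

definition int_size :: "int \<Rightarrow> nat" where
  "int_size k = length (enc_int k)"

text \<open>Each program point at which snapshots are taken is a control state of the machine of its
  own, given by \<open>mark\<close>. Tapes \<open>1\<close>, \<open>2\<close>, \<open>3\<close> hold the variables \<open>p\<close>, \<open>c\<close>, \<open>N\<close> of the procedure;
  tape \<open>0\<close> is the input tape, and further tapes are work tapes. The machine executes the procedure
  if its successive configurations in marked states are exactly the snapshots of the procedure.\<close>

datatype point = At_Faithful_Path | At_Faithful_Cycle | At_Order_Path | At_Order_Return

fun snapshot_point :: "snapshot \<Rightarrow> point" where
  "snapshot_point (Faithful_Path p) = At_Faithful_Path"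
| "snapshot_point (Faithful_Cycle p c) = At_Faithful_Cycle"
| "snapshot_point (Order_Path p N) = At_Order_Path"
| "snapshot_point (Order_Return N) = At_Order_Return"

fun tapes_show :: "tape list \<Rightarrow> snapshot \<Rightarrow> bool" where
  "tapes_show ts (Faithful_Path p) \<longleftrightarrow> tape_holds (ts ! 1) (enc_path p)"
| "tapes_show ts (Faithful_Cycle p c) \<longleftrightarrow>
     tape_holds (ts ! 1) (enc_path p) \<and> tape_holds (ts ! 2) (enc_path c)"
| "tapes_show ts (Order_Path p N) \<longleftrightarrow>
     tape_holds (ts ! 1) (enc_path p) \<and> tape_holds (ts ! 3) (enc_int N)"
| "tapes_show ts (Order_Return N) \<longleftrightarrow> tape_holds (ts ! 3) (enc_int N)"

definition tm_executes ::
    "tm \<Rightarrow> (point \<Rightarrow> nat) \<Rightarrow> nat list \<Rightarrow> nat \<Rightarrow> snapshot list \<Rightarrow> bool" where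
  "tm_executes M mark w T tr \<longleftrightarrow>
     list_all2 (\<lambda>(q, ts) s. q = mark (snapshot_point s) \<and> tapes_show ts s)
       (filter (\<lambda>(q, ts). q \<in> range mark) (map (tm_config M w) [0..<Suc T])) tr"

end

theory Submission
  imports Defs
begin

text \<open>The size bound is a matter of divisibility. A simple path uses an edge at most once, so \<open>A\<^sub>p\<close>
  divides the product of all nonzero entries of \<open>A\<close>. Every value of \<open>N\<close> is a least common multiple
  of divisors of such numbers, hence divides that product as well, and its length is polynomial.

  For the machine only space counts, and time may be wasted without limit. A register machine that
  can do no more than reset, increment and compare natural numbers works in polynomial space as
  soon as all numbers that occur are below \<open>2 ^ L\<close> for a polynomial \<open>L\<close>, since a tape with a
  number in binary then has at most \<open>L\<close> cells in use. The proof therefore separates three tasks.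

  The first is the passage from register programs to Turing machines. A small while language is
  compiled to jump instructions, each instruction is carried out by a few control states, and
  \<open>exec_runs\<close> shows that every execution in which the numbers stay below \<open>2 ^ L\<close> is followed by the
  machine with all heads staying within distance \<open>L + 1\<close> of their origin. On top of this language
  all arithmetic is primitive recursion, compiled once and for all in \<open>exec_compile_exp\<close>; the
  predicate \<open>below\<close> records that no intermediate value reaches the bound.

  The second is the enumeration of simple paths and simple cycles in lexicographic order. A vertex
  sequence is read as a number in base \<open>n + 1\<close>, the vertex \<open>u\<close> giving the digit \<open>u + 1\<close>, and is
  padded with zeros at the end to \<open>n + 1\<close> digits. The numeric order of these codes is the
  lexicographic order of the sequences (\<open>padded_code_mono\<close>), so the loops of the procedure become
  loops over an interval of numbers that skip all numbers failing a test: \<open>path_codes\<close> and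
  \<open>cycle_codes\<close>. The test is arithmetic because a path is simple iff its vertices are distinct
  (\<open>simple_path_iff\<close>), and a cycle is simple iff its vertices after the first are distinct
  (\<open>simple_cycle_iff\<close>).

  The third is the update of \<open>N\<close>. The number \<open>lcm N (a div gcd a b)\<close> is the least positive multiple
  \<open>r\<close> of \<open>N\<close> for which \<open>a\<close> divides \<open>r * b\<close>, and it is found by trying the multiples of \<open>N\<close> in turn.

  The procedure uses \<open>B\<close> only through divisibility and absolute values, so the machine computes with
  natural numbers throughout. All entries are held in a single number, as digits in a base
  \<open>D = 2 ^ length w\<close> that exceeds every entry because \<open>w\<close> contains its binary expansion.\<close>


section \<open>Binary numbers on tapes\<close>

text \<open>Numbers grow at their most significant end, so the tape content of a register is anchored at cell
  \<open>0\<close>, where the least significant digit stands, and extends to the left. The home position of the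
  head is then independent of the number. Output words are built from their last symbol in the same
  way, with the head on the blank cell to the left of the word.\<close>

definition left_word :: "nat list \<Rightarrow> int \<Rightarrow> nat" where
  "left_word l = (\<lambda>i. if i \<le> 0 \<and> nat (- i) < length l then l ! nat (- i) else 0)"

lemma left_word_nth: "j < length l \<Longrightarrow> left_word l (- int j) = l ! j"
  by (simp add: left_word_def)

lemma left_word_beyond: "length l \<le> j \<Longrightarrow> left_word l (- int j) = 0"
  by (simp add: left_word_def)

lemma left_word_pos: "0 < i \<Longrightarrow> left_word l i = 0"
  by (simp add: left_word_def)

lemma left_word_Nil: "left_word [] = (\<lambda>_. 0)"
  by (simp add: left_word_def fun_eq_iff)

lemma left_word_update: "j < length l \<Longrightarrow> (left_word l)(- int j := s) = left_word (l[j := s])"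
  by (auto simp: left_word_def fun_eq_iff nth_list_update)

lemma left_word_append: "(left_word l)(- int (length l) := s) = left_word (l @ [s])"
  by (auto simp: left_word_def fun_eq_iff nth_append)

lemma left_word_erase: "(left_word (l @ [s]))(- int (length l) := 0) = left_word l"
  by (auto simp: left_word_def fun_eq_iff nth_append)

lemma word_at_rev: "word_at (1 - int (length l)) (rev l) = left_word l"
proof
  fix i :: int
  show "word_at (1 - int (length l)) (rev l) i = left_word l i"
  proof (cases "1 - int (length l) \<le> i \<and> i \<le> 0")
    case True
    then have "nat (i - (1 - int (length l))) < length l" by linarith
    moreover have "length l - Suc (nat (i - (1 - int (length l)))) = nat (- i)"
      using True by linarith
    ultimately show ?thesis using True by (auto simp: word_at_def left_word_def rev_nth)
  next
    case False
    then show ?thesis by (auto simp: word_at_def left_word_def)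
  qed
qed

lemma tape_holds_left_word: "tape_holds (left_word l, h) (rev l)"
  unfolding tape_holds_def by (metis fst_conv word_at_rev)

text \<open>The digits of the standard encoding, least significant digit first.\<close>

definition bits :: "nat \<Rightarrow> nat list" where "bits m = rev (enc_nat m)"

lemma bits_small: "m < 2 \<Longrightarrow> bits m = [Suc m]"
  by (simp add: bits_def enc_nat.simps)

lemma bits_large: "2 \<le> m \<Longrightarrow> bits m = Suc (m mod 2) # bits (m div 2)"
  by (simp add: bits_def enc_nat.simps[of m])

lemma bits_digits: "set (bits m) \<subseteq> {1, 2}"
proof (induction m rule: less_induct)
  case (less m)
  show ?case
  proof (cases "m < 2")
    case True
    then show ?thesis by (auto simp: bits_small)
  next
    case False
    then show ?thesis using less[of "m div 2"] by (auto simp: bits_large)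
  qed
qed

lemma bits_nonblank: "0 \<notin> set (bits m)"
  using bits_digits[of m] by auto

lemma nth_nonblank: "(0::nat) \<notin> set l \<Longrightarrow> j < length l \<Longrightarrow> 0 < l ! j"
  by (metis gr0I nth_mem)

lemma bits_ne: "bits m \<noteq> []"
  by (cases "m < 2") (auto simp: bits_small bits_large)

fun increment :: "nat list \<Rightarrow> nat list" where
  "increment [] = [2]"
| "increment (s # l) = (if s = 2 then 1 # increment l else 2 # l)"

lemma bits_Suc: "bits (Suc m) = increment (bits m)"
proof (induction m rule: less_induct)
  case (less m)
  show ?case
  proof (cases "m < 2")
    case True
    then consider "m = 0" | "m = 1" by linarith
    then show ?thesis by cases (simp_all add: bits_small bits_large)
  next
    case False
    show ?thesis
    proof (cases "even m")
      case True
      then show ?thesis using False by (simp add: bits_large mod2_eq_if)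
    next
      case odd: False
      have "bits (Suc (m div 2)) = increment (bits (m div 2))" using less False by simp
      then show ?thesis using False odd by (simp add: bits_large odd_iff_mod_2_eq_one)
    qed
  qed
qed

lemma bits_inj: "bits a = bits b \<Longrightarrow> a = b"
proof (induction a arbitrary: b rule: less_induct)
  case (less a)
  have l1: "length (bits m) = 1 \<longleftrightarrow> m < 2" for m
    by (cases "m < 2") (auto simp: bits_small bits_large bits_ne)
  show ?case
  proof (cases "a < 2")
    case True
    then have "b < 2" using less.prems l1 by metis
    then show ?thesis using True less.prems by (simp add: bits_small)
  next
    case False
    then have "\<not> b < 2" using less.prems l1 by metis
    then have "a mod 2 = b mod 2" "a div 2 = b div 2"
      using False less by (simp_all add: bits_large)
    then show ?thesis by (metis div_mult_mod_eq)
  qed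
qed

lemma length_bits: "m < 2 ^ L \<Longrightarrow> 1 \<le> L \<Longrightarrow> length (bits m) \<le> L"
proof (induction L arbitrary: m)
  case 0
  then show ?case by simp
next
  case (Suc L)
  show ?case
  proof (cases "m < 2")
    case True
    then show ?thesis by (simp add: bits_small)
  next
    case False
    then have "L \<noteq> 0" using Suc.prems by (cases L) auto
    then show ?thesis using Suc False by (auto simp: bits_large)
  qed
qed


section \<open>A while language over registers\<close>

datatype cond = Eq nat nat | In nat

text \<open>\<open>EmitReg t r\<close> and \<open>Emit t a\<close> extend the word on the output tape \<open>t\<close> at its left end by the
  encoding of register \<open>r\<close> and by the symbol \<open>a\<close>. \<open>Until\<close> tests its condition before each round.\<close>

datatype com =
    Skip
  | Zero nat
  | Inc nat
  | EmitReg nat nat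
  | Emit nat nat
  | Clear nat
  | Next
  | Prev
  | Mark point
  | Seq com com (infixr ";;" 60)
  | If cond com com
  | Until cond com

text \<open>A state consists of the registers, the head position on the input tape and the output words, the
  latter in the order in which their symbols were emitted, that is, reversed.\<close>

type_synonym state = "(nat \<Rightarrow> nat) \<times> int \<times> (nat \<Rightarrow> nat list)"

fun holds :: "nat list \<Rightarrow> state \<Rightarrow> cond \<Rightarrow> bool" where
  "holds w (R, p, W) (Eq x y) \<longleftrightarrow> R x = R y"
| "holds w (R, p, W) (In a) \<longleftrightarrow> word_at 0 w p = a"

fun shows_snapshot :: "state \<Rightarrow> snapshot \<Rightarrow> bool" where
  "shows_snapshot (R, p, W) (Faithful_Path q) \<longleftrightarrow> rev (W 1) = enc_path q"
| "shows_snapshot (R, p, W) (Faithful_Cycle q c) \<longleftrightarrow> rev (W 1) = enc_path q \<and> rev (W 2) = enc_path c"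
| "shows_snapshot (R, p, W) (Order_Path q N) \<longleftrightarrow> rev (W 1) = enc_path q \<and> int (R 0) = N"
| "shows_snapshot (R, p, W) (Order_Return N) \<longleftrightarrow> int (R 0) = N"

text \<open>The parameter \<open>L\<close> is the space allowance. An increment that would reach \<open>2 ^ L\<close> and an output that
  would exceed length \<open>L\<close> have no rule, so that an execution carries its space bound with it. The
  list of snapshots contains one valid description of the state for every \<open>Mark\<close> that is passed.\<close>

inductive exec :: "nat list \<Rightarrow> nat \<Rightarrow> com \<Rightarrow> state \<Rightarrow> snapshot list \<Rightarrow> state \<Rightarrow> bool"
  for w :: "nat list" and L :: nat where
  Skip: "exec w L Skip s [] s"
| Zero: "exec w L (Zero r) (R, p, W) [] (R(r := 0), p, W)"
| Inc: "Suc (R r) < 2 ^ L \<Longrightarrow> exec w L (Inc r) (R, p, W) [] (R(r := Suc (R r)), p, W)"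
| EmitReg: "length (W t) + length (bits (R r)) \<le> L \<Longrightarrow>
    exec w L (EmitReg t r) (R, p, W) [] (R, p, W(t := W t @ bits (R r)))"
| Emit: "0 < a \<Longrightarrow> length (W t) < L \<Longrightarrow> exec w L (Emit t a) (R, p, W) [] (R, p, W(t := W t @ [a]))"
| Clear: "exec w L (Clear t) (R, p, W) [] (R, p, W(t := []))"
| Next: "p < int (length w) \<Longrightarrow> exec w L Next (R, p, W) [] (R, p + 1, W)"
| Prev: "0 \<le> p \<Longrightarrow> exec w L Prev (R, p, W) [] (R, p - 1, W)"
| Mark: "shows_snapshot s sn \<Longrightarrow> exec w L (Mark (snapshot_point sn)) s [sn] s"
| Seq: "exec w L c s tr s' \<Longrightarrow> exec w L d s' tr' s'' \<Longrightarrow> exec w L (c ;; d) s (tr @ tr') s''"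
| If_True: "holds w s b \<Longrightarrow> exec w L c s tr s' \<Longrightarrow> exec w L (If b c d) s tr s'"
| If_False: "\<not> holds w s b \<Longrightarrow> exec w L d s tr s' \<Longrightarrow> exec w L (If b c d) s tr s'"
| Until_True: "holds w s b \<Longrightarrow> exec w L (Until b c) s [] s"
| Until_False: "\<not> holds w s b \<Longrightarrow> exec w L c s tr s' \<Longrightarrow> exec w L (Until b c) s' tr' s'' \<Longrightarrow>
    exec w L (Until b c) s (tr @ tr') s''"

fun capped :: "nat \<Rightarrow> state \<Rightarrow> bool" where
  "capped L (R, p, W) \<longleftrightarrow> (\<forall>r. R r < 2 ^ L) \<and> (\<forall>t. length (W t) \<le> L \<and> 0 \<notin> set (W t)) \<and> - 1 \<le> p \<and> p \<le> int L"

lemma exec_capped: "exec w L c s tr s' \<Longrightarrow> length w \<le> L \<Longrightarrow> capped L s \<Longrightarrow> capped L s'"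
  by (induction rule: exec.induct) (auto simp: bits_nonblank)

datatype instr =
    IZero nat
  | IInc nat
  | IEmitReg nat nat
  | IEmit nat nat
  | IClear nat
  | INext
  | IPrev
  | IMark point
  | ITest cond nat
  | IJump nat

primrec code_length :: "com \<Rightarrow> nat" where
  "code_length Skip = 0"
| "code_length (Zero r) = 1"
| "code_length (Inc r) = 1"
| "code_length (EmitReg t r) = 1"
| "code_length (Emit t a) = 1"
| "code_length (Clear t) = 1"
| "code_length Next = 1"
| "code_length Prev = 1"
| "code_length (Mark pt) = 1"
| "code_length (c ;; d) = code_length c + code_length d"
| "code_length (If b c d) = code_length c + code_length d + 2"
| "code_length (Until b c) = code_length c + 3"

text \<open>In \<^term>\<open>ITest b j\<close> control falls through if \<^term>\<open>b\<close> holds and jumps to \<^term>\<open>j\<close> otherwise.\<close>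

primrec compile :: "com \<Rightarrow> nat \<Rightarrow> instr list" where
  "compile Skip a = []"
| "compile (Zero r) a = [IZero r]"
| "compile (Inc r) a = [IInc r]"
| "compile (EmitReg t r) a = [IEmitReg t r]"
| "compile (Emit t s) a = [IEmit t s]"
| "compile (Clear t) a = [IClear t]"
| "compile Next a = [INext]"
| "compile Prev a = [IPrev]"
| "compile (Mark pt) a = [IMark pt]"
| "compile (c ;; d) a = compile c a @ compile d (a + code_length c)"
| "compile (If b c d) a =
    [ITest b (a + code_length c + 2)] @ compile c (a + 1) @
    [IJump (a + code_length c + code_length d + 2)] @ compile d (a + code_length c + 2)"
| "compile (Until b c) a =
    [ITest b (a + 2), IJump (a + code_length c + 3)] @ compile c (a + 2) @ [IJump a]"

lemma length_compile [simp]: "length (compile c a) = code_length c"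
  by (induction c arbitrary: a) auto

primrec max_reg :: "com \<Rightarrow> nat" where
  "max_reg Skip = 0"
| "max_reg (Zero r) = r"
| "max_reg (Inc r) = r"
| "max_reg (EmitReg t r) = r"
| "max_reg (Emit t a) = 0"
| "max_reg (Clear t) = 0"
| "max_reg Next = 0"
| "max_reg Prev = 0"
| "max_reg (Mark pt) = 0"
| "max_reg (c ;; d) = max (max_reg c) (max_reg d)"
| "max_reg (If b c d) = max (case b of Eq x y \<Rightarrow> max x y | In a \<Rightarrow> 0) (max (max_reg c) (max_reg d))"
| "max_reg (Until b c) = max (case b of Eq x y \<Rightarrow> max x y | In a \<Rightarrow> 0) (max_reg c)"

definition cond_wf :: "cond \<Rightarrow> bool" where
  "cond_wf b \<longleftrightarrow> (case b of Eq x y \<Rightarrow> x \<noteq> y | In a \<Rightarrow> True)"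

primrec com_wf :: "com \<Rightarrow> bool" where
  "com_wf Skip = True"
| "com_wf (Zero r) = True"
| "com_wf (Inc r) = True"
| "com_wf (EmitReg t r) = (t \<in> {1, 2})"
| "com_wf (Emit t a) = (t \<in> {1, 2} \<and> 0 < a \<and> a < 7)"
| "com_wf (Clear t) = (t \<in> {1, 2})"
| "com_wf Next = True"
| "com_wf Prev = True"
| "com_wf (Mark pt) = True"
| "com_wf (c ;; d) = (com_wf c \<and> com_wf d)"
| "com_wf (If b c d) = (cond_wf b \<and> com_wf c \<and> com_wf d)"
| "com_wf (Until b c) = (cond_wf b \<and> com_wf c)"

fun instr_wf :: "nat \<Rightarrow> nat \<Rightarrow> instr \<Rightarrow> bool" where
  "instr_wf k len (IZero r) \<longleftrightarrow> 3 + r < k"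
| "instr_wf k len (IInc r) \<longleftrightarrow> 3 + r < k"
| "instr_wf k len (IEmitReg t r) \<longleftrightarrow> t \<in> {1, 2} \<and> 3 + r < k"
| "instr_wf k len (IEmit t a) \<longleftrightarrow> t \<in> {1, 2} \<and> 0 < a \<and> a < 7"
| "instr_wf k len (IClear t) \<longleftrightarrow> t \<in> {1, 2}"
| "instr_wf k len (ITest b j) \<longleftrightarrow>
    j \<le> len \<and> (case b of Eq x y \<Rightarrow> x \<noteq> y \<and> 3 + x < k \<and> 3 + y < k | In a \<Rightarrow> True)"
| "instr_wf k len (IJump j) \<longleftrightarrow> j \<le> len"
| "instr_wf k len i \<longleftrightarrow> True"

lemma compile_wf:
  assumes "com_wf c" "max_reg c + 3 < k" "a + code_length c \<le> len" "i \<in> set (compile c a)"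
  shows "instr_wf k len i"
  using assms
proof (induction c arbitrary: a)
  case (Seq c d)
  then show ?case using Seq.IH(1)[of a] Seq.IH(2)[of "a + code_length c"] by auto
next
  case (If b c d)
  then show ?case using If.IH(1)[of "a + 1"] If.IH(2)[of "a + code_length c + 2"]
    by (cases b) (auto simp: cond_wf_def)
next
  case (Until b c)
  then show ?case using Until.IH[of "a + 2"] by (cases b) (auto simp: cond_wf_def)
qed auto

text \<open>The control state of a program point must be unique. This is ensured by a count of its marks.\<close>

primrec mark_count :: "point \<Rightarrow> com \<Rightarrow> nat" where
  "mark_count pt Skip = 0"
| "mark_count pt (Zero r) = 0"
| "mark_count pt (Inc r) = 0"
| "mark_count pt (EmitReg t r) = 0"
| "mark_count pt (Emit t a) = 0"
| "mark_count pt (Clear t) = 0"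
| "mark_count pt Next = 0"
| "mark_count pt Prev = 0"
| "mark_count pt (Mark pt') = (if pt = pt' then 1 else 0)"
| "mark_count pt (c ;; d) = mark_count pt c + mark_count pt d"
| "mark_count pt (If b c d) = mark_count pt c + mark_count pt d"
| "mark_count pt (Until b c) = mark_count pt c"

lemma mark_count_compile:
  "length (filter ((=) (IMark pt)) (compile c a)) = mark_count pt c"
  by (induction c arbitrary: a) auto


section \<open>The Turing machine of a list of instructions\<close>

text \<open>An instruction is carried out in up to three phases; the control state for instruction \<^term>\<open>pc\<close> in phase \<^term>\<open>ph\<close> is
  \<^term>\<open>4 * pc + ph\<close>.\<close>

fun instr_step :: "instr \<Rightarrow> nat \<Rightarrow> nat \<Rightarrow> nat list \<Rightarrow> nat \<times> nat \<times> (nat \<Rightarrow> (nat \<times> move) option)" where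
  "instr_step (IZero r) pc ph ss =
    (let s = ss ! (3 + r) in
     if ph = 0 then (if s = 0 then (pc, 1, [3 + r \<mapsto> (0, Move_Right)]) else (pc, 0, [3 + r \<mapsto> (s, Move_Left)]))
     else if ph = 1 then (if s = 0 then (pc, 2, [3 + r \<mapsto> (0, Move_Left)]) else (pc, 1, [3 + r \<mapsto> (0, Move_Right)]))
     else (Suc pc, 0, [3 + r \<mapsto> (1, Move_Stay)]))"
| "instr_step (IInc r) pc ph ss =
    (let s = ss ! (3 + r) in
     if ph = 0 then (if s = 2 then (pc, 0, [3 + r \<mapsto> (1, Move_Left)]) else (pc, 1, [3 + r \<mapsto> (2, Move_Right)]))
     else (if s = 0 then (Suc pc, 0, [3 + r \<mapsto> (0, Move_Left)]) else (pc, 1, [3 + r \<mapsto> (s, Move_Right)])))"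
| "instr_step (IEmitReg t r) pc ph ss =
    (let s = ss ! (3 + r) in
     if ph = 0 then (if s = 0 then (pc, 1, [3 + r \<mapsto> (0, Move_Right)])
                     else (pc, 0, [t \<mapsto> (s, Move_Left), 3 + r \<mapsto> (s, Move_Left)]))
     else (if s = 0 then (Suc pc, 0, [3 + r \<mapsto> (0, Move_Left)]) else (pc, 1, [3 + r \<mapsto> (s, Move_Right)])))"
| "instr_step (IEmit t a) pc ph ss = (Suc pc, 0, [t \<mapsto> (a, Move_Left)])"
| "instr_step (IClear t) pc ph ss =
    (let s = ss ! t in
     if ph = 0 then (pc, 1, [t \<mapsto> (s, Move_Right)])
     else (if s = 0 then (Suc pc, 0, [t \<mapsto> (0, Move_Left)]) else (pc, 1, [t \<mapsto> (0, Move_Right)])))"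
| "instr_step INext pc ph ss = (Suc pc, 0, [0 \<mapsto> (ss ! 0, Move_Right)])"
| "instr_step IPrev pc ph ss = (Suc pc, 0, [0 \<mapsto> (ss ! 0, Move_Left)])"
| "instr_step (IMark pt) pc ph ss = (Suc pc, 0, Map.empty)"
| "instr_step (ITest (In a) j) pc ph ss = (if ss ! 0 = a then (Suc pc, 0, Map.empty) else (j, 0, Map.empty))"
| "instr_step (ITest (Eq x y) j) pc ph ss =
    (let s = ss ! (3 + x); s' = ss ! (3 + y) in
     if ph = 0 then
       (if s = s' \<and> s \<noteq> 0 then (pc, 0, [3 + x \<mapsto> (s, Move_Left), 3 + y \<mapsto> (s', Move_Left)])
        else (pc, if s = s' then 1 else 2, [3 + x \<mapsto> (s, Move_Right), 3 + y \<mapsto> (s', Move_Right)]))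
     else
       (if s \<noteq> 0 then (pc, ph, [3 + x \<mapsto> (s, Move_Right), 3 + y \<mapsto> (s', Move_Right)])
        else (if ph = 1 then Suc pc else j, 0, [3 + x \<mapsto> (s, Move_Left), 3 + y \<mapsto> (s', Move_Left)])))"
| "instr_step (IJump j) pc ph ss = (j, 0, Map.empty)"

definition tape_acts :: "nat list \<Rightarrow> (nat \<Rightarrow> (nat \<times> move) option) \<Rightarrow> (nat \<times> move) list" where
  "tape_acts ss u = map (\<lambda>i. case u i of None \<Rightarrow> (ss ! i, Move_Stay) | Some a \<Rightarrow> a) [0..<length ss]"

text \<open>Before the first instruction one step writes a digit zero on every register tape.\<close>

definition initial_acts :: "nat \<Rightarrow> (nat \<times> move) option" where
  "initial_acts i = (if 3 \<le> i then Some (1, Move_Stay) else None)"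

definition machine :: "nat \<Rightarrow> instr list \<Rightarrow> tm" where
  "machine k code =
    \<lparr> tapes = k, states = 4 * length code + 1, symbols = 7, start = 4 * length code,
      halt = 4 * (length code - 1),
      delta = (\<lambda>q ss. if q < 4 * length code
        then (case instr_step (code ! (q div 4)) (q div 4) (q mod 4) ss of
               (pc, ph, u) \<Rightarrow> (4 * pc + ph, tape_acts ss u))
        else (0, tape_acts ss initial_acts)) \<rparr>"

text \<open>Only sensible if the instruction \<open>IMark pt\<close> occurs exactly once.\<close>

definition mark_position :: "instr list \<Rightarrow> point \<Rightarrow> nat" where
  "mark_position code pt = (THE i. i < length code \<and> code ! i = IMark pt)"

lemma instr_step_bounds:
  assumes "instr_step i pc ph ss = (pc', ph', u)" "instr_wf k len i" "pc < len" "ph < 4"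
  shows "4 * pc' + ph' < 4 * len + 1"
proof -
  have "pc' < len \<and> ph' < 4 \<or> pc' \<le> len \<and> ph' = 0"
    using assms
    by (cases "(i, pc, ph, ss)" rule: instr_step.cases) (auto simp: Let_def split: if_splits)
  then show ?thesis by linarith
qed

lemma instr_step_symbols:
  assumes "instr_step i pc ph ss = (pc', ph', u)" "instr_wf (length ss) len i"
    and "3 < length ss" "set ss \<subseteq> {..<7}" "u t = Some a"
  shows "fst a < 7"
proof -
  have read: "ss ! t < 7" if "t < length ss" for t using assms(4) that nth_mem by blast
  have "ss ! 0 < 7" using read[of 0] assms(3) by (cases ss) auto
  then show ?thesis
    using assms(1-3,5) read
    by (cases "(i, pc, ph, ss)" rule: instr_step.cases)
      (auto simp: Let_def split: if_splits)
qed

lemma length_tape_acts [simp]: "length (tape_acts ss u) = length ss"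
  by (simp add: tape_acts_def)

lemma machine_wf:
  assumes "code \<noteq> []" "3 < k" "\<And>i. i \<in> set code \<Longrightarrow> instr_wf k (length code) i"
  shows "tm_wf (machine k code)"
proof -
  have key: "q' < 4 * length code + 1 \<and> length acts = k \<and> fst ` set acts \<subseteq> {..<7}"
    if q: "q < 4 * length code + 1" and ss: "length ss = k" "set ss \<subseteq> {..<7}"
      and d: "delta (machine k code) q ss = (q', acts)" for q ss q' acts
  proof -
    have read: "ss ! t < 7" if "t < k" for t using ss that nth_mem by blast
    have acts: "fst ` set (tape_acts ss u) \<subseteq> {..<7}"
      if "\<And>t a. u t = Some a \<Longrightarrow> fst a < 7" for u
      using that read ss by (auto simp: tape_acts_def split: option.splits)
    have init: "fst a < 7" if "initial_acts t = Some a" for t a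
      using that by (auto simp: initial_acts_def split: if_splits)
    show ?thesis
    proof (cases "q < 4 * length code")
      case True
      obtain pc ph u where st: "instr_step (code ! (q div 4)) (q div 4) (q mod 4) ss = (pc, ph, u)"
        by (metis prod_cases3)
      have len: "q div 4 < length code" using True by auto
      then have wf: "instr_wf k (length code) (code ! (q div 4))" using assms(3) by simp
      have "4 * pc + ph < 4 * length code + 1"
        using instr_step_bounds[OF st wf len] by simp
      moreover have "fst a < 7" if "u t = Some a" for t a
        using instr_step_symbols[OF st _ _ ss(2) that] wf ss(1) assms(2) by simp
      ultimately show ?thesis
        using d True st acts[of u] ss(1) by (auto simp: machine_def)
    next
      case False
      then show ?thesis
        using d acts[of initial_acts, OF init] ss(1) by (auto simp: machine_def)
    qed
  qed
  have fields: "tapes (machine k code) = k" "symbols (machine k code) = 7"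
    "states (machine k code) = 4 * length code + 1" "start (machine k code) = 4 * length code"
    "halt (machine k code) = 4 * (length code - 1)"
    by (simp_all add: machine_def)
  show ?thesis
    unfolding tm_wf_def fields
  proof (intro conjI allI impI; (elim conjE)?)
    fix q ss q' acts
    assume "q < 4 * length code + 1" "length ss = k" "set ss \<subseteq> {..<7}"
      "delta (machine k code) q ss = (q', acts)"
    from key[OF this] show "q' < 4 * length code + 1" "length acts = k" "fst ` set acts \<subseteq> {..<7}"
      by blast+
  qed (use assms(1,2) in auto)
qed

section \<open>Simulation of programs by the machine\<close>

text \<open>In proofs the list of tapes is replaced by a function on tape numbers, on which an instruction acts
  by function update.\<close>

definition conf :: "nat \<Rightarrow> nat \<Rightarrow> (nat \<Rightarrow> tape) \<Rightarrow> config" where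
  "conf k q g = (q, map g [0..<k])"

definition update_tapes :: "(nat \<Rightarrow> (nat \<times> move) option) \<Rightarrow> (nat \<Rightarrow> tape) \<Rightarrow> nat \<Rightarrow> tape" where
  "update_tapes u g = (\<lambda>i. case u i of None \<Rightarrow> g i | Some a \<Rightarrow> tape_act a (g i))"

lemma update_tapes_empty [simp]: "update_tapes Map.empty g = g"
  by (simp add: update_tapes_def)

lemma update_tapes_one [simp]: "update_tapes [t \<mapsto> a] g = g(t := tape_act a (g t))"
  by (auto simp: update_tapes_def)

lemma update_tapes_two [simp]:
  "t \<noteq> t' \<Longrightarrow> update_tapes [t \<mapsto> a, t' \<mapsto> a'] g = g(t := tape_act a (g t), t' := tape_act a' (g t'))"
  by (auto simp: update_tapes_def)

lemma tape_act_read [simp]: "tape_act (tape_read x, Move_Stay) x = x"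
  by (cases x) (simp add: tape_act.simps)

definition moved :: "move \<Rightarrow> int \<Rightarrow> int" where
  "moved m p = (case m of Move_Left \<Rightarrow> p - 1 | Move_Stay \<Rightarrow> p | Move_Right \<Rightarrow> p + 1)"

lemma moved_simps [simp]: "moved Move_Left p = p - 1" "moved Move_Stay p = p" "moved Move_Right p = p + 1"
  by (simp_all add: moved_def)

lemma tape_act_write: "f(h := s) = f' \<Longrightarrow> tape_act (s, m) (f, h) = (f', moved m h)"
  by (cases m) auto

lemma tape_act_keep: "f h = s \<Longrightarrow> tape_act (s, m) (f, h) = (f, moved m h)"
  by (rule tape_act_write) (rule fun_upd_idem)

declare tape_act.simps [simp del]

lemma map2_tape_acts:
  "map2 tape_act (tape_acts (map (tape_read \<circ> g) [0..<k]) u) (map g [0..<k]) =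
    map (update_tapes u g) [0..<k]"
  by (rule nth_equalityI) (auto simp: tape_acts_def update_tapes_def split: option.splits)

definition mark_state :: "instr list \<Rightarrow> point \<Rightarrow> nat" where
  "mark_state code pt = 4 * mark_position code pt"

locale simulation =
  fixes w :: "nat list" and L k :: nat and code :: "instr list"
  assumes code_wf: "\<And>i. i \<in> set code \<Longrightarrow> instr_wf k (length code) i"
    and three_tapes: "3 < k"
    and L_pos: "1 \<le> L"
    and input_length: "length w \<le> L"
    and mark_unique: "\<And>pt. \<exists>!i. i < length code \<and> code ! i = IMark pt"
    and code_last: "code \<noteq> []" "last code = IMark At_Order_Return"
begin

abbreviation M where "M \<equiv> machine k code"
abbreviation mark where "mark \<equiv> mark_state code"

lemma mark_eq: "pc < length code \<Longrightarrow> code ! pc = IMark pt \<Longrightarrow> mark pt = 4 * pc"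
  using the1_equality[OF mark_unique] by (simp add: mark_state_def mark_position_def)

lemma mark_position_nth: "mark_position code pt < length code \<and> code ! mark_position code pt = IMark pt"
  unfolding mark_position_def by (rule theI'[OF mark_unique])

lemma mark_inj: "inj mark"
proof (rule injI)
  fix a b assume "mark a = mark b"
  then have "mark_position code a = mark_position code b" by (simp add: mark_state_def)
  then show "a = b" using mark_position_nth[of a] mark_position_nth[of b] by (metis instr.inject)
qed

lemma mark_halt: "mark At_Order_Return = halt M"
  using mark_eq[of "length code - 1"] code_last by (simp add: last_conv_nth machine_def)

lemma unmarked:
  assumes "pc < length code" "ph < 4" "ph \<noteq> 0 \<or> (\<forall>pt. code ! pc \<noteq> IMark pt)"
  shows "4 * pc + ph \<notin> range mark"
proof
  assume "4 * pc + ph \<in> range mark"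
  then obtain pt where "4 * pc + ph = 4 * mark_position code pt" by (auto simp: mark_state_def)
  then have "pc = mark_position code pt" "ph = 0" using assms(2) by presburger+
  then show False using assms mark_position_nth[of pt] by auto
qed

definition bounded :: "config \<Rightarrow> bool" where
  "bounded c \<longleftrightarrow> length (snd c) = k \<and> (\<forall>x \<in> set (snd c). \<bar>snd x\<bar> \<le> int L + 1)"

definition bounded_tapes :: "(nat \<Rightarrow> tape) \<Rightarrow> bool" where
  "bounded_tapes g \<longleftrightarrow> (\<forall>i<k. \<bar>snd (g i)\<bar> \<le> int L + 1)"

lemma bounded_conf: "bounded (conf k q g) \<longleftrightarrow> bounded_tapes g"
  by (auto simp: bounded_def bounded_tapes_def conf_def)

lemma bounded_tapes_upd [simp]:
  "bounded_tapes g \<Longrightarrow> \<bar>snd x\<bar> \<le> int L + 1 \<Longrightarrow> bounded_tapes (g(t := x))"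
  by (simp add: bounded_tapes_def)

text \<open>Runs of the machine in which all configurations but the last are bounded and have not halted, and
  the marked ones among them are described by the given snapshots.\<close>

inductive runs :: "config \<Rightarrow> snapshot list \<Rightarrow> config \<Rightarrow> bool" where
  refl: "runs c [] c"
| silent: "fst c \<notin> range mark \<Longrightarrow> bounded c \<Longrightarrow> runs (tm_step M c) sns c' \<Longrightarrow> runs c sns c'"
| marked: "fst c = mark (snapshot_point sn) \<Longrightarrow> fst c \<noteq> halt M \<Longrightarrow> tapes_show (snd c) sn \<Longrightarrow>
    bounded c \<Longrightarrow> runs (tm_step M c) sns c' \<Longrightarrow> runs c (sn # sns) c'"

lemma runs_trans: "runs c sns c' \<Longrightarrow> runs c' sns' c'' \<Longrightarrow> runs c (sns @ sns') c''"
  by (induction rule: runs.induct) (auto intro: runs.intros)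

lemma runs_trans_silent: "runs c [] c' \<Longrightarrow> runs c' [] c'' \<Longrightarrow> runs c [] c''"
  using runs_trans[of c "[]" c' "[]"] by simp

lemma step_conf:
  assumes "pc < length code" "ph < 4"
    and "instr_step (code ! pc) pc ph (map (tape_read \<circ> g) [0..<k]) = (pc', ph', u)"
  shows "tm_step M (conf k (4 * pc + ph) g) = conf k (4 * pc' + ph') (update_tapes u g)"
proof -
  have "4 * pc + ph < 4 * length code" "(4 * pc + ph) div 4 = pc" "(4 * pc + ph) mod 4 = ph"
    using assms(1,2) by auto
  then have "delta M (4 * pc + ph) (map (tape_read \<circ> g) [0..<k]) =
      (4 * pc' + ph', tape_acts (map (tape_read \<circ> g) [0..<k]) u)"
    using assms(3) by (simp add: machine_def)
  then show ?thesis by (simp add: conf_def map2_tape_acts)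
qed

lemma runs_step:
  assumes "pc < length code" "ph < 4" "ph \<noteq> 0 \<or> (\<forall>pt. code ! pc \<noteq> IMark pt)"
    and "instr_step (code ! pc) pc ph (map (tape_read \<circ> g) [0..<k]) = (pc', ph', u)"
    and "bounded_tapes g" "update_tapes u g = g'" "q = 4 * pc + ph" "q' = 4 * pc' + ph'"
  shows "runs (conf k q g) [] (conf k q' g')"
proof (rule runs.silent)
  show "fst (conf k q g) \<notin> range mark" using unmarked[of pc ph] assms by (simp add: conf_def)
  show "bounded (conf k q g)" using assms by (simp add: bounded_conf)
  show "runs (tm_step M (conf k q g)) [] (conf k q' g')"
    using step_conf[OF assms(1,2,4)] assms(6-8) by (simp add: runs.refl)
qed

definition with_word :: "(nat \<Rightarrow> tape) \<Rightarrow> nat \<Rightarrow> nat list \<Rightarrow> int \<Rightarrow> nat \<Rightarrow> tape" where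
  "with_word g t l p = g(t := (left_word l, p))"

text \<open>The phase in which a head goes home: it moves right over the word to the blank cell \<open>1\<close> and then
  one step back. It ends the instructions for increment and output of a register.\<close>

lemma scan_right:
  assumes "pc < length code" "t < k" "bounded_tapes g"
    and step: "\<And>ss. instr_step (code ! pc) pc 1 ss =
      (if ss ! t = 0 then (Suc pc, 0, [t \<mapsto> (0, Move_Left)]) else (pc, 1, [t \<mapsto> (ss ! t, Move_Right)]))"
    and l: "0 \<notin> set l" "j \<le> length l" "length l \<le> L"
  shows "runs (conf k (4 * pc + 1) (with_word g t l (1 - int j))) []
    (conf k (4 * Suc pc) (with_word g t l 0))"
  using l(2)
proof (induction j)
  case 0
  show "runs (conf k (4 * pc + 1) (with_word g t l (1 - int 0))) []
    (conf k (4 * Suc pc) (with_word g t l 0))"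
    by (rule runs_step[of pc 1 _ "Suc pc" 0 "[t \<mapsto> (0, Move_Left)]"])
      (use assms in \<open>auto simp: with_word_def left_word_pos tape_act_keep\<close>)
next
  case (Suc j)
  have "runs (conf k (4 * pc + 1) (with_word g t l (1 - int (Suc j)))) []
     (conf k (4 * pc + 1) (with_word g t l (1 - int j)))"
  proof (rule runs_step[of pc 1 _ pc 1 "[t \<mapsto> (l ! j, Move_Right)]"])
    have "l ! j \<noteq> 0" using nth_nonblank[OF l(1), of j] Suc.prems by simp
    then show "instr_step (code ! pc) pc 1
      (map (tape_read \<circ> with_word g t l (1 - int (Suc j))) [0..<k]) =
      (pc, 1, [t \<mapsto> (l ! j, Move_Right)])"
      using Suc.prems assms(2) step left_word_nth[of j l] by (simp add: with_word_def)
  qed (use assms Suc.prems in \<open>auto simp: with_word_def left_word_nth tape_act_keep\<close>)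
  then show ?case using Suc runs_trans_silent by auto
qed

text \<open>Erasing from the most significant digit downwards leaves the head at cell \<open>0\<close> again, because the
  first blank to the right of the word marks its anchor. Starting at the low end there would be no
  way to recognise the anchor afterwards.\<close>

lemma erase_right:
  assumes "pc < length code" "t < k" "bounded_tapes g"
    and step: "\<And>ss. instr_step (code ! pc) pc 1 ss =
      (if ss ! t = 0 then (pc', ph', [t \<mapsto> (0, Move_Left)]) else (pc, 1, [t \<mapsto> (0, Move_Right)]))"
    and l: "0 \<notin> set l" "length l \<le> L"
  shows "runs (conf k (4 * pc + 1) (with_word g t l (1 - int (length l)))) []
    (conf k (4 * pc' + ph') (with_word g t [] 0))"
  using l
proof (induction l rule: rev_induct)
  case Nil
  show "runs (conf k (4 * pc + 1) (with_word g t [] (1 - int (length [])))) []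
    (conf k (4 * pc' + ph') (with_word g t [] 0))"
    by (rule runs_step[of pc 1 _ pc' ph' "[t \<mapsto> (0, Move_Left)]"])
      (use assms in \<open>auto simp: with_word_def left_word_pos tape_act_keep\<close>)
next
  case (snoc s l)
  have "runs (conf k (4 * pc + 1) (with_word g t (l @ [s]) (1 - int (length (l @ [s]))))) []
     (conf k (4 * pc + 1) (with_word g t l (1 - int (length l))))"
    by (rule runs_step[of pc 1 _ pc 1 "[t \<mapsto> (0, Move_Right)]"])
      (use assms snoc.prems left_word_nth[of "length l" "l @ [s]"] in
        \<open>auto simp: with_word_def tape_act_keep tape_act_write left_word_erase\<close>)
  then show ?case using snoc runs_trans_silent by auto
qed

lemma bits_bound: "R r < 2 ^ L \<Longrightarrow> length (bits (R r)) \<le> L"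
  using L_pos by (simp add: length_bits)

lemma run_zero:
  assumes pc: "pc < length code" "code ! pc = IZero r" and r: "3 + r < k" "bounded_tapes g"
    and l: "0 \<notin> set l" "length l \<le> L"
  shows "runs (conf k (4 * pc) (with_word g (3 + r) l 0)) []
    (conf k (4 * Suc pc) (with_word g (3 + r) [1] 0))"
proof -
  have left: "runs (conf k (4 * pc) (with_word g (3 + r) l (- int j))) []
    (conf k (4 * pc + 1) (with_word g (3 + r) l (1 - int (length l))))" if "j \<le> length l" for j
    using that
  proof (induction "length l - j" arbitrary: j)
    case 0
    then have j: "j = length l" by simp
    show "runs (conf k (4 * pc) (with_word g (3 + r) l (- int j))) []
      (conf k (4 * pc + 1) (with_word g (3 + r) l (1 - int (length l))))"
      unfolding j
      by (intro runs_step[of pc 0 _ pc 1 "[3 + r \<mapsto> (0, Move_Right)]"])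
        (use assms in \<open>auto simp: with_word_def left_word_beyond tape_act_keep\<close>)
  next
    case (Suc d)
    then have j: "j < length l" by simp
    then have nz: "l ! j \<noteq> 0" using nth_nonblank[OF l(1), of j] by simp
    have "runs (conf k (4 * pc) (with_word g (3 + r) l (- int j))) []
      (conf k (4 * pc) (with_word g (3 + r) l (- int (Suc j))))"
      by (intro runs_step[of pc 0 _ pc 0 "[3 + r \<mapsto> (l ! j, Move_Left)]"])
        (use assms j nz in \<open>auto simp: with_word_def left_word_nth tape_act_keep\<close>)
    then show ?case using Suc(1)[of "Suc j"] Suc(2) j runs_trans_silent by auto
  qed
  have "runs (conf k (4 * pc) (with_word g (3 + r) l 0)) []
    (conf k (4 * pc + 2) (with_word g (3 + r) [] 0))"
    using runs_trans_silent[OF left[of 0] erase_right[of pc "3 + r" g pc 2 l]] assms by simp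
  moreover have "runs (conf k (4 * pc + 2) (with_word g (3 + r) [] 0)) []
    (conf k (4 * Suc pc) (with_word g (3 + r) [1] 0))"
    by (intro runs_step[of pc 2 _ "Suc pc" 0 "[3 + r \<mapsto> (1, Move_Stay)]"])
      (use assms left_word_append[of "[]" 1] in \<open>auto simp: with_word_def tape_act_write\<close>)
  ultimately show ?thesis by (rule runs_trans_silent)
qed

lemma run_clear:
  assumes pc: "pc < length code" "code ! pc = IClear t" and r: "t < k" "bounded_tapes g"
    and l: "0 \<notin> set l" "length l \<le> L"
  shows "runs (conf k (4 * pc) (with_word g t l (- int (length l)))) []
    (conf k (4 * Suc pc) (with_word g t [] 0))"
proof -
  have "runs (conf k (4 * pc) (with_word g t l (- int (length l)))) []
    (conf k (4 * pc + 1) (with_word g t l (1 - int (length l))))"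
    by (intro runs_step[of pc 0 _ pc 1 "[t \<mapsto> (0, Move_Right)]"])
      (use assms left_word_beyond[of l "length l"] in \<open>auto simp: with_word_def tape_act_keep\<close>)
  then show ?thesis
    using runs_trans_silent erase_right[of pc t g "Suc pc" 0 l] assms by simp
qed

text \<open>The carry moves left through a block \<open>pre\<close> of digits that have already been flipped from one to
  zero; the general statement is about what remains after this block.\<close>

lemma run_increment:
  assumes pc: "pc < length code" "code ! pc = IInc r" and r: "3 + r < k" "bounded_tapes g"
    and l: "set l \<subseteq> {1, 2}" "length l \<le> L" "length (increment l) \<le> L"
  shows "runs (conf k (4 * pc) (with_word g (3 + r) l 0)) []
    (conf k (4 * Suc pc) (with_word g (3 + r) (increment l) 0))"
proof -
  have carry: "\<exists>j \<le> length (pre @ increment l).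
    runs (conf k (4 * pc) (with_word g (3 + r) (pre @ l) (- int (length pre)))) []
      (conf k (4 * pc + 1) (with_word g (3 + r) (pre @ increment l) (1 - int j)))"
    if "set l \<subseteq> {1, 2}" "length (pre @ l) \<le> L" for pre l
    using that
  proof (induction l arbitrary: pre)
    case Nil
    have "runs (conf k (4 * pc) (with_word g (3 + r) pre (- int (length pre)))) []
      (conf k (4 * pc + 1) (with_word g (3 + r) (pre @ [2]) (1 - int (length pre))))"
      by (intro runs_step[of pc 0 _ pc 1 "[3 + r \<mapsto> (2, Move_Right)]"])
        (use assms Nil left_word_beyond[of pre "length pre"] in \<open>auto simp: with_word_def left_word_append tape_act_write\<close>)
    then have "\<exists>j \<le> length (pre @ increment []).
      runs (conf k (4 * pc) (with_word g (3 + r) (pre @ []) (- int (length pre)))) []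
      (conf k (4 * pc + 1) (with_word g (3 + r) (pre @ increment []) (1 - int j)))"
      by (intro exI[of _ "length pre"]) simp
    then show ?case .
  next
    case (Cons s l)
    have upd: "(left_word (pre @ s # l))(- int (length pre) := s') = left_word (pre @ s' # l)" for s'
      using left_word_update[of "length pre" "pre @ s # l"] by simp
    have rd: "left_word (pre @ s # l) (- int (length pre)) = s"
      using left_word_nth[of "length pre" "pre @ s # l"] by simp
    have digits: "set l \<subseteq> {1, 2}" and len: "length ((pre @ [1]) @ l) \<le> L"
      using Cons.prems by auto
    show ?case
    proof (cases "s = 2")
      case True
      have "runs (conf k (4 * pc) (with_word g (3 + r) (pre @ s # l) (- int (length pre)))) []
        (conf k (4 * pc) (with_word g (3 + r) ((pre @ [1]) @ l) (- int (length (pre @ [1])))))"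
        by (intro runs_step[of pc 0 _ pc 0 "[3 + r \<mapsto> (1, Move_Left)]"])
          (use assms Cons.prems rd upd True in \<open>auto simp: with_word_def tape_act_write\<close>)
      moreover obtain j where "j \<le> length ((pre @ [1]) @ increment l)"
        "runs (conf k (4 * pc) (with_word g (3 + r) ((pre @ [1]) @ l) (- int (length (pre @ [1]))))) []
      (conf k (4 * pc + 1) (with_word g (3 + r) ((pre @ [1]) @ increment l) (1 - int j)))"
        using Cons.IH[OF digits, of "pre @ [1]"] len by metis
      ultimately have "runs (conf k (4 * pc) (with_word g (3 + r) (pre @ s # l) (- int (length pre)))) []
        (conf k (4 * pc + 1) (with_word g (3 + r) ((pre @ [1]) @ increment l) (1 - int j)))"
        using runs_trans_silent by blast
      then show ?thesis using True \<open>j \<le> _\<close> by (intro exI[of _ j]) simp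
    next
      case False
      have "runs (conf k (4 * pc) (with_word g (3 + r) (pre @ s # l) (- int (length pre)))) []
        (conf k (4 * pc + 1) (with_word g (3 + r) (pre @ 2 # l) (1 - int (length pre))))"
        by (intro runs_step[of pc 0 _ pc 1 "[3 + r \<mapsto> (2, Move_Right)]"])
          (use assms Cons.prems rd upd False in \<open>auto simp: with_word_def tape_act_write\<close>)
      then show ?thesis using False by (intro exI[of _ "length pre"]) simp
    qed
  qed
  obtain j where "j \<le> length (increment l)"
    "runs (conf k (4 * pc) (with_word g (3 + r) l 0)) []
      (conf k (4 * pc + 1) (with_word g (3 + r) (increment l) (1 - int j)))"
    using carry[of l "[]"] l by auto
  moreover have "0 \<notin> set (increment l)"
    using l(1) by (induction l) auto
  ultimately show ?thesis
    using runs_trans_silent scan_right[of pc "3 + r" g "increment l" j] assms by simp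
qed

lemma run_emit_reg:
  assumes pc: "pc < length code" "code ! pc = IEmitReg t r" and r: "t < 3" "3 + r < k" "bounded_tapes g"
    and l: "0 \<notin> set l" "length l \<le> L" "length v + length l \<le> L"
  shows "runs (conf k (4 * pc) (g(t := (left_word v, - int (length v)), 3 + r := (left_word l, 0)))) []
    (conf k (4 * Suc pc) (g(t := (left_word (v @ l), - int (length (v @ l))), 3 + r := (left_word l, 0))))"
proof -
  define h where "h j = g(t := (left_word (v @ take j l), - int (length (v @ take j l))),
     3 + r := (left_word l, - int j))" for j
  have copy: "runs (conf k (4 * pc) (h j)) []
    (conf k (4 * pc + 1) ((h (length l))(3 + r := (left_word l, 1 - int (length l)))))"
    if "j \<le> length l" for j
    using that
  proof (induction "length l - j" arbitrary: j)
    case 0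
    then have j: "j = length l" by simp
    show "runs (conf k (4 * pc) (h j)) []
      (conf k (4 * pc + 1) ((h (length l))(3 + r := (left_word l, 1 - int (length l)))))"
      unfolding j
      by (intro runs_step[of pc 0 _ pc 1 "[3 + r \<mapsto> (0, Move_Right)]"])
        (use assms in \<open>auto simp: left_word_beyond tape_act_keep h_def\<close>)
  next
    case (Suc d)
    then have j: "j < length l" by simp
    then have nz: "l ! j \<noteq> 0" using nth_nonblank[OF l(1), of j] by simp
    have tk: "take (Suc j) l = take j l @ [l ! j]" using j by (rule take_Suc_conv_app_nth)
    have "runs (conf k (4 * pc) (h j)) [] (conf k (4 * pc) (h (Suc j)))"
    proof (intro runs_step[of pc 0 _ pc 0 "[t \<mapsto> (l ! j, Move_Left), 3 + r \<mapsto> (l ! j, Move_Left)]"])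
      show "update_tapes [t \<mapsto> (l ! j, Move_Left), 3 + r \<mapsto> (l ! j, Move_Left)] (h j) = h (Suc j)"
      proof -
        have "tape_act (l ! j, Move_Left) (left_word (v @ take j l), - int (length (v @ take j l))) =
            (left_word (v @ take (Suc j) l), - int (length (v @ take (Suc j) l)))"
          using tape_act_write[OF left_word_append[of "v @ take j l" "l ! j"], of Move_Left] j
          by (simp add: tk)
        moreover have "tape_act (l ! j, Move_Left) (left_word l, - int j) = (left_word l, - int (Suc j))"
          using tape_act_keep[of "left_word l" "- int j"] j by (simp add: left_word_nth)
        ultimately show ?thesis using r by (simp add: h_def fun_upd_twist)
      qed
    qed (use assms j nz in \<open>auto simp: left_word_nth h_def Let_def\<close>)
    then show ?case using Suc(1)[of "Suc j"] Suc(2) j runs_trans_silent by auto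
  qed
  have "bounded_tapes (h (length l))" using assms by (simp add: h_def)
  from scan_right[of pc "3 + r", OF _ _ this, of l "length l"] runs_trans_silent[OF copy[of 0]]
  show ?thesis using assms by (simp add: h_def with_word_def Let_def)
qed

text \<open>Both heads move left in parallel while they read the same digit, so they are at the same position
  when the comparison is decided, and the return needs to look at one of the two tapes only. The
  outcome is kept in the phase.\<close>

lemma run_test_eq:
  assumes pc: "pc < length code" "code ! pc = ITest (Eq x y) a"
    and r: "x \<noteq> y" "3 + x < k" "3 + y < k" "bounded_tapes g"
    and l: "0 \<notin> set l" "length l \<le> L" "0 \<notin> set l'" "length l' \<le> L"
    and g: "g (3 + x) = (left_word l, 0)" "g (3 + y) = (left_word l', 0)"
  shows "runs (conf k (4 * pc) g) [] (conf k (4 * (if l = l' then Suc pc else a)) g)"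
proof -
  define h where "h p = g(3 + x := (left_word l, p), 3 + y := (left_word l', p))" for p
  have h0: "h 0 = g" using g by (auto simp: h_def)
  have hx: "h p (3 + x) = (left_word l, p)" and hy: "h p (3 + y) = (left_word l', p)" for p
    using r(1) by (auto simp: h_def)
  have upd: "update_tapes [3 + x \<mapsto> (left_word l p, m), 3 + y \<mapsto> (left_word l' p, m)] (h p) =
      h (moved m p)" for p m
    using r(1) by (auto simp: h_def tape_act_keep fun_eq_iff)
  have bd: "bounded_tapes (h p)" if "\<bar>p\<bar> \<le> int L + 1" for p
    using that r(4) by (simp add: h_def)
  have return: "runs (conf k (4 * pc + ph) (h (1 - int j))) []
      (conf k (4 * (if ph = 1 then Suc pc else a)) (h 0))"
    if "j \<le> length l" "take j l = take j l'" "ph = 1 \<or> ph = 2" for j ph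
    using that
  proof (induction j)
    case 0
    show ?case
      by (rule runs_step[of pc ph _ "if ph = 1 then Suc pc else a" 0
            "[3 + x \<mapsto> (left_word l 1, Move_Left), 3 + y \<mapsto> (left_word l' 1, Move_Left)]"])
        (use 0 assms hx hy upd[of 1 Move_Left] in \<open>auto simp: bd left_word_pos Let_def\<close>)
  next
    case (Suc j)
    then have nz: "l ! j \<noteq> 0" using nth_nonblank[OF l(1), of j] by simp
    have tk: "take j l = take j l'" using arg_cong[OF Suc.prems(2), of "take j"] by simp
    have step: "runs (conf k (4 * pc + ph) (h (1 - int (Suc j)))) []
        (conf k (4 * pc + ph) (h (1 - int j)))"
      by (rule runs_step[of pc ph _ pc ph
            "[3 + x \<mapsto> (left_word l (- int j), Move_Right), 3 + y \<mapsto> (left_word l' (- int j), Move_Right)]"])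
        (use Suc.prems nz assms hx[of "- int j"] hy[of "- int j"] upd[of "- int j" Move_Right]
          left_word_nth[of j l] in \<open>auto simp: bd Let_def\<close>)
    show ?case by (rule runs_trans_silent[OF step Suc.IH]) (use Suc.prems tk in auto)
  qed
  have compare: "runs (conf k (4 * pc) (h (- int j))) []
      (conf k (4 * (if l = l' then Suc pc else a)) (h 0))"
    if "j \<le> length l" "j \<le> length l'" "take j l = take j l'" for j
    using that
  proof (induction "length l - j" arbitrary: j rule: less_induct)
    case less
    let ?s = "left_word l (- int j)" and ?s' = "left_word l' (- int j)"
    have s: "?s = (if j < length l then l ! j else 0)" "?s' = (if j < length l' then l' ! j else 0)"
      by (auto simp: left_word_nth left_word_beyond)
    have nz: "j < length l \<Longrightarrow> l ! j \<noteq> 0" "j < length l' \<Longrightarrow> l' ! j \<noteq> 0"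
      using l nth_mem by metis+
    show ?case
    proof (cases "?s = ?s' \<and> ?s \<noteq> 0")
      case True
      then have j: "j < length l" "j < length l'" using s by (auto split: if_splits)
      then have eq: "take (Suc j) l = take (Suc j) l'"
        using less.prems True s by (simp add: take_Suc_conv_app_nth)
      have step: "runs (conf k (4 * pc) (h (- int j))) [] (conf k (4 * pc) (h (- int (Suc j))))"
      proof (rule runs_step[of pc 0 _ pc 0 "[3 + x \<mapsto> (?s, Move_Left), 3 + y \<mapsto> (?s', Move_Left)]"])
        show "instr_step (code ! pc) pc 0 (map (tape_read \<circ> h (- int j)) [0..<k]) =
            (pc, 0, [3 + x \<mapsto> (?s, Move_Left), 3 + y \<mapsto> (?s', Move_Left)])"
          using True pc(2) r hx hy by (simp add: Let_def)
        show "bounded_tapes (h (- int j))" using less.prems(1) l(2) by (intro bd) simp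
        show "update_tapes [3 + x \<mapsto> (?s, Move_Left), 3 + y \<mapsto> (?s', Move_Left)] (h (- int j)) =
            h (- int (Suc j))"
        proof -
          have "- int (Suc j) = - int j - 1" by simp
          then show ?thesis using upd[of "- int j" Move_Left] by (simp only: moved_simps)
        qed
      qed (use pc in auto)
      show ?thesis by (rule runs_trans_silent[OF step less.hyps]) (use j eq in auto)
    next
      case False
      \<comment> \<open>The digits differ or both are blank; as digits are nonblank, equality here means that both words end.\<close>
      have iff: "l = l' \<longleftrightarrow> ?s = ?s'"
      proof
        assume "?s = ?s'"
        then have "length l = j" "length l' = j" using False s nz less.prems by (auto split: if_splits)
        then show "l = l'" using less.prems by simp
      qed simp
      have step: "runs (conf k (4 * pc) (h (- int j))) []
          (conf k (4 * pc + (if l = l' then 1 else 2)) (h (1 - int j)))"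
      proof (rule runs_step[of pc 0 _ pc "if l = l' then 1 else 2"
            "[3 + x \<mapsto> (?s, Move_Right), 3 + y \<mapsto> (?s', Move_Right)]"])
        show "instr_step (code ! pc) pc 0 (map (tape_read \<circ> h (- int j)) [0..<k]) =
            (pc, if l = l' then 1 else 2, [3 + x \<mapsto> (?s, Move_Right), 3 + y \<mapsto> (?s', Move_Right)])"
          unfolding iff using False pc(2) r hx hy by (auto simp: Let_def)
        show "bounded_tapes (h (- int j))" using less.prems(1) l(2) by (intro bd) simp
        show "update_tapes [3 + x \<mapsto> (?s, Move_Right), 3 + y \<mapsto> (?s', Move_Right)] (h (- int j)) =
            h (1 - int j)"
          using upd[of "- int j" Move_Right] by simp
      qed (use pc in auto)
      show ?thesis
        using runs_trans_silent[OF step return[of j "if l = l' then 1 else 2"]] less.prems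
        by (cases "l = l'") simp_all
    qed
  qed
  show ?thesis using compare[of 0] h0 by simp
qed

text \<open>Tape \<open>0\<close> is the input, tapes \<open>1\<close> and \<open>2\<close> are outputs, and register \<open>r\<close> is on tape \<open>r + 3\<close>. In
  particular tape \<open>3\<close> shows register \<open>0\<close>, which will hold \<open>N\<close>.\<close>

fun tape_of :: "state \<Rightarrow> nat \<Rightarrow> tape" where
  "tape_of (R, p, W) i =
    (if i = 0 then (word_at 0 w, p)
     else if i < 3 then (left_word (W i), - int (length (W i)))
     else (left_word (bits (R (i - 3))), 0))"

lemma tape_of_reg: "with_word (tape_of (R, p, W)) (3 + r) (bits m) 0 = tape_of (R(r := m), p, W)"
  by (auto simp: with_word_def fun_eq_iff)

lemma tape_of_out:
  "t \<in> {1, 2} \<Longrightarrow> with_word (tape_of (R, p, W)) t l (- int (length l)) = tape_of (R, p, W(t := l))"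
  by (auto simp: with_word_def fun_eq_iff)

lemma tape_of_reg_same: "with_word (tape_of (R, p, W)) (3 + r) (bits (R r)) 0 = tape_of (R, p, W)"
  using tape_of_reg[of R p W r "R r"] by simp

lemma tape_of_out_same:
  "t \<in> {1, 2} \<Longrightarrow> with_word (tape_of (R, p, W)) t (W t) (- int (length (W t))) = tape_of (R, p, W)"
  using tape_of_out[of t R p W "W t"] by simp

lemma bounded_tape_of:
  assumes "capped L s"
  shows "bounded_tapes (tape_of s)"
proof -
  obtain R p W where s: "s = (R, p, W)" by (cases s)
  have "int (length (W t)) \<le> int L" for t using assms s by simp
  then have "\<bar>- int (length (W t))\<bar> \<le> int L + 1" for t by (simp add: add_increasing2)
  moreover have "\<bar>p\<bar> \<le> int L + 1" using assms s by (simp add: abs_le_iff)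
  ultimately show ?thesis using s by (simp add: bounded_tapes_def)
qed

lemma capped_bits: "capped L (R, p, W) \<Longrightarrow> length (bits (R r)) \<le> L"
  using bits_bound[of R r] by simp

lemma run_test:
  assumes "pc < length code" "code ! pc = ITest b j" "capped L s" "cond_wf b"
    and "(case b of Eq x y \<Rightarrow> max x y | In a \<Rightarrow> 0) + 3 < k"
  shows "runs (conf k (4 * pc) (tape_of s)) []
    (conf k (4 * (if holds w s b then Suc pc else j)) (tape_of s))"
proof -
  obtain R p W where s: "s = (R, p, W)" by (cases s)
  show ?thesis
  proof (cases b)
    case (Eq x y)
    have "bits (R x) = bits (R y) \<longleftrightarrow> R x = R y" using bits_inj by auto
    moreover have "3 + x < k" "3 + y < k" using assms(5) Eq by auto
    ultimately show ?thesis
      using run_test_eq[of pc x y j "tape_of s" "bits (R x)" "bits (R y)"] assms Eq s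
        bounded_tape_of[of s] capped_bits[of R p W] bits_nonblank
      by (simp add: cond_wf_def)
  next
    case (In a)
    show ?thesis
      by (rule runs_step[of pc 0 _ "if holds w s b then Suc pc else j" 0 Map.empty])
        (use assms In s bounded_tape_of three_tapes in auto)
  qed
qed

lemma run_jump:
  assumes "pc < length code" "code ! pc = IJump j" "capped L s"
  shows "runs (conf k (4 * pc) (tape_of s)) [] (conf k (4 * j) (tape_of s))"
  by (rule runs_step[of pc 0 _ j 0 Map.empty]) (use assms bounded_tape_of in auto)

lemma tapes_show_tape_of:
  assumes "shows_snapshot s sn"
  shows "tapes_show (snd (conf k q (tape_of s))) sn"
proof -
  obtain R p W where s: "s = (R, p, W)" by (cases s)
  have "tape_holds (map (tape_of s) [0..<k] ! 1) (rev (W 1))"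
    "tape_holds (map (tape_of s) [0..<k] ! 2) (rev (W 2))"
    "tape_holds (map (tape_of s) [0..<k] ! 3) (enc_int (int (R 0)))"
    using s three_tapes tape_holds_left_word tape_holds_left_word[of "bits (R 0)"]
    by (simp_all add: bits_def enc_int_def numeral_2_eq_2)
  then show ?thesis using assms s by (cases sn) (auto simp: conf_def)
qed

lemma tape_of_input: "tape_of (R, p, W) 0 = (word_at 0 w, p)"
  by simp

declare tape_of.simps [simp del]

text \<open>The rest after the located segment is nonempty: the last instruction of the code is the halting
  state, so no located mark coincides with it.\<close>

definition located :: "nat \<Rightarrow> instr list \<Rightarrow> bool" where
  "located a is \<longleftrightarrow> (\<exists>xs ys. code = xs @ is @ ys \<and> length xs = a \<and> ys \<noteq> [])"

lemma located_append: "located a (is @ is') \<Longrightarrow> located a is \<and> located (a + length is) is'"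
  unfolding located_def by (metis append.assoc append_is_Nil_conv length_append)

lemma located_Cons: "located a (i # is) \<Longrightarrow> a < length code - 1 \<and> code ! a = i \<and> located (a + 1) is"
proof -
  assume l: "located a (i # is)"
  then have "located (a + 1) is" using located_append[of a "[i]" "is"] by simp
  moreover have "a < length code - 1 \<and> code ! a = i"
    using l unfolding located_def by (auto simp: neq_Nil_conv nth_append)
  ultimately show ?thesis by simp
qed

lemma runs_trans_left: "runs c [] c' \<Longrightarrow> runs c' sns c'' \<Longrightarrow> runs c sns c''"
  using runs_trans[of c "[]"] by simp

lemma runs_trans_right: "runs c sns c' \<Longrightarrow> runs c' [] c'' \<Longrightarrow> runs c sns c''"
  using runs_trans[of c sns c' "[]"] by simp

text \<open>By induction on the execution. The cases of single instructions are the lemmas above, the others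
  put runs together along the jumps.\<close>

lemma exec_runs:
  assumes "exec w L c s sns s'" "capped L s" "com_wf c" "max_reg c + 3 < k" "located a (compile c a)"
  shows "runs (conf k (4 * a) (tape_of s)) sns (conf k (4 * (a + code_length c)) (tape_of s'))"
  using assms
proof (induction arbitrary: a rule: exec.induct)
  case (Skip s)
  then show ?case by (simp add: runs.refl)
next
  case (Zero r R p W)
  have pc: "a < length code" "code ! a = IZero r" using Zero located_Cons by fastforce+
  show ?case
    using run_zero[OF pc, of "tape_of (R, p, W)" "bits (R r)"] Zero.prems bounded_tape_of
      capped_bits[of R p W r] bits_nonblank[of "R r"] tape_of_reg[of R p W r 0]
    by (simp add: tape_of_reg_same bits_small)
next
  case (Inc R r p W)
  have pc: "a < length code" "code ! a = IInc r" using Inc located_Cons by fastforce+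
  have "length (increment (bits (R r))) \<le> L"
    using Inc.hyps L_pos length_bits[of "Suc (R r)" L] by (simp add: bits_Suc)
  then show ?case
    using run_increment[OF pc, of "tape_of (R, p, W)" "bits (R r)"] Inc.prems bounded_tape_of
      capped_bits[of R p W r] bits_digits[of "R r"] tape_of_reg[of R p W r "Suc (R r)"]
    by (simp add: tape_of_reg_same bits_Suc)
next
  case (EmitReg W t R r p)
  have pc: "a < length code" "code ! a = IEmitReg t r" using EmitReg located_Cons by fastforce+
  have t: "t = 1 \<or> t = 2" using EmitReg.prems by auto
  have upd: "(tape_of (R, p, W))(t := (left_word v, - int (length v)), 3 + r := (left_word (bits (R r)), 0)) =
      tape_of (R, p, W(t := v))" for v
    using t by (auto simp: fun_eq_iff tape_of.simps)
  have upd': "tape_of (R, p, W(t := W t)) = tape_of (R, p, W)" by simp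
  have "length (bits (R r)) \<le> L" "length (W t) + length (bits (R r)) \<le> L"
    using EmitReg by auto
  moreover have "t < 3" "3 + r < k" using t EmitReg.prems by auto
  ultimately show ?case
    using run_emit_reg[OF pc _ _ bounded_tape_of[OF EmitReg.prems(1)] bits_nonblank[of "R r"], where v = "W t"]
    unfolding upd upd' by simp
next
  case (Emit s W t R p)
  have pc: "a < length code" "code ! a = IEmit t s" using Emit located_Cons by fastforce+
  have t: "t \<in> {1, 2}" using Emit.prems by auto
  have "tape_act (s, Move_Left) (left_word (W t), - int (length (W t))) =
      (left_word (W t @ [s]), - int (length (W t @ [s])))"
    using tape_act_write[OF left_word_append[of "W t" s], of Move_Left] by simp
  then have "update_tapes [t \<mapsto> (s, Move_Left)] (tape_of (R, p, W)) = tape_of (R, p, W(t := W t @ [s]))"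
    using t tape_of_out[OF t, of R p W "W t @ [s]"] by (auto simp: with_word_def tape_of.simps)
  then show ?case
    using bounded_tape_of[OF Emit.prems(1)] pc
    by (intro runs_step[of a 0 _ "Suc a" 0 "[t \<mapsto> (s, Move_Left)]"]) auto
next
  case (Clear t R p W)
  have pc: "a < length code" "code ! a = IClear t" using Clear located_Cons by fastforce+
  have t: "t \<in> {1, 2}" using Clear.prems by auto
  have "length (W t) \<le> L" "0 \<notin> set (W t)" "t < k" using Clear.prems t three_tapes by auto
  then show ?case
    using run_clear[OF pc, of "tape_of (R, p, W)" "W t"] bounded_tape_of[OF Clear.prems(1)]
      tape_of_out[OF t, of R p W "[]"] tape_of_out_same[OF t, of R p W]
    by simp
next
  case (Next p R W)
  have pc: "a < length code" "code ! a = INext" using Next located_Cons by fastforce+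
  have "update_tapes [0 \<mapsto> (word_at 0 w p, Move_Right)] (tape_of (R, p, W)) = tape_of (R, p + 1, W)"
    by (auto simp: tape_act_keep fun_eq_iff tape_of.simps)
  then show ?case
    using bounded_tape_of[OF Next.prems(1)] pc three_tapes
    by (intro runs_step[of a 0 _ "Suc a" 0 "[0 \<mapsto> (word_at 0 w p, Move_Right)]"]) (auto simp: tape_of_input)
next
  case (Prev p R W)
  have pc: "a < length code" "code ! a = IPrev" using Prev located_Cons by fastforce+
  have "update_tapes [0 \<mapsto> (word_at 0 w p, Move_Left)] (tape_of (R, p, W)) = tape_of (R, p - 1, W)"
    by (auto simp: tape_act_keep fun_eq_iff tape_of.simps)
  then show ?case
    using bounded_tape_of[OF Prev.prems(1)] pc three_tapes
    by (intro runs_step[of a 0 _ "Suc a" 0 "[0 \<mapsto> (word_at 0 w p, Move_Left)]"]) (auto simp: tape_of_input)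
next
  case (Mark s sn)
  have nh: "a < length code - 1" and at: "code ! a = IMark (snapshot_point sn)"
    using Mark located_Cons by fastforce+
  have pc: "a < length code" using nh by simp
  show ?case
  proof (rule runs.marked)
    show "fst (conf k (4 * a) (tape_of s)) = mark (snapshot_point sn)"
      using mark_eq[OF pc at] by (simp add: conf_def)
    show "fst (conf k (4 * a) (tape_of s)) \<noteq> halt M"
      using nh by (simp add: conf_def machine_def)
    show "tapes_show (snd (conf k (4 * a) (tape_of s))) sn"
      using Mark.hyps tapes_show_tape_of by simp
    show "bounded (conf k (4 * a) (tape_of s))"
      using Mark.prems(1) bounded_tape_of by (simp add: bounded_conf)
    show "runs (tm_step M (conf k (4 * a) (tape_of s))) []
      (conf k (4 * (a + code_length (Mark (snapshot_point sn)))) (tape_of s))"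
      using step_conf[of a 0 "tape_of s" "Suc a" 0 Map.empty] pc at
      by (simp add: runs.refl)
  qed
next
  case (Seq c s tr s' d tr' s'')
  have loc: "located a (compile c a)" "located (a + code_length c) (compile d (a + code_length c))"
    using Seq.prems(4) located_append by fastforce+
  have s': "capped L s'" using Seq.hyps(1) Seq.prems(1) exec_capped input_length by blast
  have "runs (conf k (4 * a) (tape_of s)) tr (conf k (4 * (a + code_length c)) (tape_of s'))"
    using Seq.IH(1)[OF Seq.prems(1) _ _ loc(1)] Seq.prems by simp
  moreover have "runs (conf k (4 * (a + code_length c)) (tape_of s')) tr'
      (conf k (4 * (a + code_length c + code_length d)) (tape_of s''))"
    using Seq.IH(2)[OF s' _ _ loc(2)] Seq.prems by simp
  ultimately show ?case using runs_trans by (simp add: add.assoc)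
next
  case (If_True s b c tr s' d)
  let ?j = "a + code_length c + 2" and ?e = "a + code_length c + code_length d + 2"
  have 1: "a < length code - 1" "code ! a = ITest b ?j"
      "located (a + 1) (compile c (a + 1) @ [IJump ?e] @ compile d ?j)"
    using If_True.prems(4) located_Cons by fastforce+
  have 2: "located (a + 1) (compile c (a + 1))"
      "located (a + 1 + code_length c) ([IJump ?e] @ compile d ?j)"
    using located_append[OF 1(3)] by simp_all
  have 3: "a + 1 + code_length c < length code - 1" "code ! (a + 1 + code_length c) = IJump ?e"
    using located_Cons 2(2) by fastforce+
  have s': "capped L s'" using If_True.hyps(2) If_True.prems(1) exec_capped input_length by blast
  have r: "(case b of Eq x y \<Rightarrow> max x y | In a \<Rightarrow> 0) + 3 < k"
    using If_True.prems(3) by simp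
  have "runs (conf k (4 * a) (tape_of s)) [] (conf k (4 * (a + 1)) (tape_of s))"
    using run_test[OF _ 1(2) If_True.prems(1) _ r] 1(1) If_True.hyps(1) If_True.prems(2) by simp
  moreover have "runs (conf k (4 * (a + 1)) (tape_of s)) tr
      (conf k (4 * (a + 1 + code_length c)) (tape_of s'))"
    using If_True.IH[OF If_True.prems(1) _ _ 2(1)] If_True.prems by simp
  moreover have "runs (conf k (4 * (a + 1 + code_length c)) (tape_of s')) []
      (conf k (4 * (a + code_length (If b c d))) (tape_of s'))"
    using run_jump[OF _ 3(2) s'] 3(1) by (simp add: add.assoc)
  ultimately show ?case using runs_trans_left runs_trans_right by blast
next
  case (If_False s b d tr s' c)
  let ?j = "a + code_length c + 2" and ?e = "a + code_length c + code_length d + 2"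
  have 1: "a < length code - 1" "code ! a = ITest b ?j"
      "located (a + 1) (compile c (a + 1) @ [IJump ?e] @ compile d ?j)"
    using If_False.prems(4) located_Cons by fastforce+
  have "located (a + 1 + code_length c) ([IJump ?e] @ compile d ?j)"
    using located_append[OF 1(3)] by simp
  then have 2: "located ?j (compile d ?j)" using located_Cons by fastforce
  have r: "(case b of Eq x y \<Rightarrow> max x y | In a \<Rightarrow> 0) + 3 < k"
    using If_False.prems(3) by simp
  have "runs (conf k (4 * a) (tape_of s)) [] (conf k (4 * ?j) (tape_of s))"
    using run_test[OF _ 1(2) If_False.prems(1) _ r] 1(1) If_False.hyps(1) If_False.prems(2) by simp
  moreover have "runs (conf k (4 * ?j) (tape_of s)) tr
      (conf k (4 * (?j + code_length d)) (tape_of s'))"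
    using If_False.IH[OF If_False.prems(1) _ _ 2] If_False.prems by simp
  moreover have "?j + code_length d = a + code_length (If b c d)" by simp
  ultimately show ?case using runs_trans_left by metis
next
  case (Until_True s b c)
  have 1: "a < length code - 1" "code ! a = ITest b (a + 2)"
      "located (a + 1) (IJump (a + code_length c + 3) # compile c (a + 2) @ [IJump a])"
    using Until_True.prems(4) located_Cons by fastforce+
  have 2: "a + 1 < length code - 1" "code ! (a + 1) = IJump (a + code_length c + 3)"
    using located_Cons[OF 1(3)] by simp_all
  have r: "(case b of Eq x y \<Rightarrow> max x y | In a \<Rightarrow> 0) + 3 < k"
    using Until_True.prems(3) by simp
  have "runs (conf k (4 * a) (tape_of s)) [] (conf k (4 * (a + 1)) (tape_of s))"
    using run_test[OF _ 1(2) Until_True.prems(1) _ r] 1(1) Until_True.hyps(1) Until_True.prems(2) by simp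
  moreover have "runs (conf k (4 * (a + 1)) (tape_of s)) []
      (conf k (4 * (a + code_length (Until b c))) (tape_of s))"
    using run_jump[OF _ 2(2) Until_True.prems(1)] 2(1) by (simp add: add.assoc)
  ultimately show ?case using runs_trans_silent by blast
next
  case (Until_False s b c tr s' tr' s'')
  have 1: "a < length code - 1" "code ! a = ITest b (a + 2)"
      "located (a + 1) (IJump (a + code_length c + 3) # compile c (a + 2) @ [IJump a])"
    using Until_False.prems(4) located_Cons by fastforce+
  have 2: "located (a + 2) (compile c (a + 2) @ [IJump a])"
    using located_Cons[OF 1(3)] by simp
  have 3: "located (a + 2) (compile c (a + 2))" "located (a + 2 + code_length c) [IJump a]"
    using located_append[OF 2] by simp_all
  have 4: "a + 2 + code_length c < length code - 1" "code ! (a + 2 + code_length c) = IJump a"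
    using located_Cons[OF 3(2)] by simp_all
  have s': "capped L s'" using Until_False.hyps(2) Until_False.prems(1) exec_capped input_length by blast
  have r: "(case b of Eq x y \<Rightarrow> max x y | In a \<Rightarrow> 0) + 3 < k"
    using Until_False.prems(3) by simp
  have "runs (conf k (4 * a) (tape_of s)) [] (conf k (4 * (a + 2)) (tape_of s))"
    using run_test[OF _ 1(2) Until_False.prems(1) _ r] 1(1) Until_False.hyps(1) Until_False.prems(2) by simp
  moreover have "runs (conf k (4 * (a + 2)) (tape_of s)) tr
      (conf k (4 * (a + 2 + code_length c)) (tape_of s'))"
    using Until_False.IH(1)[OF Until_False.prems(1) _ _ 3(1)] Until_False.prems by simp
  moreover have "runs (conf k (4 * (a + 2 + code_length c)) (tape_of s')) [] (conf k (4 * a) (tape_of s'))"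
    using run_jump[OF _ 4(2) s'] 4(1) by simp
  moreover have "runs (conf k (4 * a) (tape_of s')) tr'
      (conf k (4 * (a + code_length (Until b c))) (tape_of s''))"
    using Until_False.IH(2)[OF s' Until_False.prems(2-4)] .
  ultimately show ?case using runs_trans_left runs_trans by blast
qed

text \<open>A run unfolds to an iteration of the step function, as halting time, trace and space refer to it.\<close>

lemma runs_steps:
  "runs c sns c' \<Longrightarrow> \<exists>j. (tm_step M ^^ j) c = c' \<and>
    (\<forall>i<j. fst ((tm_step M ^^ i) c) \<noteq> halt M \<and> bounded ((tm_step M ^^ i) c)) \<and>
    list_all2 (\<lambda>(q, ts) s. q = mark (snapshot_point s) \<and> tapes_show ts s)
      (filter (\<lambda>(q, ts). q \<in> range mark) (map (\<lambda>i. (tm_step M ^^ i) c) [0..<j])) sns"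
proof (induction rule: runs.induct)
  case (refl c)
  show ?case by (intro exI[of _ 0]) simp
next
  case (silent c sns c')
  then obtain j where j: "(tm_step M ^^ j) (tm_step M c) = c'"
    "\<forall>i<j. fst ((tm_step M ^^ i) (tm_step M c)) \<noteq> halt M \<and> bounded ((tm_step M ^^ i) (tm_step M c))"
    "list_all2 (\<lambda>(q, ts) s. q = mark (snapshot_point s) \<and> tapes_show ts s)
      (filter (\<lambda>(q, ts). q \<in> range mark) (map (\<lambda>i. (tm_step M ^^ i) (tm_step M c)) [0..<j])) sns"
    by blast
  have mp: "map (\<lambda>i. (tm_step M ^^ i) c) [0..<Suc j] = c # map (\<lambda>i. (tm_step M ^^ i) (tm_step M c)) [0..<j]"
    by (simp add: upt_conv_Cons map_Suc_upt[symmetric] funpow_Suc_right del: upt_Suc funpow.simps)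
  have "fst c \<noteq> halt M" using silent mark_halt by (metis rangeI)
  then have "\<forall>i<Suc j. fst ((tm_step M ^^ i) c) \<noteq> halt M \<and> bounded ((tm_step M ^^ i) c)"
    using j(2) silent by (auto simp: less_Suc_eq_0_disj funpow_Suc_right simp del: funpow.simps(2))
  then show ?case
    using j silent mp
    by (intro exI[of _ "Suc j"]) (auto simp: funpow_Suc_right simp del: funpow.simps(2) upt_Suc)
next
  case (marked c sn sns c')
  then obtain j where j: "(tm_step M ^^ j) (tm_step M c) = c'"
    "\<forall>i<j. fst ((tm_step M ^^ i) (tm_step M c)) \<noteq> halt M \<and> bounded ((tm_step M ^^ i) (tm_step M c))"
    "list_all2 (\<lambda>(q, ts) s. q = mark (snapshot_point s) \<and> tapes_show ts s)
      (filter (\<lambda>(q, ts). q \<in> range mark) (map (\<lambda>i. (tm_step M ^^ i) (tm_step M c)) [0..<j])) sns"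
    by blast
  have mp: "map (\<lambda>i. (tm_step M ^^ i) c) [0..<Suc j] = c # map (\<lambda>i. (tm_step M ^^ i) (tm_step M c)) [0..<j]"
    by (simp add: upt_conv_Cons map_Suc_upt[symmetric] funpow_Suc_right del: upt_Suc funpow.simps)
  have "\<forall>i<Suc j. fst ((tm_step M ^^ i) c) \<noteq> halt M \<and> bounded ((tm_step M ^^ i) c)"
    using j(2) marked by (auto simp: less_Suc_eq_0_disj funpow_Suc_right simp del: funpow.simps(2))
  then show ?case
    using j marked mp
    by (intro exI[of _ "Suc j"]) (auto simp: funpow_Suc_right simp del: funpow.simps(2) upt_Suc)
qed

lemma initial_run:
  "runs (tm_init M w) [] (conf k 0 (tape_of (\<lambda>_. 0, 0, \<lambda>_. [])))"
proof -
  define g :: "nat \<Rightarrow> tape" where "g i = (if i = 0 then (word_at 0 w, 0) else (\<lambda>_. 0, 0))" for i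
  have init: "tm_init M w = conf k (4 * length code) g"
    using three_tapes
    by (auto simp: tm_init_def conf_def machine_def g_def nth_Cons split: nat.splits intro!: nth_equalityI)
  have "tm_step M (conf k (4 * length code) g) = conf k 0 (update_tapes initial_acts g)"
    using map2_tape_acts[of g k initial_acts] by (simp add: conf_def machine_def)
  also have "update_tapes initial_acts g = tape_of (\<lambda>_. 0, 0, \<lambda>_. [])"
    using tape_act_write[OF left_word_append[of "[]" 1], of Move_Stay]
    by (auto simp: update_tapes_def initial_acts_def g_def bits_small left_word_Nil fun_eq_iff tape_of.simps)
  finally have step: "tm_step M (conf k (4 * length code) g) = conf k 0 (tape_of (\<lambda>_. 0, 0, \<lambda>_. []))" .
  have "mark pt < 4 * length code" for pt using mark_position_nth[of pt] by (simp add: mark_state_def)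
  \<comment> \<open>The start state lies beyond all instructions, so the first configuration does not enter the trace.\<close>
  then have "4 * length code \<notin> range mark" by (metis imageE less_irrefl)
  then have "fst (conf k (4 * length code) g) \<notin> range mark" by (simp add: conf_def)
  moreover have "bounded (conf k (4 * length code) g)" by (auto simp: bounded_def conf_def g_def)
  ultimately show ?thesis unfolding init using step runs.refl by (metis runs.silent)
qed

text \<open>A head that stays within distance \<open>L + 1\<close> of its origin visits at most \<open>2 * L + 3\<close> cells, for each
  of the \<open>k\<close> tapes.\<close>

lemma machine_executes:
  assumes ex: "exec w L c (\<lambda>_. 0, 0, \<lambda>_. []) sns (R, p, W)" and wf: "com_wf c" "max_reg c + 3 < k"
    and cd: "code = compile c 0 @ [IMark At_Order_Return]"
  obtains T where "tm_halts_at M w T"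
    and "tm_executes M mark w T (sns @ [Order_Return (int (R 0))])"
    and "tape_holds (snd (tm_config M w T) ! 3) (enc_int (int (R 0)))"
    and "tm_space M w T \<le> k * (2 * L + 3)"
proof -
  let ?f = "conf k (4 * code_length c) (tape_of (R, p, W))"
  have cap: "capped L (\<lambda>_. 0, 0, \<lambda>_. [])" by simp
  have loc: "located 0 (compile c 0)"
    unfolding located_def using cd by (intro exI[of _ "[]"] exI[of _ "[IMark At_Order_Return]"]) simp
  have "runs (conf k 0 (tape_of (\<lambda>_. 0, 0, \<lambda>_. []))) sns ?f"
    using exec_runs[OF ex cap wf loc] by simp
  from runs_steps[OF runs_trans[OF initial_run this]] obtain T where
    T: "(tm_step M ^^ T) (tm_init M w) = ?f"
    "\<forall>i<T. fst ((tm_step M ^^ i) (tm_init M w)) \<noteq> halt M \<and> bounded ((tm_step M ^^ i) (tm_init M w))"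
    "list_all2 (\<lambda>(q, ts) s. q = mark (snapshot_point s) \<and> tapes_show ts s)
      (filter (\<lambda>(q, ts). q \<in> range mark) (map (\<lambda>i. (tm_step M ^^ i) (tm_init M w)) [0..<T])) sns"
    by auto
  have cT: "tm_config M w T = ?f" using T(1) by (simp add: tm_config_def)
  have halt: "fst ?f = halt M" using cd by (simp add: conf_def machine_def)
  have sh: "tapes_show (snd ?f) (Order_Return (int (R 0)))"
    by (rule tapes_show_tape_of) simp
  have "tm_halts_at M w T" using T(2) halt cT by (simp add: tm_halts_at_def tm_config_def)
  moreover have "tm_executes M mark w T (sns @ [Order_Return (int (R 0))])"
  proof -
    have mp: "map (tm_config M w) [0..<Suc T] = map (\<lambda>i. (tm_step M ^^ i) (tm_init M w)) [0..<T] @ [?f]"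
      using T(1) by (simp add: tm_config_def)
    \<comment> \<open>Reaching the halting state is itself the last snapshot, which reports the returned value.\<close>
    have "fst ?f \<in> range mark" using halt mark_halt by (metis rangeI)
    then have "filter (\<lambda>(q, ts). q \<in> range mark) [?f] = [?f]" by (simp add: case_prod_beta)
    moreover have "list_all2 (\<lambda>(q, ts) s. q = mark (snapshot_point s) \<and> tapes_show ts s)
        [?f] [Order_Return (int (R 0))]"
      using sh halt mark_halt by (simp add: case_prod_beta)
    ultimately show ?thesis
      unfolding tm_executes_def mp filter_append using T(3) by (simp only: list_all2_appendI)
  qed
  moreover have "tape_holds (snd (tm_config M w T) ! 3) (enc_int (int (R 0)))"
    using sh cT by simp
  moreover have "tm_space M w T \<le> k * (2 * L + 3)"
  proof -
    have "capped L (R, p, W)" using exec_capped[OF ex input_length cap] .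
    then have "bounded ?f" using bounded_tape_of by (simp add: bounded_conf)
    then have bd: "bounded (tm_config M w t)" if "t \<le> T" for t
      using that T(1,2) cT by (cases "t = T") (auto simp: tm_config_def)
    have "card ((\<lambda>t. snd (snd (tm_config M w t) ! i)) ` {..T}) \<le> 2 * L + 3" if "i < k" for i
    proof -
      have "(\<lambda>t. snd (snd (tm_config M w t) ! i)) ` {..T} \<subseteq> {- (int L + 1)..int L + 1}"
      proof
        fix x assume "x \<in> (\<lambda>t. snd (snd (tm_config M w t) ! i)) ` {..T}"
        then obtain t where t: "t \<le> T" "x = snd (snd (tm_config M w t) ! i)" by auto
        have "snd (tm_config M w t) ! i \<in> set (snd (tm_config M w t))"
          using bd[OF t(1)] that by (simp add: bounded_def)
        then have "\<bar>x\<bar> \<le> int L + 1" using bd[OF t(1)] t(2) by (simp add: bounded_def)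
        then show "x \<in> {- (int L + 1)..int L + 1}" by auto
      qed
      then have "card ((\<lambda>t. snd (snd (tm_config M w t) ! i)) ` {..T}) \<le> card {- (int L + 1)..int L + 1}"
        by (intro card_mono) auto
      then show ?thesis by simp
    qed
    note cells = this
    have "tapes M = k" by (simp add: machine_def)
    then have "tm_space M w T = (\<Sum>i<k. card ((\<lambda>t. snd (snd (tm_config M w t) ! i)) ` {..T}))"
      unfolding tm_space_def by (simp only:)
    also have "\<dots> \<le> (\<Sum>i<k. 2 * L + 3)" by (intro sum_mono cells) simp
    also have "\<dots> = k * (2 * L + 3)" by simp
    finally show ?thesis .
  qed
  ultimately show thesis using that by blast
qed

end

lemma unique_index:
  assumes "length (filter P xs) = 1"
  shows "\<exists>!i. i < length xs \<and> P (xs ! i)"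
proof -
  obtain i where i: "{i. i < length xs \<and> P (xs ! i)} = {i}"
    using assms unfolding length_filter_conv_card by (rule card_1_singletonE)
  have "j < length xs \<and> P (xs ! j) \<longleftrightarrow> j = i" for j
    using i unfolding set_eq_iff mem_Collect_eq by simp
  then show ?thesis by auto
qed

lemma simulation_compile:
  assumes wf: "com_wf c" "max_reg c + 3 < k" and marks: "\<And>pt. mark_count pt c = (if pt = At_Order_Return then 0 else 1)"
    and L: "1 \<le> L" "length w \<le> L"
  shows "simulation w L k (compile c 0 @ [IMark At_Order_Return])"
proof
  let ?code = "compile c 0 @ [IMark At_Order_Return]"
  show "instr_wf k (length ?code) i" if "i \<in> set ?code" for i
    using that compile_wf[OF wf, of 0 "length ?code"] by auto
  show "\<exists>!i. i < length ?code \<and> ?code ! i = IMark pt" for pt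
  proof -
    have "length (filter ((=) (IMark pt)) ?code) = 1"
      using mark_count_compile[of pt c 0] marks[of pt] by simp
    from unique_index[OF this] show ?thesis by (simp only: eq_commute)
  qed
qed (use wf L in auto)

section \<open>Primitive recursive expressions\<close>

text \<open>Variables are de Bruijn indices into an environment. \<open>Rec\<close> binds the index of the round as variable
  \<open>0\<close> and the current value as variable \<open>1\<close>. \<open>Call\<close> evaluates a closed function in the environment
  of its arguments, so that functions can be composed without shifting indices.\<close>

datatype exp =
    EZero
  | Var nat
  | ESuc exp
  | IfEq exp exp exp exp
  | Rec exp exp exp
  | Call exp "exp list"

fun eval_exp :: "nat list \<Rightarrow> exp \<Rightarrow> nat" where
  "eval_exp env EZero = 0"
| "eval_exp env (Var i) = env ! i"
| "eval_exp env (ESuc e) = Suc (eval_exp env e)"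
| "eval_exp env (IfEq a b c d) =
    (if eval_exp env a = eval_exp env b then eval_exp env c else eval_exp env d)"
| "eval_exp env (Rec n a e) =
    rec_nat (eval_exp env a) (\<lambda>i r. eval_exp (i # r # env) e) (eval_exp env n)"
| "eval_exp env (Call f es) = eval_exp (map (eval_exp env) es) f"

text \<open>Every value that arises in the evaluation stays below \<open>K\<close>. For conditionals only the branch that
  is taken counts, which matters for searches that stop growing once they have succeeded.\<close>

fun below :: "nat \<Rightarrow> nat list \<Rightarrow> exp \<Rightarrow> bool" where
  "below K env EZero \<longleftrightarrow> True"
| "below K env (Var i) \<longleftrightarrow> i < length env"
| "below K env (ESuc e) \<longleftrightarrow> below K env e \<and> Suc (eval_exp env e) < K"
| "below K env (IfEq a b c d) \<longleftrightarrow> below K env a \<and> below K env b \<and>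
    (if eval_exp env a = eval_exp env b then below K env c else below K env d)"
| "below K env (Rec n a e) \<longleftrightarrow> below K env n \<and> below K env a \<and>
    (\<forall>i < eval_exp env n.
       below K (i # rec_nat (eval_exp env a) (\<lambda>i r. eval_exp (i # r # env) e) i # env) e)"
| "below K env (Call f es) \<longleftrightarrow>
    (\<forall>e \<in> set es. below K env e) \<and> below K (map (eval_exp env) es) f"

fun scoped :: "nat \<Rightarrow> exp \<Rightarrow> bool" where
  "scoped m EZero \<longleftrightarrow> True"
| "scoped m (Var i) \<longleftrightarrow> i < m"
| "scoped m (ESuc e) \<longleftrightarrow> scoped m e"
| "scoped m (IfEq a b c d) \<longleftrightarrow> scoped m a \<and> scoped m b \<and> scoped m c \<and> scoped m d"
| "scoped m (Rec n a e) \<longleftrightarrow> scoped m n \<and> scoped m a \<and> scoped (Suc (Suc m)) e"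
| "scoped m (Call f es) \<longleftrightarrow> (\<forall>e \<in> set es. scoped m e) \<and> scoped (length es) f"

definition copy_reg :: "nat \<Rightarrow> nat \<Rightarrow> com" where
  "copy_reg r x = Zero r ;; Until (Eq r x) (Inc r)"

text \<open>The result goes to register \<open>b\<close>; all registers from \<open>b\<close> on are scratch, and the environment is
  kept in the registers \<open>rs\<close> below \<open>b\<close>. A recursion keeps its value in \<open>b\<close>, the number of rounds in
  \<open>b + 1\<close> and the counter in \<open>b + 2\<close>, so that its body can use the last two as variables directly.\<close>

fun compile_exp :: "nat list \<Rightarrow> nat \<Rightarrow> exp \<Rightarrow> com"
  and compile_exps :: "nat list \<Rightarrow> nat \<Rightarrow> exp list \<Rightarrow> com" where
  "compile_exp rs b EZero = Zero b"
| "compile_exp rs b (Var i) = copy_reg b (rs ! i)"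
| "compile_exp rs b (ESuc e) = compile_exp rs b e ;; Inc b"
| "compile_exp rs b (IfEq e1 e2 e3 e4) =
    compile_exp rs b e1 ;; compile_exp rs (b + 1) e2 ;;
    If (Eq b (b + 1)) (compile_exp rs b e3) (compile_exp rs b e4)"
| "compile_exp rs b (Rec n a e) =
    compile_exp rs b a ;; compile_exp rs (b + 1) n ;; Zero (b + 2) ;;
    Until (Eq (b + 2) (b + 1))
      (compile_exp ((b + 2) # b # rs) (b + 3) e ;; copy_reg b (b + 3) ;; Inc (b + 2))"
| "compile_exp rs b (Call f es) =
    compile_exps rs (b + 1) es ;;
    compile_exp [b + 1..<b + 1 + length es] (b + 1 + length es) f ;;
    copy_reg b (b + 1 + length es)"
| "compile_exps rs b [] = Skip"
| "compile_exps rs b (e # es) = compile_exp rs b e ;; compile_exps rs (b + 1) es"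

lemma exec_copy_reg:
  assumes "r \<noteq> x" "R x < 2 ^ L"
  shows "exec w L (copy_reg r x) (R, p, W) [] (R(r := R x), p, W)"
proof -
  have "exec w L (Until (Eq r x) (Inc r)) (R(r := i), p, W) [] (R(r := R x), p, W)" if "i \<le> R x" for i
    using that
  proof (induction "R x - i" arbitrary: i)
    case 0
    then have i: "i = R x" by simp
    show ?case unfolding i by (rule exec.Until_True) (use assms(1) in simp)
  next
    case (Suc d)
    have "exec w L (Inc r) (R(r := i), p, W) [] ((R(r := i))(r := Suc ((R(r := i)) r)), p, W)"
      using Suc assms by (intro exec.Inc) simp
    then have "exec w L (Inc r) (R(r := i), p, W) [] (R(r := Suc i), p, W)" by simp
    from exec.Until_False[OF _ this Suc.hyps(1)[of "Suc i"]] Suc.hyps(2) Suc.prems assms(1)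
    show ?case by simp
  qed
  from exec.Seq[OF exec.Zero[of w L r R p W] this[of 0]] show ?thesis
    by (simp add: copy_reg_def)
qed

lemma exec_Seq_silent:
  "exec w L c s [] s' \<Longrightarrow> exec w L d s' tr s'' \<Longrightarrow> exec w L (c ;; d) s tr s''"
  using exec.Seq[of w L c s "[]"] by simp

lemma exec_witness:
  "exec w L c s [] (Q, p, W) \<Longrightarrow> P Q \<Longrightarrow> \<exists>R'. exec w L c s [] (R', p, W) \<and> P R'"
  by blast

text \<open>The registers below \<open>b\<close> survive, so the environment is still available when the next
  subexpression is evaluated one register higher.\<close>

lemma exec_compile_exp:
  fixes w :: "nat list" and L :: nat and p :: int and W :: "nat \<Rightarrow> nat list"
  shows "(\<forall>x \<in> set rs. x < b) \<Longrightarrow> below (2 ^ L) (map R rs) e \<Longrightarrow> (\<forall>r. R r < 2 ^ L) \<Longrightarrow>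
      \<exists>R'. exec w L (compile_exp rs b e) (R, p, W) [] (R', p, W) \<and> (\<forall>x<b. R' x = R x) \<and>
        R' b = eval_exp (map R rs) e \<and> (\<forall>r. R' r < 2 ^ L)"
    and "(\<forall>x \<in> set rs. x < b) \<Longrightarrow> (\<forall>e \<in> set es. below (2 ^ L) (map R rs) e) \<Longrightarrow> (\<forall>r. R r < 2 ^ L) \<Longrightarrow>
      \<exists>R'. exec w L (compile_exps rs b es) (R, p, W) [] (R', p, W) \<and> (\<forall>x<b. R' x = R x) \<and>
        map R' [b..<b + length es] = map (eval_exp (map R rs)) es \<and> (\<forall>r. R' r < 2 ^ L)"
proof (induction rs b e and rs b es arbitrary: R and R rule: compile_exp_compile_exps.induct)
  case (1 rs b)
  show ?case using 1 by (auto intro!: exI[of _ "R(b := 0)"] exec.Zero)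
next
  case (2 rs b i)
  have "rs ! i < b" using 2 by simp
  then have "exec w L (copy_reg b (rs ! i)) (R, p, W) [] (R(b := R (rs ! i)), p, W)"
    using 2 by (intro exec_copy_reg) auto
  then show ?case using 2 by (auto intro!: exI[of _ "R(b := R (rs ! i))"])
next
  case (3 rs b e)
  have bl: "below (2 ^ L) (map R rs) e" using "3.prems"(2) by simp
  from "3.IH"[OF "3.prems"(1) bl "3.prems"(3)] obtain R' where R': "exec w L (compile_exp rs b e) (R, p, W) [] (R', p, W)" "\<forall>x<b. R' x = R x"
    "R' b = eval_exp (map R rs) e" "\<forall>r. R' r < 2 ^ L" by blast
  have "exec w L (Inc b) (R', p, W) [] (R'(b := Suc (R' b)), p, W)"
    using 3 R' by (intro exec.Inc) simp
  then have ex: "exec w L (compile_exp rs b (ESuc e)) (R, p, W) [] (R'(b := Suc (R' b)), p, W)"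
    using exec_Seq_silent[OF R'(1)] by simp
  have "Suc (R' b) < 2 ^ L" using "3.prems"(2) R'(3) by simp
  then show ?case
    using R' by (intro exec_witness[OF ex]) auto
next
  case (4 rs b e1 e2 e3 e4)
  have env: "map R' rs = map R rs" if "\<forall>x<b. R' x = R x" for R'
    using that "4.prems"(1) by auto
  have bl: "below (2 ^ L) (map R rs) e1" using "4.prems"(2) by simp
  from "4.IH"(1)[OF "4.prems"(1) bl "4.prems"(3)]
  obtain R1 where R1: "exec w L (compile_exp rs b e1) (R, p, W) [] (R1, p, W)" "\<forall>x<b. R1 x = R x"
    "R1 b = eval_exp (map R rs) e1" "\<forall>r. R1 r < 2 ^ L" by blast
  have lt: "\<forall>x \<in> set rs. x < b + 1" using "4.prems"(1) by auto
  have bl': "below (2 ^ L) (map R1 rs) e2" unfolding env[OF R1(2)] using "4.prems"(2) by simp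
  from "4.IH"(2)[OF lt bl' R1(4)] obtain R2 where R2: "exec w L (compile_exp rs (b + 1) e2) (R1, p, W) [] (R2, p, W)" "\<forall>x<b + 1. R2 x = R1 x"
    "R2 (b + 1) = eval_exp (map R rs) e2" "\<forall>r. R2 r < 2 ^ L" using env[OF R1(2)] by auto
  have R2': "\<forall>x<b. R2 x = R x" using R1(2) R2(2) by simp
  show ?case
  proof (cases "eval_exp (map R rs) e1 = eval_exp (map R rs) e2")
    case True
    then obtain R3 where R3: "exec w L (compile_exp rs b e3) (R2, p, W) [] (R3, p, W)" "\<forall>x<b. R3 x = R2 x"
      "R3 b = eval_exp (map R2 rs) e3" "\<forall>r. R3 r < 2 ^ L"
      using "4.IH"(3)[of R2] "4.prems" R2(4) env[OF R2'] by auto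
    have "exec w L (If (Eq b (b + 1)) (compile_exp rs b e3) (compile_exp rs b e4)) (R2, p, W) [] (R3, p, W)"
      using True R2 R1 R3 by (intro exec.If_True) auto
    then show ?thesis
      using exec_Seq_silent[OF R1(1) exec_Seq_silent[OF R2(1)]] True R3 R2' env[OF R2']
      by (intro exI[of _ R3] conjI) auto
  next
    case False
    then obtain R3 where R3: "exec w L (compile_exp rs b e4) (R2, p, W) [] (R3, p, W)" "\<forall>x<b. R3 x = R2 x"
      "R3 b = eval_exp (map R2 rs) e4" "\<forall>r. R3 r < 2 ^ L"
      using "4.IH"(4)[of R2] "4.prems" R2(4) env[OF R2'] by auto
    have "exec w L (If (Eq b (b + 1)) (compile_exp rs b e3) (compile_exp rs b e4)) (R2, p, W) [] (R3, p, W)"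
      using False R2 R1 R3 by (intro exec.If_False) auto
    then show ?thesis
      using exec_Seq_silent[OF R1(1) exec_Seq_silent[OF R2(1)]] False R3 R2' env[OF R2']
      by (intro exI[of _ R3] conjI) auto
  qed
next
  case (5 rs b n a e)
  let ?env = "map R rs"
  define val where "val i = rec_nat (eval_exp ?env a) (\<lambda>i r. eval_exp (i # r # ?env) e) i" for i
  let ?m = "eval_exp ?env n"
  let ?body = "compile_exp ((b + 2) # b # rs) (b + 3) e ;; copy_reg b (b + 3) ;; Inc (b + 2)"
  have env: "map R' rs = map R rs" if "\<forall>x<b. R' x = R x" for R'
    using that "5.prems"(1) by auto
  have bl: "below (2 ^ L) (map R rs) a" using "5.prems"(2) by simp
  from "5.IH"(1)[OF "5.prems"(1) bl "5.prems"(3)]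
  obtain R1 where R1: "exec w L (compile_exp rs b a) (R, p, W) [] (R1, p, W)" "\<forall>x<b. R1 x = R x"
    "R1 b = eval_exp ?env a" "\<forall>r. R1 r < 2 ^ L" by blast
  have lt: "\<forall>x \<in> set rs. x < b + 1" using "5.prems"(1) by auto
  have bl': "below (2 ^ L) (map R1 rs) n" unfolding env[OF R1(2)] using "5.prems"(2) by simp
  from "5.IH"(2)[OF lt bl' R1(4)] obtain R2 where R2: "exec w L (compile_exp rs (b + 1) n) (R1, p, W) [] (R2, p, W)" "\<forall>x<b + 1. R2 x = R1 x"
    "R2 (b + 1) = ?m" "\<forall>r. R2 r < 2 ^ L" using env[OF R1(2)] by auto
  have loop: "\<exists>R'. exec w L (Until (Eq (b + 2) (b + 1)) ?body) (Q, p, W) [] (R', p, W) \<and>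
      (\<forall>x<b. R' x = R x) \<and> R' b = val ?m \<and> (\<forall>r. R' r < 2 ^ L)"
    if "i \<le> ?m" "\<forall>x<b. Q x = R x" "Q b = val i" "Q (b + 1) = ?m" "Q (b + 2) = i" "\<forall>r. Q r < 2 ^ L" for i Q
    using that
  proof (induction "?m - i" arbitrary: i Q)
    case 0
    then have "i = ?m" by simp
    then show ?case using 0 by (intro exI[of _ Q] conjI exec.Until_True) auto
  next
    case (Suc d)
    then have i: "i < ?m" by simp
    have "below (2 ^ L) (i # val i # ?env) e" using "5.prems"(2) i by (simp add: val_def)
    moreover have mq: "map Q ((b + 2) # b # rs) = i # val i # map R rs"
      by (simp only: list.map env[OF Suc.prems(2)] Suc.prems(3,5))
    ultimately have "below (2 ^ L) (map Q ((b + 2) # b # rs)) e" by (simp only:)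
    moreover have "\<forall>x \<in> set ((b + 2) # b # rs). x < b + 3" using "5.prems"(1) by fastforce
    ultimately obtain Q1 where Q1: "exec w L (compile_exp ((b + 2) # b # rs) (b + 3) e) (Q, p, W) [] (Q1, p, W)"
      "\<forall>x<b + 3. Q1 x = Q x" "Q1 (b + 3) = eval_exp (map Q ((b + 2) # b # rs)) e" "\<forall>r. Q1 r < 2 ^ L"
      using "5.IH"(3)[of Q] Suc.prems(6) by blast
    have v: "Q1 (b + 3) = val (Suc i)" using Q1(3) unfolding mq by (simp add: val_def)
    have vl: "val (Suc i) < 2 ^ L" using Q1(4) v by metis
    define Q3 where "Q3 = Q1(b := val (Suc i), b + 2 := Suc i)"
    have "exec w L (copy_reg b (b + 3)) (Q1, p, W) [] (Q1(b := val (Suc i)), p, W)"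
      using exec_copy_reg[of b "b + 3" Q1 L w p W] vl v by simp
    moreover have "Suc i < 2 ^ L" using i R2(3,4) by (metis le_less_trans Suc_leI)
    then have "exec w L (Inc (b + 2)) (Q1(b := val (Suc i)), p, W) [] (Q3, p, W)"
      using exec.Inc[of "Q1(b := val (Suc i))" "b + 2" L w p W] Q1(2) Suc.prems(5) by (simp add: Q3_def)
    ultimately have body: "exec w L ?body (Q, p, W) [] (Q3, p, W)"
      using Q1(1) exec_Seq_silent by blast
    have c3: "\<forall>r. Q3 r < 2 ^ L" using Q1(4) vl \<open>Suc i < 2 ^ L\<close> by (metis Q3_def fun_upd_apply)
    have "d = ?m - Suc i" "Suc i \<le> ?m" using Suc.hyps(2) i by simp_all
    moreover have "\<forall>x<b. Q3 x = R x" "Q3 b = val (Suc i)" "Q3 (b + 1) = ?m" "Q3 (b + 2) = Suc i"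
      using Q1(2) Suc.prems(2-5) by (simp_all add: Q3_def)
    ultimately obtain R' where "exec w L (Until (Eq (b + 2) (b + 1)) ?body) (Q3, p, W) [] (R', p, W)"
      "(\<forall>x<b. R' x = R x) \<and> R' b = val ?m \<and> (\<forall>r. R' r < 2 ^ L)"
      using Suc.hyps(1)[of "Suc i" Q3] c3 by blast
    moreover have "\<not> holds w (Q, p, W) (Eq (b + 2) (b + 1))" using i Suc.prems by simp
    ultimately show ?case using exec.Until_False[OF _ body] by (metis append_Nil)
  qed
  have z: "exec w L (Zero (b + 2)) (R2, p, W) [] (R2(b + 2 := 0), p, W)" by (rule exec.Zero)
  have "\<forall>r. (R2(b + 2 := 0)) r < 2 ^ L" using R2(4) by (simp add: fun_upd_apply)
  then have s0: "0 \<le> ?m" "\<forall>x<b. (R2(b + 2 := 0)) x = R x" "(R2(b + 2 := 0)) b = val 0"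
    "(R2(b + 2 := 0)) (b + 1) = ?m" "(R2(b + 2 := 0)) (b + 2) = 0" "\<forall>r. (R2(b + 2 := 0)) r < 2 ^ L"
    using R1(2,3) R2(2,3) by (simp_all add: val_def)
  obtain R' where R': "exec w L (Until (Eq (b + 2) (b + 1)) ?body) (R2(b + 2 := 0), p, W) [] (R', p, W)"
    "(\<forall>x<b. R' x = R x) \<and> R' b = val ?m \<and> (\<forall>r. R' r < 2 ^ L)"
    using loop[of 0 "R2(b + 2 := 0)"] s0 by blast
  then show ?case
    using exec_Seq_silent[OF R1(1) exec_Seq_silent[OF R2(1) exec_Seq_silent[OF z R'(1)]]]
    by (intro exI[of _ R']) (simp add: val_def)
next
  case (6 rs b f es)
  let ?b' = "b + 1 + length es"
  have lt: "\<forall>x \<in> set rs. x < b + 1" using "6.prems"(1) by auto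
  have bl: "\<forall>e \<in> set es. below (2 ^ L) (map R rs) e" using "6.prems"(2) by simp
  from "6.IH"(1)[OF lt bl "6.prems"(3)]
  obtain R1 where R1: "exec w L (compile_exps rs (b + 1) es) (R, p, W) [] (R1, p, W)" "\<forall>x<b + 1. R1 x = R x"
    "map R1 [b + 1..<b + 1 + length es] = map (eval_exp (map R rs)) es" "\<forall>r. R1 r < 2 ^ L" by blast
  have "below (2 ^ L) (map R1 [b + 1..<?b']) f" using "6.prems"(2) unfolding R1(3) by simp
  moreover have "\<forall>x \<in> set [b + 1..<?b']. x < ?b'" by auto
  ultimately obtain R2 where R2: "exec w L (compile_exp [b + 1..<?b'] ?b' f) (R1, p, W) [] (R2, p, W)"
    "\<forall>x<?b'. R2 x = R1 x" "R2 ?b' = eval_exp (map R1 [b + 1..<?b']) f" "\<forall>r. R2 r < 2 ^ L"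
    using "6.IH"(2)[of R1] R1(4) by blast
  have "exec w L (copy_reg b ?b') (R2, p, W) [] (R2(b := R2 ?b'), p, W)"
    using exec_copy_reg[of b ?b' R2 L w p W] R2(4) by simp
  then have ex: "exec w L (compile_exp rs b (Call f es)) (R, p, W) [] (R2(b := R2 ?b'), p, W)"
    using exec_Seq_silent[OF R1(1) exec_Seq_silent[OF R2(1)]] by simp
  have v: "R2 ?b' = eval_exp (map R rs) (Call f es)" using R2(3) unfolding R1(3) by simp
  moreover have "eval_exp (map R rs) (Call f es) < 2 ^ L" using R2(4) v by metis
  ultimately show ?case using R1(2) R2(2,4) by (intro exec_witness[OF ex]) auto
next
  case (7 rs b)
  then show ?case by (auto intro!: exI[of _ R] exec.Skip)
next
  case (8 rs b e es)
  have env: "map R' rs = map R rs" if "\<forall>x<b. R' x = R x" for R'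
    using that "8.prems"(1) by auto
  have bl: "below (2 ^ L) (map R rs) e" using "8.prems"(2) by simp
  from "8.IH"(1)[OF "8.prems"(1) bl "8.prems"(3)]
  obtain R1 where R1: "exec w L (compile_exp rs b e) (R, p, W) [] (R1, p, W)" "\<forall>x<b. R1 x = R x"
    "R1 b = eval_exp (map R rs) e" "\<forall>r. R1 r < 2 ^ L" by blast
  have lt: "\<forall>x \<in> set rs. x < b + 1" using "8.prems"(1) by auto
  have bl': "\<forall>e \<in> set es. below (2 ^ L) (map R1 rs) e"
    unfolding env[OF R1(2)] using "8.prems"(2) by simp
  from "8.IH"(2)[OF lt bl' R1(4)] env[OF R1(2)] obtain R2 where R2: "exec w L (compile_exps rs (b + 1) es) (R1, p, W) [] (R2, p, W)" "\<forall>x<b + 1. R2 x = R1 x"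
    "map R2 [b + 1..<b + 1 + length es] = map (eval_exp (map R rs)) es" "\<forall>r. R2 r < 2 ^ L"
    by metis
  have up: "map R2 [b..<b + length (e # es)] = R2 b # map R2 [b + 1..<b + 1 + length es]"
    by (simp add: upt_conv_Cons del: upt_Suc)
  have ex: "exec w L (compile_exps rs b (e # es)) (R, p, W) [] (R2, p, W)"
    using exec_Seq_silent[OF R1(1) R2(1)] by simp
  show ?case
    by (rule exec_witness[OF ex]) (use R1(2,3) R2(2-4) up in \<open>simp del: upt_Suc\<close>)
qed

lemma compile_exp_wf:
  shows "(\<forall>x \<in> set rs. x < b) \<Longrightarrow> scoped (length rs) e \<Longrightarrow> com_wf (compile_exp rs b e)"
    and "(\<forall>x \<in> set rs. x < b) \<Longrightarrow> (\<forall>e \<in> set es. scoped (length rs) e) \<Longrightarrow> com_wf (compile_exps rs b es)"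
proof (induction rs b e and rs b es rule: compile_exp_compile_exps.induct)
  case (2 rs b i)
  then have "rs ! i < b" by simp
  then show ?case by (simp add: copy_reg_def cond_wf_def)
next
  case (5 rs b n a e)
  have "\<forall>x \<in> set rs. x < b + 1" "\<forall>x \<in> set ((b + 2) # b # rs). x < b + 3"
    using "5.prems"(1) by auto
  then show ?case using 5 by (simp add: copy_reg_def cond_wf_def)
next
  case (6 rs b f es)
  have "\<forall>x \<in> set rs. x < b + 1" using "6.prems"(1) by auto
  moreover have "com_wf (compile_exp [b + 1..<b + 1 + length es] (b + 1 + length es) f)"
    by (rule "6.IH"(2)) (use "6.prems" in \<open>auto simp del: upt_Suc\<close>)
  ultimately show ?case using 6 by (simp add: copy_reg_def cond_wf_def del: upt_Suc)
qed (auto simp: copy_reg_def cond_wf_def less_Suc_eq)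

lemma mark_count_compile_exp [simp]:
  "mark_count pt (compile_exp rs b e) = 0" "mark_count pt (compile_exps rs b es) = 0"
  by (induction rs b e and rs b es rule: compile_exp_compile_exps.induct) (auto simp: copy_reg_def)


section \<open>Arithmetic by primitive recursion\<close>

text \<open>Quotients and remainders are counted up together with the dividend: passing from \<open>i\<close> to \<open>i + 1\<close>
  raises the remainder by one or resets it, and raises the quotient exactly when it is reset.\<close>

definition "add_exp = Rec (Var 1) (Var 0) (ESuc (Var 1))"
definition "mul_exp = Rec (Var 1) EZero (Call add_exp [Var 1, Var 2])"
definition "pow_exp = Rec (Var 1) (ESuc EZero) (Call mul_exp [Var 1, Var 2])"
definition "pred_exp = Rec (Var 0) EZero (Var 0)"
definition "mod_exp = Rec (Var 0) EZero (IfEq (ESuc (Var 1)) (Var 3) EZero (ESuc (Var 1)))"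
definition "div_exp = Rec (Var 0) EZero (IfEq (Call mod_exp [ESuc (Var 0), Var 3]) EZero (ESuc (Var 1)) (Var 1))"

lemma rec_add: "rec_nat x (\<lambda>i r. Suc r) y = x + y"
  by (induction y) auto

lemma eval_add [simp]: "eval_exp [x, y] add_exp = x + y"
  by (simp add: add_exp_def rec_add)

lemma below_add: "x + y < K \<Longrightarrow> below K [x, y] add_exp"
  by (auto simp: add_exp_def rec_add)

lemma rec_mul: "rec_nat 0 (\<lambda>i r. r + x) y = x * (y :: nat)"
  by (induction y) auto

lemma eval_mul [simp]: "eval_exp [x, y] mul_exp = x * y"
  by (simp add: mul_exp_def rec_mul)

lemma below_mul:
  assumes "x * y < K"
  shows "below K [x, y] mul_exp"
proof -
  have "x * i + x < K" if "i < y" for i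
    using mult_le_mono2[of "Suc i" y x] that assms by simp
  then show ?thesis by (auto simp: mul_exp_def rec_mul intro!: below_add)
qed

lemma rec_pow: "rec_nat (Suc 0) (\<lambda>i r. r * x) y = x ^ y"
  by (induction y) auto

lemma eval_pow [simp]: "eval_exp [x, y] pow_exp = x ^ y"
  by (simp add: pow_exp_def rec_pow)

lemma below_pow:
  assumes "x ^ y < K" "0 < x" "1 < K"
  shows "below K [x, y] pow_exp"
proof -
  have "x ^ i * x < K" if "i < y" for i
    using power_increasing[of "Suc i" y x] that assms by (simp add: mult.commute)
  then show ?thesis using assms(3) by (auto simp: pow_exp_def rec_pow intro!: below_mul)
qed

lemma rec_pred: "rec_nat 0 (\<lambda>i r. i) x = x - 1"
  by (cases x) auto

lemma eval_pred [simp]: "eval_exp [x] pred_exp = x - 1"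
  by (simp add: pred_exp_def rec_pred)

lemma below_pred: "below K [x] pred_exp"
  by (simp add: pred_exp_def)

lemma rec_mod: "rec_nat 0 (\<lambda>i r. if Suc r = y then 0 else Suc r) x = x mod y"
  by (induction x) (auto simp: mod_Suc)

lemma eval_mod [simp]: "eval_exp [x, y] mod_exp = x mod y"
  by (simp add: mod_exp_def rec_mod cong: if_cong)

lemma below_mod:
  assumes "x < K"
  shows "below K [x, y] mod_exp"
proof -
  have "Suc (i mod y) < K" if "i < x" for i
    using assms that mod_less_eq_dividend[of i y] by linarith
  then show ?thesis by (simp add: mod_exp_def rec_mod cong: if_cong)
qed

lemma rec_div: "rec_nat 0 (\<lambda>i r. if Suc i mod y = 0 then Suc r else r) x = x div y"
  by (induction x) (auto simp: div_Suc)

lemma eval_div [simp]: "eval_exp [x, y] div_exp = x div y"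
  by (simp add: div_exp_def rec_div cong: if_cong)

lemma below_div:
  assumes "x < K"
  shows "below K [x, y] div_exp"
proof -
  have "Suc (i div y) < K" if "i < x" for i
    using assms that div_le_dividend[of i y] by linarith
  then show ?thesis using assms by (simp add: div_exp_def rec_div below_mod cong: if_cong)
qed

section \<open>Simple paths and cycles as vertex sequences\<close>

lemma path_edges_Nil [simp]: "path_edges [] = []" "path_edges [x] = []"
  by (simp_all add: path_edges_def)

lemma path_edges_Cons [simp]: "path_edges (x # y # p) = (x, y) # path_edges (y # p)"
  by (simp add: path_edges_def)

lemma length_path_edges [simp]: "length (path_edges p) = length p - 1"
  by (simp add: path_edges_def)

lemma nth_path_edges: "Suc i < length p \<Longrightarrow> path_edges p ! i = (p ! i, p ! Suc i)"
  by (simp add: path_edges_def nth_tl)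

lemma all_path_edges:
  "(\<forall>e \<in> set (path_edges p). P e) \<longleftrightarrow> (\<forall>i. Suc i < length p \<longrightarrow> P (p ! i, p ! Suc i))"
proof -
  have "(\<forall>e \<in> set (path_edges p). P e) \<longleftrightarrow> (\<forall>i < length p - 1. P (path_edges p ! i))"
    by (simp add: all_set_conv_all_nth)
  also have "\<dots> \<longleftrightarrow> (\<forall>i. Suc i < length p \<longrightarrow> P (path_edges p ! i))"
    by (auto simp: less_diff_conv)
  also have "\<dots> \<longleftrightarrow> (\<forall>i. Suc i < length p \<longrightarrow> P (p ! i, p ! Suc i))"
    by (simp add: nth_path_edges)
  finally show ?thesis .
qed

lemma edge_path_path_edges: "edge_path A (path_edges p) \<longleftrightarrow> set (path_edges p) \<subseteq> edges A"
  by (auto simp: edge_path_def nth_path_edges)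

lemma is_path_iff:
  "is_path A p \<longleftrightarrow> p \<noteq> [] \<and> set p \<subseteq> {..<dim_row A} \<and>
    (\<forall>i. Suc i < length p \<longrightarrow> A $$ (p ! i, p ! Suc i) \<noteq> 0)"
proof -
  have "set (path_edges p) \<subseteq> edges A \<longleftrightarrow> (\<forall>i. Suc i < length p \<longrightarrow> A $$ (p ! i, p ! Suc i) \<noteq> 0)"
    if "set p \<subseteq> {..<dim_row A}"
  proof -
    have "p ! i < dim_row A" if "i < length p" for i
      using that \<open>set p \<subseteq> _\<close> nth_mem by blast
    then show ?thesis
      using all_path_edges[of p "\<lambda>e. e \<in> edges A"] by (auto simp: subset_iff edges_def Suc_lessD)
  qed
  then show ?thesis by (auto simp: is_path_def edge_path_path_edges)
qed

lemma path_prod_nth: "path_prod M p = (\<Prod>i<length p - 1. M $$ (p ! i, p ! Suc i))"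
proof (induction p rule: induct_list012)
  case (3 x y p)
  have "path_prod M (x # y # p) = M $$ (x, y) * path_prod M (y # p)"
    by (simp add: path_prod_def)
  then show ?case using 3 by (simp add: prod.lessThan_Suc_shift del: prod.lessThan_Suc)
qed (simp_all add: path_prod_def)

text \<open>Along the edges of a repetition-free sequence the position of the vertex increases, so a chain
  of such edges never comes back to where it started, even if it leaves out edges.\<close>

lemma chain_not_closed:
  assumes "distinct p" "set es \<subseteq> set (path_edges p)" "edge_path A es" "es \<noteq> []"
  shows "edge_range (hd es) \<noteq> edge_source (last es)"
proof -
  define pos where "pos x = (THE i. i < length p \<and> p ! i = x)" for x
  have pos: "pos (p ! i) = i" if "i < length p" for i
    unfolding pos_def using that assms(1) by (auto simp: nth_eq_iff_index_eq)
  have step: "pos (edge_source e) = Suc (pos (edge_range e))" if e: "e \<in> set es" for e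
  proof -
    have "e \<in> set (path_edges p)" using e assms(2) by auto
    then obtain i where "i < length p - 1" "e = path_edges p ! i"
      by (auto simp: in_set_conv_nth)
    then have "Suc i < length p" "e = (p ! i, p ! Suc i)" by (auto simp: nth_path_edges)
    then show ?thesis by (simp add: pos)
  qed
  have "pos (edge_source (es ! i)) = pos (edge_range (es ! 0)) + Suc i" if "i < length es" for i
    using that
  proof (induction i)
    case 0
    then show ?case using step nth_mem by fastforce
  next
    case (Suc i)
    have "edge_source (es ! i) = edge_range (es ! Suc i)"
      using assms(3) Suc.prems by (simp add: edge_path_def)
    then show ?case using Suc step[of "es ! Suc i"] by simp
  qed
  from this[of "length es - 1"] show ?thesis
    using assms(4) by (auto simp: hd_conv_nth last_conv_nth)
qed

lemma set_subseq: "subseq xs ys \<Longrightarrow> set xs \<subseteq> set ys"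
  by (induction rule: list_emb.induct) auto

lemma simple_path_iff: "simple_path A p \<longleftrightarrow> is_path A p \<and> distinct p"
proof
  assume "simple_path A p"
  then show "is_path A p \<and> distinct p" using simple_path_distinct by (auto simp: simple_path_def)
next
  assume p: "is_path A p \<and> distinct p"
  have "\<not> edge_cycle A es" if "subseq es (path_edges p)" for es
    using chain_not_closed[of p es A] p set_subseq[OF that] by (auto simp: edge_cycle_def)
  then show "simple_path A p" using p by (auto simp: simple_path_def)
qed

lemma hd_path_edges: "2 \<le> length p \<Longrightarrow> edge_range (hd (path_edges p)) = hd p"
  by (induction p rule: induct_list012) auto

lemma last_path_edges: "2 \<le> length p \<Longrightarrow> edge_source (last (path_edges p)) = last p"
proof -
  assume p: "2 \<le> length p"
  then have "path_edges p \<noteq> []" using length_path_edges[of p] by force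
  moreover have "Suc (length p - 2) < length p" "Suc (length p - 2) = length p - 1" using p by auto
  moreover have "p \<noteq> []" using p by auto
  ultimately show ?thesis using p nth_path_edges[of "length p - 2" p]
    by (simp add: last_conv_nth numeral_2_eq_2)
qed

lemma path_edges_vertices: "e \<in> set (path_edges p) \<Longrightarrow> edge_range e \<in> set p \<and> edge_source e \<in> set p"
  by (induction p rule: induct_list012) auto

text \<open>With distinct vertices an edge is determined by its range. A chain that starts at the first vertex
  is therefore forced along the path edge by edge until it reaches the last vertex.\<close>

lemma full_chain:
  assumes "distinct q" "subseq es (path_edges q)" "es \<noteq> []" "edge_path A es"
    and "edge_range (hd es) = hd q" "edge_source (last es) = last q"
  shows "es = path_edges q"
  using assms
proof (induction q arbitrary: es rule: induct_list012)
  case (3 x y r)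
  obtain e es' where es: "es = e # es'" using "3.prems"(3) by (cases es) auto
  have e: "e = (x, y)"
  proof (rule ccontr)
    \<comment> \<open>Then all of \<open>es\<close> lies in the later edges, none of which has range \<open>x\<close>.\<close>
    assume "e \<noteq> (x, y)"
    then have "subseq es (path_edges (y # r))" using "3.prems"(2) es by auto
    then have "e \<in> set (path_edges (y # r))" using set_subseq es by fastforce
    then have "edge_range e \<in> set (y # r)" using path_edges_vertices by blast
    then show False using "3.prems"(1,5) es by simp
  qed
  have sub: "subseq es' (path_edges (y # r))" using "3.prems"(2) es e by simp
  show ?case
  proof (cases "es' = []")
    case True
    then have "y = last (y # r)" using "3.prems"(6) es e by simp
    then have "r = []" using "3.prems"(1) by (cases r) (auto split: if_splits)
    then show ?thesis using True es e by simp
  next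
    case False
    have "Suc 0 < length es \<Longrightarrow> edge_source (es ! 0) = edge_range (es ! Suc 0)"
      using "3.prems"(4) by (simp add: edge_path_def)
    then have "edge_source e = edge_range (es' ! 0)" using es False by simp
    then have "edge_range (hd es') = y" using e False by (simp add: hd_conv_nth)
    moreover have "edge_path A es'" using "3.prems"(4) edge_path_appendD[of A "[e]" es' "[]"] es by simp
    ultimately have "es' = path_edges (y # r)"
      using "3.IH"(2)[of es'] "3.prems"(1,6) es sub False by auto
    then show ?thesis using es e by simp
  qed
qed auto

text \<open>A proper subsequence of the edges that is a cycle would either avoid the first edge and lie in the
  rest, which is a simple path, or contain it and then by \<open>full_chain\<close> be everything.\<close>

lemma simple_cycle_iff:
  "simple_cycle A c \<longleftrightarrow> is_path A c \<and> 2 \<le> length c \<and> hd c = last c \<and> distinct (tl c)"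
proof
  assume s: "simple_cycle A c"
  then have "path_edges c \<noteq> []" by (auto simp: simple_cycle_def edge_cycle_def)
  then have "2 \<le> length c" by (cases c; cases "tl c") auto
  moreover have "hd c = last c"
    using s calculation hd_path_edges last_path_edges by (simp add: simple_cycle_def edge_cycle_def)
  ultimately show "is_path A c \<and> 2 \<le> length c \<and> hd c = last c \<and> distinct (tl c)"
    using s simple_cycle_distinct_tl by (simp add: simple_cycle_def)
next
  assume c: "is_path A c \<and> 2 \<le> length c \<and> hd c = last c \<and> distinct (tl c)"
  then obtain x y r where xy: "c = x # y # r" by (cases c; cases "tl c") auto
  have len: "path_edges c \<noteq> []" using xy by simp
  have "edge_cycle A (path_edges c)"
    using c len hd_path_edges last_path_edges by (simp add: edge_cycle_def is_path_def)
  moreover have "\<not> edge_cycle A es" if sub: "strict_subseq es (path_edges c)" for es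
  proof
    assume es: "edge_cycle A es"
    have sub': "subseq es ((x, y) # path_edges (y # r))"
      using sub xy by (simp add: strict_subseq_def)
    obtain e es' where ee: "es = e # es'" using es by (cases es) (auto simp: edge_cycle_def)
    show False
    proof (cases "e = (x, y)")
      case False
      then have "subseq es (path_edges (y # r))" using sub' ee by auto
      then show False
        using chain_not_closed[of "y # r" es A] c xy es set_subseq by (auto simp: edge_cycle_def)
    next
      case True
      have s: "subseq es' (path_edges (y # r))" using sub' ee True by simp
      have last: "edge_source (last es) = last (y # r)"
        using es ee True c xy by (simp add: edge_cycle_def)
      have "es' = path_edges (y # r)"
      proof (cases "es' = []")
        case emp: True
        then have "y = last (y # r)" using last ee True by simp
        then have "r = []" using c xy by (cases r) (auto split: if_splits)
        then show ?thesis using emp by simp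
      next
        case ne: False
        have "Suc 0 < length es \<Longrightarrow> edge_source (es ! 0) = edge_range (es ! Suc 0)"
          using es by (simp add: edge_cycle_def edge_path_def)
        then have "edge_source e = edge_range (es' ! 0)" using ee ne by simp
        then have "edge_range (hd es') = y" using True ne by (simp add: hd_conv_nth)
        moreover have "edge_path A es'"
          using es edge_path_appendD[of A "[e]" es' "[]"] ee by (simp add: edge_cycle_def)
        ultimately show ?thesis using full_chain[of "y # r" es' A] c xy s ne last ee by simp
      qed
      then show False using sub ee True xy by (simp add: strict_subseq_def)
    qed
  qed
  ultimately show "simple_cycle A c" using c by (auto simp: simple_cycle_def)
qed


section \<open>Padded codes of vertex sequences\<close>

definition digit :: "nat \<Rightarrow> nat \<Rightarrow> nat \<Rightarrow> nat" where
  "digit x b i = x div b ^ i mod b"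

text \<open>Base \<open>b\<close>, \<open>k\<close> digits, most significant digit first. The digits of vertices are shifted by one so that
  the padding digit \<open>0\<close> is smaller than all of them, as a proper prefix comes first in the
  lexicographic order.\<close>

fun padded_code :: "nat \<Rightarrow> nat \<Rightarrow> path \<Rightarrow> nat" where
  "padded_code b 0 p = 0"
| "padded_code b (Suc k) [] = 0"
| "padded_code b (Suc k) (v # p) = Suc v * b ^ k + padded_code b k p"

lemma padded_code_Nil [simp]: "padded_code b k [] = 0"
  by (cases k) auto

definition codable :: "nat \<Rightarrow> path \<Rightarrow> bool" where
  "codable b p \<longleftrightarrow> (\<forall>v \<in> set p. Suc v < b)"

lemma codable_simps [simp]: "codable b []" "codable b (v # p) \<longleftrightarrow> Suc v < b \<and> codable b p"
  by (auto simp: codable_def)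

lemma padded_code_less: "0 < b \<Longrightarrow> codable b p \<Longrightarrow> padded_code b k p < b ^ k"
proof (induction b k p rule: padded_code.induct)
  case (3 b k v p)
  have "padded_code b k p < b ^ k" using 3 by simp
  moreover have "Suc (Suc v) * b ^ k \<le> b * b ^ k" using 3 by (intro mult_right_mono) auto
  ultimately show ?case by (simp add: algebra_simps)
qed auto

lemma digit_less: "0 < b \<Longrightarrow> digit x b i < b"
  by (simp add: digit_def)

lemma digit_low: "i < k \<Longrightarrow> digit (a * b ^ k + x) b i = digit x b i" if "0 < b"
proof -
  assume "i < k"
  then obtain d where k: "k = i + Suc d" by (metis less_iff_Suc_add add_Suc_right)
  have "a * b ^ k + x = x + (a * b ^ d * b) * b ^ i" by (simp add: k power_add algebra_simps)
  moreover have "(x + (a * b ^ d * b) * b ^ i) div b ^ i = (a * b ^ d) * b + x div b ^ i"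
    using that by (intro div_mult_self1) simp
  ultimately have "(a * b ^ k + x) div b ^ i = (a * b ^ d) * b + x div b ^ i" by (simp only:)
  then show ?thesis by (simp add: digit_def)
qed

lemma digit_high: "a < b \<Longrightarrow> x < b ^ k \<Longrightarrow> digit (a * b ^ k + x) b k = a"
  by (simp add: digit_def)

lemma digit_padded_code:
  assumes "0 < b" "codable b p" "i < k"
  shows "digit (padded_code b k p) b (k - Suc i) = (if i < length p then Suc (p ! i) else 0)"
  using assms
proof (induction b k p arbitrary: i rule: padded_code.induct)
  case (2 b k)
  then show ?case by (simp add: digit_def)
next
  case (3 b k v p)
  show ?case
  proof (cases i)
    case 0
    then show ?thesis using 3 padded_code_less digit_high[of "Suc v" b "padded_code b k p" k] by simp
  next
    case (Suc j)
    then have "digit (Suc v * b ^ k + padded_code b k p) b (k - Suc j) =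
        digit (padded_code b k p) b (k - Suc j)"
      using 3 by (intro digit_low) auto
    then show ?thesis using 3 Suc by simp
  qed
qed auto

lemma padded_code_mono:
  assumes "0 < b" "codable b p" "codable b q" "length p \<le> k" "length q \<le> k" "p < q"
  shows "padded_code b k p < padded_code b k q"
  using assms
proof (induction k arbitrary: p q)
  case (Suc k)
  obtain y q' where q: "q = y # q'" using Suc.prems(6) by (cases q) auto
  show ?case
  proof (cases p)
    case Nil
    then show ?thesis using q Suc.prems by simp
  next
    case (Cons x p')
    then consider "x < y" | "x = y" "p' < q'" using Suc.prems(6) q by auto
    then show ?thesis
    proof cases
      case 1
      have "padded_code b k p' < b ^ k" using padded_code_less Suc.prems Cons by simp
      moreover have "Suc (Suc x) * b ^ k \<le> Suc y * b ^ k" using 1 by (intro mult_right_mono) auto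
      ultimately show ?thesis using Cons q by (simp add: algebra_simps)
    next
      case 2
      then show ?thesis using Suc Cons q by simp
    qed
  qed
qed auto

text \<open>Codes are recognised by their digits: zeros occur only at the end.\<close>

lemma padded_code_surj:
  assumes "0 < b" "x < b ^ k" "\<And>i. Suc i < k \<Longrightarrow> digit x b (Suc i) = 0 \<Longrightarrow> digit x b i = 0"
  obtains p where "codable b p" "length p \<le> k" "x = padded_code b k p"
  using assms
proof (induction k arbitrary: x thesis)
  case 0
  then show ?case by (intro 0(1)[of "[]"]) auto
next
  case (Suc k)
  let ?a = "x div b ^ k" and ?y = "x mod b ^ k"
  have x: "x = ?a * b ^ k + ?y" by (rule div_mult_mod_eq[symmetric])
  have y: "?y < b ^ k" using Suc.prems(2) by simp
  have a: "?a < b" using Suc.prems(3) by (simp add: less_mult_imp_div_less)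
  have dig: "digit x b i = digit ?y b i" if "i < k" for i
    using digit_low[OF Suc.prems(2) that, of ?a ?y] by (simp only: div_mult_mod_eq)
  obtain p where p: "codable b p" "length p \<le> k" "?y = padded_code b k p"
  proof (rule Suc.IH[of ?y])
    show "digit ?y b i = 0" if "Suc i < k" "digit ?y b (Suc i) = 0" for i
      using Suc.prems(4)[of i] that dig[of i] dig[of "Suc i"] by simp
  qed (use Suc.prems(2) y in auto)
  show ?case
  proof (cases "?a")
    case 0
    have dk: "digit x b k = 0" using 0 by (simp add: digit_def)
    note zeros = Suc.prems(4)
    \<comment> \<open>A leading zero forces all digits to be zero, so the sequence is empty.\<close>
  have top: "digit x b (k - j) = 0" if "j \<le> k" for j
      using that
    proof (induction j)
      case (Suc j)
      have "Suc (k - Suc j) = k - j" using Suc.prems by simp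
      then show ?case using Suc.IH Suc.prems zeros[of "k - Suc j"] by simp
    qed (simp add: dk)
    from top[of 1] have "k \<noteq> 0 \<Longrightarrow> digit ?y b (k - 1) = 0" using dig[of "k - 1"] by simp
    then have "p ! 0 = p ! 0 \<and> length p = 0"
      using digit_padded_code[OF Suc.prems(2) p(1), of 0 k] p(2,3)
      by (cases "k = 0") (auto split: if_splits)
    then have "?y = 0" using p(3) by simp
    then have "x = padded_code b (Suc k) []" using 0 x by simp
    then show ?thesis using Suc.prems(1)[of "[]"] by simp
  next
    case (Suc v)
    then have "x = padded_code b (Suc k) (v # p)" using x p(3) by simp
    then show ?thesis using Suc.prems(1)[of "v # p"] p a Suc by simp
  qed
qed

declare padded_code.simps [simp del]

text \<open>In the following definitions digits are counted from the least significant one, so digit \<open>n\<close> is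
  the first vertex of the sequence and digit \<open>n - i\<close> its vertex number \<open>i\<close>.\<close>

definition zeros_last :: "nat \<Rightarrow> nat \<Rightarrow> bool" where
  "zeros_last n x \<longleftrightarrow> (\<forall>i<n. digit x (Suc n) (Suc i) = 0 \<longrightarrow> digit x (Suc n) i = 0)"

text \<open>Only the lowest \<open>m\<close> digits are compared: for \<open>m = n + 1\<close> these are all vertices, for \<open>m = n\<close> the
  first vertex is left out, as is appropriate for cycles.\<close>

definition digits_distinct :: "nat \<Rightarrow> nat \<Rightarrow> nat \<Rightarrow> bool" where
  "digits_distinct n m x \<longleftrightarrow>
    (\<forall>i<m. \<forall>j<m. digit x (Suc n) i = digit x (Suc n) j \<longrightarrow> i = j \<or> digit x (Suc n) i = 0)"

text \<open>The lowest nonzero digit, found by a search from below; the source of the path.\<close>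

definition last_digit :: "nat \<Rightarrow> nat \<Rightarrow> nat" where
  "last_digit n x = rec_nat 0 (\<lambda>i r. if r = 0 then digit x (Suc n) i else r) (Suc n)"

text \<open>Product of an edge weight over the edges of the path; padding contributes factors \<open>1\<close>.\<close>

definition walk_prod :: "nat \<Rightarrow> (nat \<Rightarrow> nat \<Rightarrow> nat) \<Rightarrow> nat \<Rightarrow> nat" where
  "walk_prod n f x = (\<Prod>i<n. if digit x (Suc n) i = 0 then 1
     else f (digit x (Suc n) (Suc i) - 1) (digit x (Suc n) i - 1))"

abbreviation code_of :: "nat \<Rightarrow> path \<Rightarrow> nat" where
  "code_of n p \<equiv> padded_code (Suc n) (Suc n) p"

lemma digit_code_of:
  assumes "codable (Suc n) p" "i \<le> n"
  shows "digit (code_of n p) (Suc n) i = (if n - i < length p then Suc (p ! (n - i)) else 0)"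
  using digit_padded_code[of "Suc n" p "n - i" "Suc n"] assms by simp

lemma zeros_last_code_of: "codable (Suc n) p \<Longrightarrow> zeros_last n (code_of n p)"
  by (auto simp: zeros_last_def digit_code_of split: if_splits)

text \<open>The reflection \<open>i \<mapsto> m - 1 - i\<close> turns digit numbers into positions in the sequence.\<close>

lemma digits_distinct_code_of:
  assumes p: "codable (Suc n) p" "length p \<le> Suc n" and m: "m \<le> Suc n"
  shows "digits_distinct n m (code_of n p) \<longleftrightarrow> distinct (drop (Suc n - m) p)"
proof -
  let ?s = "Suc n - m" and ?d = "\<lambda>i. digit (code_of n p) (Suc n) i"
  have "digits_distinct n m (code_of n p) \<longleftrightarrow> (\<forall>i<m. \<forall>j<m. ?d (m - Suc i) = ?d (m - Suc j) \<longrightarrow>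
      m - Suc i = m - Suc j \<or> ?d (m - Suc i) = 0)"
  proof
    assume d: "\<forall>i<m. \<forall>j<m. ?d (m - Suc i) = ?d (m - Suc j) \<longrightarrow> m - Suc i = m - Suc j \<or> ?d (m - Suc i) = 0"
    show "digits_distinct n m (code_of n p)"
      unfolding digits_distinct_def
    proof (intro allI impI)
      fix i j assume ij: "i < m" "j < m" "?d i = ?d j"
      then have "m - Suc (m - Suc i) = i" "m - Suc (m - Suc j) = j" "m - Suc i < m" "m - Suc j < m" by auto
      then show "i = j \<or> ?d i = 0" using d ij(3) by metis
    qed
  qed (auto simp: digits_distinct_def)
  also have "\<dots> \<longleftrightarrow> (\<forall>i<m. \<forall>j<m. ?d (m - Suc i) = ?d (m - Suc j) \<longrightarrow> i = j \<or> ?d (m - Suc i) = 0)"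
    by (intro all_cong imp_cong refl) (auto dest: arg_cong[of _ _ "\<lambda>x. m - Suc x"])
  also have "\<dots> \<longleftrightarrow> (\<forall>i < length (drop ?s p). \<forall>j < length (drop ?s p). drop ?s p ! i = drop ?s p ! j \<longrightarrow> i = j)"
  proof -
    have dig: "?d (m - Suc i) = (if i < length p - ?s then Suc (drop ?s p ! i) else 0)" if "i < m" for i
    proof -
      have "n - (m - Suc i) = ?s + i" using that m by auto
      then show ?thesis using digit_code_of[OF p(1), of "m - Suc i"] that m
        by (auto simp: less_diff_conv add.commute)
    qed
    have len: "length p - ?s \<le> m" using p(2) by auto
    show ?thesis
    proof (intro iffI allI impI)
      fix i j
      assume L: "\<forall>i<m. \<forall>j<m. ?d (m - Suc i) = ?d (m - Suc j) \<longrightarrow> i = j \<or> ?d (m - Suc i) = 0"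
        and ij: "i < length (drop ?s p)" "j < length (drop ?s p)" "drop ?s p ! i = drop ?s p ! j"
      have "i < m" "j < m" using ij len by auto
      then show "i = j" using L ij dig[of i] dig[of j] by (metis length_drop nat.distinct(1))
    next
      fix i j
      assume R: "\<forall>i < length (drop ?s p). \<forall>j < length (drop ?s p). drop ?s p ! i = drop ?s p ! j \<longrightarrow> i = j"
        and ij: "i < m" "j < m" "?d (m - Suc i) = ?d (m - Suc j)"
      show "i = j \<or> ?d (m - Suc i) = 0"
        using R ij(3) unfolding dig[OF ij(1)] dig[OF ij(2)] by (auto split: if_splits)
    qed
  qed
  also have "\<dots> \<longleftrightarrow> distinct (drop ?s p)" by (auto simp: distinct_conv_nth)
  finally show ?thesis .
qed

lemma last_digit_code_of:
  assumes "codable (Suc n) p" "length p \<le> Suc n" "p \<noteq> []"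
  shows "last_digit n (code_of n p) = Suc (last p)"
proof -
  have "rec_nat 0 (\<lambda>i r. if r = 0 then digit (code_of n p) (Suc n) i else r) j =
      (if j \<le> Suc n - length p then 0 else Suc (last p))" if "j \<le> Suc n" for j
    using that
  proof (induction j)
    case (Suc j)
    have d: "digit (code_of n p) (Suc n) j = (if n - j < length p then Suc (p ! (n - j)) else 0)"
      using digit_code_of[OF assms(1)] Suc.prems by simp
    consider "Suc j \<le> Suc n - length p" | "j = Suc n - length p" | "Suc n - length p < j" by linarith
    then show ?case
    proof cases
      case 1
      then show ?thesis using Suc d by auto
    next
      case 2
      then have "n - j = length p - 1" using assms Suc.prems by (cases p) auto
      then show ?thesis using 2 Suc d assms by (simp add: last_conv_nth)
    next
      case 3
      then show ?thesis using Suc d by auto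
    qed
  qed simp
  from this[of "Suc n"] have "last_digit n (code_of n p) =
      (if Suc n \<le> Suc n - length p then 0 else Suc (last p))"
    unfolding last_digit_def by blast
  moreover have "\<not> Suc n \<le> Suc n - length p" using assms by (cases p) auto
  ultimately show ?thesis by simp
qed

lemma walk_prod_code_of:
  assumes "codable (Suc n) p" "length p \<le> Suc n"
  shows "walk_prod n f (code_of n p) = (\<Prod>i<length p - 1. f (p ! i) (p ! Suc i))"
proof -
  let ?d = "\<lambda>i. digit (code_of n p) (Suc n) i"
  have "walk_prod n f (code_of n p) = (\<Prod>i<n. if ?d (n - Suc i) = 0 then 1
     else f (?d (Suc (n - Suc i)) - 1) (?d (n - Suc i) - 1))"
    unfolding walk_prod_def by (rule prod.nat_diff_reindex[symmetric])
  also have "\<dots> = (\<Prod>i<n. if i < length p - 1 then f (p ! i) (p ! Suc i) else 1)"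
  proof (intro prod.cong refl)
    fix i assume i: "i \<in> {..<n}"
    then have "n - (n - Suc i) = Suc i" "Suc (n - Suc i) = n - i" "n - (n - i) = i" by auto
    then show "(if ?d (n - Suc i) = 0 then 1 else f (?d (Suc (n - Suc i)) - 1) (?d (n - Suc i) - 1)) =
        (if i < length p - 1 then f (p ! i) (p ! Suc i) else 1)"
      using digit_code_of[OF assms(1), of "n - Suc i"] digit_code_of[OF assms(1), of "n - i"]
      by (auto simp: less_diff_conv)
  qed
  also have "\<dots> = (\<Prod>i<length p - 1. f (p ! i) (p ! Suc i))"
    using assms(2) by (intro prod.mono_neutral_cong_right) auto
  finally show ?thesis .
qed

lemma code_of_surj:
  assumes "x < Suc n ^ Suc n" "zeros_last n x"
  obtains p where "codable (Suc n) p" "length p \<le> Suc n" "x = code_of n p"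
proof -
  have "digit x (Suc n) i = 0" if "Suc i < Suc n" "digit x (Suc n) (Suc i) = 0" for i
    using assms(2) that by (simp add: zeros_last_def)
  with padded_code_surj[of "Suc n" x "Suc n"] assms(1) that show thesis by blast
qed

lemma code_of_interval:
  assumes "codable (Suc n) p" "length p \<le> Suc n" "u < n"
  shows "Suc u * Suc n ^ n \<le> code_of n p \<and> code_of n p < Suc (Suc u) * Suc n ^ n \<longleftrightarrow> p \<noteq> [] \<and> hd p = u"
proof (cases p)
  case Nil
  then show ?thesis by simp
next
  case (Cons y q)
  let ?b = "Suc n ^ n"
  have c: "code_of n p = Suc y * ?b + padded_code (Suc n) n q" using Cons by (simp add: padded_code.simps)
  have q: "padded_code (Suc n) n q < ?b" using padded_code_less assms Cons by simp
  have "Suc u * ?b \<le> code_of n p \<longleftrightarrow> Suc u \<le> code_of n p div ?b"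
    by (simp add: less_eq_div_iff_mult_less_eq)
  moreover have "code_of n p < Suc (Suc u) * ?b \<longleftrightarrow> code_of n p div ?b < Suc (Suc u)"
    by (simp add: div_less_iff_less_mult)
  moreover have "code_of n p div ?b = Suc y" unfolding c by (subst div_mult_self3) (use q in auto)
  ultimately show ?thesis using Cons by auto
qed

lemma strict_sorted_map:
  assumes "sorted_wrt (<) xs" "\<And>x y. x \<in> set xs \<Longrightarrow> y \<in> set xs \<Longrightarrow> x < y \<Longrightarrow> f x < f y"
  shows "sorted_wrt (<) (map f xs)"
  using assms by (auto simp: sorted_wrt_map intro: sorted_wrt_mono_rel[of xs "(<)"])

text \<open>Numeric enumeration of codes agrees with lexicographic enumeration of the sequences.\<close>

lemma filter_codes:
  assumes S: "\<And>p. p \<in> set ps \<Longrightarrow> codable (Suc n) p \<and> length p \<le> Suc n" and sorted: "sorted_wrt (<) ps"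
    and eq: "{x \<in> {lo..<hi}. P x} = code_of n ` set ps"
  shows "filter P [lo..<hi] = map (code_of n) ps"
proof (rule strict_sorted_equal)
  show "sorted_wrt (<) (filter P [lo..<hi])" by (rule sorted_wrt_filter) (rule sorted_wrt_upt)
  show "sorted_wrt (<) (map (code_of n) ps)"
    using sorted S by (intro strict_sorted_map padded_code_mono) auto
  show "set (filter P [lo..<hi]) = set (map (code_of n) ps)" using eq by auto
qed

locale katsura =
  fixes n :: nat and A B :: "int mat"
  assumes katsura: "katsura_pair n A B"
begin

definition a_entry :: "nat \<Rightarrow> nat \<Rightarrow> nat" where "a_entry u w = nat (A $$ (u, w))"
definition b_entry :: "nat \<Rightarrow> nat \<Rightarrow> nat" where "b_entry u w = nat \<bar>B $$ (u, w)\<bar>"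

lemma n_pos: "0 < n" and dims: "dim_row A = n" "dim_col A = n" "dim_row B = n" "dim_col B = n"
  using katsura by (auto simp: katsura_pair_def)

lemma A_nonneg: "u < n \<Longrightarrow> w < n \<Longrightarrow> 0 \<le> A $$ (u, w)"
  using katsura by (simp add: katsura_pair_def)

lemma B_support: "u < n \<Longrightarrow> w < n \<Longrightarrow> B $$ (u, w) \<noteq> 0 \<Longrightarrow> A $$ (u, w) \<noteq> 0"
  using katsura by (auto simp: katsura_pair_def)

lemma codable_iff: "codable (Suc n) p \<longleftrightarrow> set p \<subseteq> {..<n}"
  by (auto simp: codable_def)

lemma path_prod_b: "int (\<Prod>i<length p - 1. b_entry (p ! i) (p ! Suc i)) = \<bar>path_prod B p\<bar>"
  by (simp add: path_prod_nth b_entry_def abs_prod)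

lemma path_prod_a:
  assumes "set p \<subseteq> {..<n}"
  shows "int (\<Prod>i<length p - 1. a_entry (p ! i) (p ! Suc i)) = path_prod A p"
proof -
  have "int (a_entry (p ! i) (p ! Suc i)) = A $$ (p ! i, p ! Suc i)" if "i < length p - 1" for i
  proof -
    have "p ! i < n" "p ! Suc i < n" using that assms nth_mem[of i p] nth_mem[of "Suc i" p]
      by (auto simp: subset_iff less_diff_conv)
    then show ?thesis using A_nonneg by (simp add: a_entry_def)
  qed
  then show ?thesis by (simp add: path_prod_nth)
qed

text \<open>A nonzero product over \<open>B\<close> also ensures that all edges exist, since entries of \<open>B\<close> vanish where
  those of \<open>A\<close> do. For cycles the product may vanish over \<open>B\<close>, so there the edges are tested on \<open>A\<close>.\<close>

definition path_ok :: "nat \<Rightarrow> bool" where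
  "path_ok x \<longleftrightarrow> zeros_last n x \<and> digits_distinct n (Suc n) x \<and> walk_prod n b_entry x \<noteq> 0"

definition cycle_ok :: "nat \<Rightarrow> bool" where
  "cycle_ok x \<longleftrightarrow> zeros_last n x \<and> digits_distinct n n x \<and> digit x (Suc n) (n - 1) \<noteq> 0 \<and>
    last_digit n x = digit x (Suc n) n \<and> walk_prod n a_entry x \<noteq> 0"

lemma interval_bound: "u < n \<Longrightarrow> Suc (Suc u) * Suc n ^ n \<le> Suc n ^ Suc n"
proof -
  assume "u < n"
  then have "Suc (Suc u) * Suc n ^ n \<le> Suc n * Suc n ^ n" by (intro mult_right_mono) auto
  then show ?thesis by simp
qed

lemma simple_path_bounds:
  assumes "simple_path A p"
  shows "p \<noteq> []" "set p \<subseteq> {..<n}" "length p \<le> n" "distinct p"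
proof -
  show p: "p \<noteq> []" "set p \<subseteq> {..<n}" "distinct p"
    using assms dims by (auto simp: simple_path_iff is_path_iff)
  show "length p \<le> n" using p card_mono[of "{..<n}" "set p"] distinct_card[of p] by simp
qed

lemma simple_cycle_bounds:
  assumes "simple_cycle A c"
  shows "2 \<le> length c" "set c \<subseteq> {..<n}" "length c \<le> Suc n"
proof -
  show c: "2 \<le> length c" "set c \<subseteq> {..<n}"
    using assms dims by (auto simp: simple_cycle_iff is_path_iff)
  have "set (tl c) \<subseteq> {..<n}" using c by (cases c) auto
  then have "length (tl c) \<le> n"
    using assms card_mono[of "{..<n}" "set (tl c)"] distinct_card[of "tl c"] by (simp add: simple_cycle_iff)
  then show "length c \<le> Suc n" by simp
qed

lemma walk_prod_pos_iff:
  assumes "codable (Suc n) p" "length p \<le> Suc n"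
  shows "walk_prod n f (code_of n p) \<noteq> 0 \<longleftrightarrow> (\<forall>i. Suc i < length p \<longrightarrow> f (p ! i) (p ! Suc i) \<noteq> 0)"
  unfolding walk_prod_code_of[OF assms] by (auto simp: less_diff_conv)

lemma a_entry_ne: "u < n \<Longrightarrow> w < n \<Longrightarrow> a_entry u w \<noteq> 0 \<longleftrightarrow> A $$ (u, w) \<noteq> 0"
  using A_nonneg[of u w] by (auto simp: a_entry_def)

lemma nth_less: "set p \<subseteq> {..<n} \<Longrightarrow> i < length p \<Longrightarrow> p ! i < n"
  using nth_mem by blast

lemma path_codes:
  assumes v: "v < n"
  shows "filter path_ok [Suc v * Suc n ^ n..<Suc (Suc v) * Suc n ^ n] = map (code_of n) (loop_paths A B v)"
proof (rule filter_codes)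
  let ?S = "{p. simple_path A p \<and> path_range p = v}"
  have set: "set (loop_paths A B v) = {p \<in> ?S. path_prod B p \<noteq> 0}"
    using finite_simple_paths[of A v] by (auto simp: loop_paths_def simple_paths_def)
  show "codable (Suc n) p \<and> length p \<le> Suc n" if "p \<in> set (loop_paths A B v)" for p
    using that set simple_path_bounds[of p] by (simp add: codable_iff)
  show "sorted_wrt (<) (loop_paths A B v)"
    unfolding loop_paths_def simple_paths_def by (intro sorted_wrt_filter strict_sorted_list_of_set)
  show "{x \<in> {Suc v * Suc n ^ n..<Suc (Suc v) * Suc n ^ n}. path_ok x} = code_of n ` set (loop_paths A B v)"
  proof (rule Set.set_eqI, rule iffI)
    fix x assume x: "x \<in> {x \<in> {Suc v * Suc n ^ n..<Suc (Suc v) * Suc n ^ n}. path_ok x}"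
    then have "x < Suc n ^ Suc n" using interval_bound[OF v] by simp
    then obtain p where p: "codable (Suc n) p" "length p \<le> Suc n" "x = code_of n p"
      using code_of_surj x by (auto simp: path_ok_def)
    have ne: "p \<noteq> []" "hd p = v" using code_of_interval[OF p(1,2) v] x p(3) by auto
    have vert: "set p \<subseteq> {..<n}" using p(1) codable_iff by simp
    have "distinct p" using x digits_distinct_code_of[OF p(1,2), of "Suc n"] p(3)
      by (auto simp: path_ok_def)
    moreover have w: "walk_prod n b_entry (code_of n p) \<noteq> 0" using x p(3) by (simp add: path_ok_def)
    moreover have "A $$ (p ! i, p ! Suc i) \<noteq> 0" if "Suc i < length p" for i
    proof -
      have "b_entry (p ! i) (p ! Suc i) \<noteq> 0" using w that walk_prod_pos_iff[OF p(1,2)] by blast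
      then show ?thesis using B_support[of "p ! i" "p ! Suc i"] nth_less[OF vert] that by (auto simp: b_entry_def)
    qed
    moreover have "(\<Prod>i<length p - 1. b_entry (p ! i) (p ! Suc i)) \<noteq> 0"
      using w walk_prod_code_of[OF p(1,2), of b_entry] by (simp only: not_False_eq_True)
    then have "\<bar>path_prod B p\<bar> \<noteq> 0" using path_prod_b[of p] by (metis of_nat_eq_0_iff)
    then have "path_prod B p \<noteq> 0" by simp
    ultimately have "p \<in> set (loop_paths A B v)"
      using set ne vert dims by (auto simp: simple_path_iff is_path_iff path_range_def)
    then show "x \<in> code_of n ` set (loop_paths A B v)" using p(3) by blast
  next
    fix x assume "x \<in> code_of n ` set (loop_paths A B v)"
    then obtain p where p: "simple_path A p" "path_range p = v" "path_prod B p \<noteq> 0" "x = code_of n p"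
      using set by auto
    note bd = simple_path_bounds[OF p(1)]
    have cd: "codable (Suc n) p" "length p \<le> Suc n" using bd codable_iff by auto
    have "Suc v * Suc n ^ n \<le> x \<and> x < Suc (Suc v) * Suc n ^ n"
      using code_of_interval[OF cd v] bd(1) p by (simp add: path_range_def)
    moreover have "int (walk_prod n b_entry (code_of n p)) \<noteq> 0"
      using path_prod_b[of p] p(3) unfolding walk_prod_code_of[OF cd] by simp
    then have "path_ok x"
      unfolding path_ok_def p(4)
      using zeros_last_code_of[OF cd(1)] digits_distinct_code_of[OF cd, of "Suc n"] bd(4) p(3)
        path_prod_b[of p] walk_prod_code_of[OF cd, of b_entry]
      by (auto)
    ultimately show "x \<in> {x \<in> {Suc v * Suc n ^ n..<Suc (Suc v) * Suc n ^ n}. path_ok x}" by simp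
  qed
qed

lemma cycle_codes:
  assumes v: "v < n"
  shows "filter cycle_ok [Suc v * Suc n ^ n..<Suc (Suc v) * Suc n ^ n] = map (code_of n) (simple_cycles A v)"
proof (rule filter_codes)
  let ?S = "{c. simple_cycle A c \<and> path_range c = v \<and> path_source c = v}"
  have set: "set (simple_cycles A v) = ?S"
    using finite_simple_cycles[of A v] by (auto simp: simple_cycles_def)
  show "codable (Suc n) p \<and> length p \<le> Suc n" if "p \<in> set (simple_cycles A v)" for p
    using that set simple_cycle_bounds[of p] by (simp add: codable_iff)
  show "sorted_wrt (<) (simple_cycles A v)"
    unfolding simple_cycles_def by (intro strict_sorted_list_of_set)
  \<comment> \<open>Digit \<open>n - 1\<close> is the second vertex; it is present iff the sequence has an edge.\<close>
  have second: "digit (code_of n p) (Suc n) (n - 1) \<noteq> 0 \<longleftrightarrow> 2 \<le> length p"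
    and top: "p \<noteq> [] \<Longrightarrow> digit (code_of n p) (Suc n) n = Suc (hd p)"
    if "codable (Suc n) p" for p
    using digit_code_of[OF that, of "n - 1"] digit_code_of[OF that, of n] n_pos
    by (auto simp: hd_conv_nth)
  show "{x \<in> {Suc v * Suc n ^ n..<Suc (Suc v) * Suc n ^ n}. cycle_ok x} = code_of n ` set (simple_cycles A v)"
  proof (rule Set.set_eqI, rule iffI)
    fix x assume x: "x \<in> {x \<in> {Suc v * Suc n ^ n..<Suc (Suc v) * Suc n ^ n}. cycle_ok x}"
    then have "x < Suc n ^ Suc n" using interval_bound[OF v] by simp
    then obtain p where p: "codable (Suc n) p" "length p \<le> Suc n" "x = code_of n p"
      using code_of_surj x by (auto simp: cycle_ok_def)
    have ne: "p \<noteq> []" "hd p = v" using code_of_interval[OF p(1,2) v] x p(3) by auto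
    have vert: "set p \<subseteq> {..<n}" using p(1) codable_iff by simp
    have ok: "cycle_ok (code_of n p)" using x p(3) by simp
    have "distinct (tl p)" using ok digits_distinct_code_of[OF p(1,2), of n]
      by (auto simp: cycle_ok_def drop_Suc)
    moreover have "2 \<le> length p" using ok second[OF p(1)] by (simp add: cycle_ok_def)
    moreover have "last p = v"
      using ok last_digit_code_of[OF p(1,2) ne(1)] top[OF p(1) ne(1)] ne(2) by (simp add: cycle_ok_def)
    moreover have "A $$ (p ! i, p ! Suc i) \<noteq> 0" if "Suc i < length p" for i
    proof -
      have "a_entry (p ! i) (p ! Suc i) \<noteq> 0" using ok that walk_prod_pos_iff[OF p(1,2)]
        unfolding cycle_ok_def by blast
      then show ?thesis using a_entry_ne[of "p ! i" "p ! Suc i"] nth_less[OF vert] that by auto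
    qed
    ultimately have "p \<in> set (simple_cycles A v)"
      using set ne vert dims by (auto simp: simple_cycle_iff is_path_iff path_range_def path_source_def)
    then show "x \<in> code_of n ` set (simple_cycles A v)" using p(3) by blast
  next
    fix x assume "x \<in> code_of n ` set (simple_cycles A v)"
    then obtain p where p: "simple_cycle A p" "path_range p = v" "path_source p = v" "x = code_of n p"
      using set by auto
    note bd = simple_cycle_bounds[OF p(1)]
    have ne: "p \<noteq> []" using bd(1) by auto
    have cd: "codable (Suc n) p" "length p \<le> Suc n" using bd codable_iff by auto
    have "Suc v * Suc n ^ n \<le> x \<and> x < Suc (Suc v) * Suc n ^ n"
      using code_of_interval[OF cd v] ne p by (simp add: path_range_def)
    moreover have "walk_prod n a_entry (code_of n p) \<noteq> 0"
      unfolding walk_prod_pos_iff[OF cd]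
    proof (intro allI impI)
      fix i assume i: "Suc i < length p"
      have "A $$ (p ! i, p ! Suc i) \<noteq> 0" using p(1) i by (simp add: simple_cycle_iff is_path_iff)
      then show "a_entry (p ! i) (p ! Suc i) \<noteq> 0"
        using a_entry_ne[of "p ! i" "p ! Suc i"] nth_less[OF bd(2)] i by simp
    qed
    moreover have "distinct (drop (Suc n - n) p)" using p(1) by (simp add: simple_cycle_iff drop_Suc)
    ultimately have "cycle_ok x"
      unfolding cycle_ok_def p(4)
      using zeros_last_code_of[OF cd(1)] digits_distinct_code_of[OF cd, of n] second[OF cd(1)] bd(1)
        last_digit_code_of[OF cd ne] top[OF cd(1) ne] p(2,3)
      by (auto simp: path_range_def path_source_def)
    then show "x \<in> {x \<in> {Suc v * Suc n ^ n..<Suc (Suc v) * Suc n ^ n}. cycle_ok x}"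
      using \<open>Suc v * Suc n ^ n \<le> x \<and> _\<close> by simp
  qed
qed

end

section \<open>Search for the least common multiple\<close>

text \<open>The value after \<open>i\<close> rounds: the candidate stays as soon as it is good.\<close>

definition lcm_search :: "nat \<Rightarrow> nat \<Rightarrow> nat \<Rightarrow> nat \<Rightarrow> nat" where
  "lcm_search N a b i = rec_nat N (\<lambda>i r. if r * b mod a = 0 then r else r + N) i"

lemma dvd_reduced_iff:
  fixes a b r :: nat
  assumes "0 < b"
  shows "a dvd r * b \<longleftrightarrow> a div gcd a b dvd r"
proof -
  have g0: "gcd a b \<noteq> 0" using assms by simp
  obtain t s where st: "a = t * gcd a b" "b = s * gcd a b" "coprime t s"
    using gcd_coprime_exists[OF g0] by blast
  have "a dvd r * b \<longleftrightarrow> t * gcd a b dvd (r * s) * gcd a b"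
    using st(1,2) by (metis mult.assoc)
  also have "\<dots> \<longleftrightarrow> t dvd r * s" using g0 by simp
  also have "\<dots> \<longleftrightarrow> t dvd r" using st(3) by (simp add: coprime_dvd_mult_left_iff)
  also have "t = a div gcd a b" using st(1) g0 by (metis nonzero_mult_div_cancel_right)
  finally show ?thesis .
qed

text \<open>With \<open>k = lcm N (a div gcd a b) div N\<close> the multiple \<open>N * j\<close> is good iff \<open>k\<close> divides \<open>j\<close>, so the
  search runs through \<open>N, 2 * N, \<dots>\<close> and stops at \<open>N * k\<close>.\<close>

lemma lcm_search_bounded:
  fixes N a b :: nat
  assumes "0 < N" "0 < a" "0 < b"
  shows "lcm_search N a b i = N * min (Suc i) (lcm N (a div gcd a b) div N)"
proof -
  let ?t = "a div gcd a b"
  define l k where "l = lcm N ?t" and "k = l div N"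
  have "?t \<noteq> 0" using assms(2) by (metis dvd_mult_div_cancel gcd_dvd1 mult_0_right less_irrefl)
  then have l: "0 < l" using assms(1) by (simp add: l_def lcm_pos_nat)
  have lk: "l = N * k" by (simp add: k_def l_def)
  then have kpos: "0 < k" using l by simp
  have div: "N * j * b mod a = 0 \<longleftrightarrow> k dvd j" for j
  proof -
    have "N * j * b mod a = 0 \<longleftrightarrow> ?t dvd N * j"
      using dvd_reduced_iff[OF assms(3), of a "N * j"] by (simp only: mod_eq_0_iff_dvd)
    also have "\<dots> \<longleftrightarrow> l dvd N * j" by (simp add: l_def)
    also have "\<dots> \<longleftrightarrow> k dvd j" using assms(1) by (simp add: lk)
    finally show ?thesis .
  qed
  have "lcm_search N a b i = N * min (Suc i) k"
    unfolding lcm_search_def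
  proof (induction i)
    case 0
    then show ?case using kpos by (simp add: min_def)
  next
    case (Suc i)
    show ?case
    proof (cases "k \<le> Suc i")
      case True
      then show ?thesis using Suc div[of k] by (simp add: min_def)
    next
      case False
      then have "\<not> k dvd Suc i" by (meson dvd_imp_le zero_less_Suc)
      then have "N * Suc i * b mod a \<noteq> 0" using div by blast
      then show ?thesis using False Suc by (simp add: min_def)
    qed
  qed
  then show ?thesis by (simp only: k_def l_def)
qed

lemma lcm_search_le: "0 < N \<Longrightarrow> 0 < a \<Longrightarrow> 0 < b \<Longrightarrow> lcm_search N a b i \<le> lcm N (a div gcd a b)"
proof -
  assume h: "0 < N" "0 < a" "0 < b"
  have "N * min (Suc i) (lcm N (a div gcd a b) div N) \<le> N * (lcm N (a div gcd a b) div N)" by (intro mult_le_mono2) simp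
  also have "\<dots> \<le> lcm N (a div gcd a b)" by (rule times_div_less_eq_dividend)
  finally show ?thesis by (simp only: lcm_search_bounded[OF h])
qed

text \<open>At most \<open>a div gcd a b\<close> multiples have to be tried, hence \<open>a\<close> rounds suffice.\<close>

lemma lcm_search_eq: "0 < N \<Longrightarrow> 0 < a \<Longrightarrow> 0 < b \<Longrightarrow> lcm_search N a b a = lcm N (a div gcd a b)"
proof -
  assume h: "0 < N" "0 < a" "0 < b"
  let ?t = "a div gcd a b"
  have "?t \<noteq> 0" using h by (metis dvd_mult_div_cancel gcd_dvd1 mult_0_right less_irrefl)
  then have "lcm N ?t \<le> N * ?t" using h by (intro dvd_imp_le lcm_least) auto
  then have "lcm N ?t div N \<le> N * ?t div N" by (rule div_le_mono)
  also have "N * ?t div N = ?t" using h(1) by simp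
  also have "?t \<le> a" by simp
  finally have "min (Suc a) (lcm N ?t div N) = lcm N ?t div N" by simp
  then show ?thesis by (simp add: lcm_search_bounded[OF h])
qed

section \<open>The quantities of the procedure as expressions\<close>

abbreviation "EOne \<equiv> ESuc EZero"

text \<open>Expressions are closed functions of an environment: \<open>[x, b, i]\<close> for digits, \<open>[n, D, X, o', u, u']\<close> for
  matrix entries, where \<open>X\<close> holds the entries of both matrices in base \<open>D\<close> and the offset \<open>o'\<close>
  selects \<open>A\<close> or \<open>B\<close>, and \<open>[n, D, X, o', x]\<close> for products along the sequence with code \<open>x\<close>.\<close>

definition "digit_exp = Call mod_exp [Call div_exp [Var 0, Call pow_exp [Var 1, Var 2]], Var 1]"

definition "entry_exp = Call digit_exp
  [Var 2, Var 1, Call add_exp [Var 3, Call add_exp [Call mul_exp [Var 4, Var 0], Var 5]]]"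

definition walk_factor :: "nat \<Rightarrow> (nat \<Rightarrow> nat \<Rightarrow> nat) \<Rightarrow> nat \<Rightarrow> nat \<Rightarrow> nat" where
  "walk_factor n f x i = (if digit x (Suc n) i = 0 then 1
     else f (digit x (Suc n) (Suc i) - 1) (digit x (Suc n) i - 1))"

lemma walk_prod_factor: "walk_prod n f x = (\<Prod>i<n. walk_factor n f x i)"
  by (simp add: walk_prod_def walk_factor_def)

definition "factor_exp =
  IfEq (Call digit_exp [Var 5, ESuc (Var 1), Var 0]) EZero EOne
    (Call entry_exp [Var 1, Var 2, Var 3, Var 4,
      Call pred_exp [Call digit_exp [Var 5, ESuc (Var 1), ESuc (Var 0)]],
      Call pred_exp [Call digit_exp [Var 5, ESuc (Var 1), Var 0]]])"

definition "walk_exp = Rec (Var 0) EOne (Call mul_exp [Var 1,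
  Call factor_exp [Var 0, Var 2, Var 3, Var 4, Var 5, Var 6]])"

definition "zeros_exp = Rec (Var 0) EOne
  (IfEq (Call digit_exp [Var 3, ESuc (Var 2), ESuc (Var 0)]) EZero
    (IfEq (Call digit_exp [Var 3, ESuc (Var 2), Var 0]) EZero (Var 1) EZero) (Var 1))"

definition "distinct_exp = Rec (Var 1) EOne (Rec (Var 3) (Var 1)
  (IfEq (Call digit_exp [Var 6, ESuc (Var 4), Var 2]) (Call digit_exp [Var 6, ESuc (Var 4), Var 0])
    (IfEq (Var 2) (Var 0) (Var 1)
      (IfEq (Call digit_exp [Var 6, ESuc (Var 4), Var 2]) EZero (Var 1) EZero)) (Var 1)))"

definition "last_exp = Rec (ESuc (Var 0)) EZero
  (IfEq (Var 1) EZero (Call digit_exp [Var 3, ESuc (Var 2), Var 0]) (Var 1))"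

definition "path_ok_exp =
  IfEq (Call zeros_exp [Var 0, Var 3]) EZero EZero
  (IfEq (Call distinct_exp [Var 0, ESuc (Var 0), Var 3]) EZero EZero
  (IfEq (Call walk_exp [Var 0, Var 1, Var 2, Call mul_exp [Var 0, Var 0], Var 3]) EZero EZero EOne))"

definition "cycle_ok_exp =
  IfEq (Call zeros_exp [Var 0, Var 3]) EZero EZero
  (IfEq (Call distinct_exp [Var 0, Var 0, Var 3]) EZero EZero
  (IfEq (Call digit_exp [Var 3, ESuc (Var 0), Call pred_exp [Var 0]]) EZero EZero
  (IfEq (Call last_exp [Var 0, Var 3]) (Call digit_exp [Var 3, ESuc (Var 0), Var 0])
    (IfEq (Call walk_exp [Var 0, Var 1, Var 2, EZero, Var 3]) EZero EZero EOne) EZero)))"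

definition "lcm_exp = Rec (Var 1) (Var 0)
  (IfEq (Call mod_exp [Call mul_exp [Var 1, Var 4], Var 3]) EZero (Var 1) (Call add_exp [Var 1, Var 2]))"

text \<open>Arities are written with \<open>Suc\<close> because simplification brings the length of an argument list into this
  form.\<close>

lemma scoped_exps [simp]:
  "scoped (Suc (Suc 0)) add_exp" "scoped (Suc (Suc 0)) mul_exp" "scoped (Suc (Suc 0)) pow_exp" "scoped (Suc 0) pred_exp" "scoped (Suc (Suc 0)) mod_exp"
  "scoped (Suc (Suc 0)) div_exp" "scoped (Suc (Suc (Suc 0))) digit_exp" "scoped (Suc (Suc (Suc (Suc (Suc (Suc 0)))))) entry_exp" "scoped (Suc (Suc (Suc (Suc (Suc (Suc 0)))))) factor_exp" "scoped (Suc (Suc (Suc (Suc (Suc 0))))) walk_exp" "scoped (Suc (Suc 0)) zeros_exp"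
  "scoped (Suc (Suc (Suc 0))) distinct_exp" "scoped (Suc (Suc 0)) last_exp" "scoped (Suc (Suc (Suc (Suc 0)))) path_ok_exp" "scoped (Suc (Suc (Suc (Suc 0)))) cycle_ok_exp"
  "scoped (Suc (Suc (Suc 0))) lcm_exp"
  by (simp_all add: add_exp_def mul_exp_def pow_exp_def pred_exp_def mod_exp_def div_exp_def
      digit_exp_def entry_exp_def factor_exp_def walk_exp_def zeros_exp_def distinct_exp_def last_exp_def
      path_ok_exp_def cycle_ok_exp_def lcm_exp_def numeral_eq_Suc)

lemma eval_digit [simp]: "eval_exp [x, b, i] digit_exp = digit x b i"
  by (simp add: digit_exp_def digit_def)

lemma below_digit: "x < K \<Longrightarrow> b ^ i < K \<Longrightarrow> 0 < b \<Longrightarrow> 1 < K \<Longrightarrow> below K [x, b, i] digit_exp"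
  by (auto simp: digit_exp_def intro!: below_mod below_div below_pow
      intro: le_less_trans[OF div_le_dividend])

lemma eval_entry [simp]: "eval_exp [n, D, X, o', u, w] entry_exp = digit X D (o' + (u * n + w))"
  by (simp add: entry_exp_def)

lemma below_entry:
  "X < K \<Longrightarrow> D ^ (o' + (u * n + w)) < K \<Longrightarrow> 1 < D \<Longrightarrow> 1 < K \<Longrightarrow> below K [n, D, X, o', u, w] entry_exp"
proof -
  assume h: "X < K" "D ^ (o' + (u * n + w)) < K" "1 < D" "1 < K"
  have "o' + (u * n + w) < K" using less_exp[of "o' + (u * n + w)"] power_mono[of 2 D "o' + (u * n + w)"] h
    by linarith
  then show ?thesis using h by (auto simp: entry_exp_def intro!: below_digit below_add below_mul)
qed

lemma rec_prod: "rec_nat (Suc 0) (\<lambda>i r. r * f i) m = (\<Prod>i<m. f i :: nat)"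
  by (induction m) auto

lemma rec_all: "rec_nat r0 (\<lambda>i r. if P i then r else 0) m = (if \<forall>i<m. P i then r0 else (0 :: nat))"
  by (induction m) (auto simp: less_Suc_eq)

lemma rec_all_imp:
  "rec_nat r0 (\<lambda>i r. if P i then if Q i then r else 0 else r) m =
    (if \<forall>i<m. P i \<longrightarrow> Q i then r0 else (0 :: nat))"
  by (induction m) (auto simp: less_Suc_eq)

lemma rec_all_imp_or:
  "rec_nat r0 (\<lambda>i r. if P i then if Q i then r else if R i then r else 0 else r) m =
    (if \<forall>i<m. P i \<longrightarrow> Q i \<or> R i then r0 else (0 :: nat))"
  by (induction m) (auto simp: less_Suc_eq)

lemma eval_factor [simp]:
  "eval_exp [i, n, D, X, o', x] factor_exp = walk_factor n (\<lambda>u w. digit X D (o' + (u * n + w))) x i"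
  by (simp add: factor_exp_def walk_factor_def cong: if_cong)

lemma eval_walk [simp]:
  "eval_exp [n, D, X, o', x] walk_exp = walk_prod n (\<lambda>u w. digit X D (o' + (u * n + w))) x"
  by (simp add: walk_exp_def walk_prod_factor rec_prod cong: if_cong)

lemma eval_zeros [simp]: "eval_exp [n, x] zeros_exp = of_bool (zeros_last n x)"
  by (simp add: zeros_exp_def rec_all_imp zeros_last_def cong: if_cong)

lemma eval_distinct [simp]: "eval_exp [n, m, x] distinct_exp = of_bool (digits_distinct n m x)"
  by (simp add: distinct_exp_def rec_all_imp_or rec_all cong: if_cong)
    (auto simp: digits_distinct_def)

lemma eval_last [simp]: "eval_exp [n, x] last_exp = last_digit n x"
  by (simp add: last_exp_def last_digit_def cong: if_cong)

lemma eval_lcm [simp]: "eval_exp [N, a, b] lcm_exp = lcm_search N a b a"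
  by (simp add: lcm_exp_def lcm_search_def cong: if_cong)

lemma below_lcm:
  assumes "0 < N" "0 < a" "0 < b" "lcm N (a div gcd a b) * b < K"
  shows "below K [N, a, b] lcm_exp"
proof -
  let ?l = "lcm N (a div gcd a b)"
  have le: "lcm_search N a b i * b \<le> ?l * b" for i
    using lcm_search_le[OF assms(1-3)] by simp
  have "?l \<le> ?l * b" using assms(3) by simp
  then have lK: "?l < K" using assms(4) by linarith
  \<comment> \<open>An addition takes place only if the search has not yet succeeded, and then its result is the next value.\<close>
  have step: "lcm_search N a b i + N < K" if "lcm_search N a b i * b mod a \<noteq> 0" for i
    using lcm_search_le[OF assms(1-3), of "Suc i"] that lK by (simp add: lcm_search_def)
  have rec: "rec_nat N (\<lambda>i r. if eval_exp [i, r, N, a, b] (Call mod_exp [Call mul_exp [Var 1, Var 4], Var 3]) =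
        eval_exp [i, r, N, a, b] EZero then eval_exp [i, r, N, a, b] (Var 1)
        else eval_exp [i, r, N, a, b] (Call add_exp [Var 1, Var 2])) i = lcm_search N a b i" for i
    by (simp add: lcm_search_def cong: if_cong)
  show ?thesis
    using step le_less_trans[OF le assms(4)]
    by (auto simp: lcm_exp_def rec[simplified] lcm_search_def[symmetric] intro!: below_mod below_mul below_add cong: if_cong)
qed

text \<open>The exponent \<open>2 * n * n + n\<close> leaves room for \<open>X\<close>, which has \<open>2 * n * n\<close> digits in base \<open>D\<close>, and for
  the product of a value of \<open>N\<close>, at most \<open>D ^ (n * n)\<close>, with a weight \<open>B\<^sub>p\<close>, at most \<open>D ^ n\<close>.\<close>

locale numbers =
  fixes n D X L :: nat
  assumes n: "0 < n" and D: "1 < D" and X: "X < 2 ^ L"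
    and D_pow: "D ^ (2 * n * n + n) < 2 ^ L" and base_pow: "Suc n ^ Suc (Suc n) < 2 ^ L"
begin

lemma D_pow_less: "i \<le> 2 * n * n + n \<Longrightarrow> D ^ i < 2 ^ L"
  using power_increasing[of i "2 * n * n + n" D] D D_pow by linarith

lemma base_pow_less: "i \<le> Suc (Suc n) \<Longrightarrow> Suc n ^ i < 2 ^ L"
  using power_increasing[of i "Suc (Suc n)" "Suc n"] base_pow by linarith

lemma small: "1 < (2::nat) ^ L" "Suc n < 2 ^ L" "Suc (Suc n) < 2 ^ L" "n * n < 2 ^ L" "n < 2 ^ L"
proof -
  show 1: "Suc n < 2 ^ L" using base_pow_less[of 1] by simp
  have "Suc n * Suc n < 2 ^ L" using base_pow_less[of 2] by (simp add: power2_eq_square)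
  moreover have "Suc (Suc n) \<le> Suc n * Suc n" "n * n \<le> Suc n * Suc n" using n by simp_all
  ultimately show "Suc (Suc n) < 2 ^ L" "n * n < 2 ^ L" by linarith+
  show "1 < (2::nat) ^ L" "n < 2 ^ L" using 1 n by linarith+
qed

context
  fixes x assumes x: "x < Suc n ^ Suc n"
begin

lemma x_less: "x < 2 ^ L"
  using x base_pow_less[of "Suc n"] by linarith

lemma below_digit_x: "i \<le> Suc n \<Longrightarrow> below (2 ^ L) [x, Suc n, i] digit_exp"
  using x_less base_pow_less[of i] small by (intro below_digit) auto

lemma digit_x: "digit x (Suc n) i - 1 < n"
  using digit_less[of "Suc n" x i] n by linarith

lemma below_entry_x:
  assumes "o' \<le> n * n"
  shows "D ^ (o' + ((digit x (Suc n) i - 1) * n + (digit x (Suc n) j - 1))) < 2 ^ L"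
proof -
  let ?u = "digit x (Suc n) i - 1" and ?w = "digit x (Suc n) j - 1"
  have "?u * n + ?w \<le> (n - 1) * n + n"
    using digit_x[of i] digit_x[of j] by (intro add_mono mult_right_mono) auto
  also have "\<dots> = n * n" using n by (cases n) auto
  finally have "o' + (?u * n + ?w) \<le> 2 * n * n + n" using assms by linarith
  then show ?thesis by (rule D_pow_less)
qed

abbreviation entry_fun :: "nat \<Rightarrow> nat \<Rightarrow> nat \<Rightarrow> nat" where
  "entry_fun o' \<equiv> \<lambda>u w. digit X D (o' + (u * n + w))"

lemma walk_factor_le: "walk_factor n (entry_fun o') x i \<le> D"
  using digit_less[of D X] D by (auto simp: walk_factor_def intro: less_imp_le)

lemma walk_prefix_le: "(\<Prod>i<m. walk_factor n (entry_fun o') x i) \<le> D ^ m"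
proof -
  have "(\<Prod>i<m. walk_factor n (entry_fun o') x i) \<le> (\<Prod>i<m. D)"
    using walk_factor_le by (intro prod_mono) auto
  then show ?thesis by simp
qed

lemma walk_le: "walk_prod n (entry_fun o') x \<le> D ^ n"
  unfolding walk_prod_factor by (rule walk_prefix_le)

lemma walk_less: "walk_prod n (entry_fun o') x < 2 ^ L"
  using walk_le[of o'] D_pow_less[of n] by (meson le_add2 le_less_trans)

lemma below_factor:
  assumes "o' \<le> n * n" "i < n"
  shows "below (2 ^ L) [i, n, D, X, o', x] factor_exp"
  using assms small X D below_entry_x[OF assms(1)]
  by (auto simp: factor_exp_def intro!: below_digit_x below_entry below_pred)

lemma below_walk:
  assumes "o' \<le> n * n"
  shows "below (2 ^ L) [n, D, X, o', x] walk_exp"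
proof -
  let ?f = "walk_factor n (entry_fun o') x"
  have "(\<Prod>j<i. ?f j) * ?f i < 2 ^ L" if "i < n" for i
  proof -
    have "(\<Prod>j<i. ?f j) * ?f i \<le> D ^ Suc i" using walk_prefix_le[where m = "Suc i" and o' = o'] by simp
    also have "\<dots> < 2 ^ L" using that by (intro D_pow_less) auto
    finally show ?thesis .
  qed
  then show ?thesis
    using small below_factor[OF assms]
    by (auto simp: walk_exp_def rec_prod intro!: below_mul cong: if_cong)
qed

lemma below_zeros: "below (2 ^ L) [n, x] zeros_exp"
  using small by (auto simp: zeros_exp_def intro!: below_digit_x)

lemma below_distinct: "m \<le> Suc n \<Longrightarrow> below (2 ^ L) [n, m, x] distinct_exp"
  using small by (auto simp: distinct_exp_def intro!: below_digit_x)

lemma below_last: "below (2 ^ L) [n, x] last_exp"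
  using small by (auto simp: last_exp_def intro!: below_digit_x)

lemma below_path_ok: "below (2 ^ L) [n, D, X, x] path_ok_exp"
  using small by (auto simp: path_ok_exp_def intro!: below_zeros below_distinct below_walk below_mul)

lemma below_cycle_ok: "below (2 ^ L) [n, D, X, x] cycle_ok_exp"
  using small by (auto simp: cycle_ok_exp_def
      intro!: below_zeros below_distinct below_walk below_mul below_pred below_last below_digit_x)

end

end

section \<open>Programs on visible registers\<close>

text \<open>Registers from \<open>nvars\<close> on are scratch for the evaluation of expressions. The registers below are
  used as follows: \<open>0\<close> for \<open>N\<close>; \<open>1\<close> for the dimension \<open>n\<close>; \<open>2\<close> for the base \<open>D\<close>; \<open>3\<close> for the entries
  \<open>X\<close>; \<open>4\<close> for the vertex \<open>v\<close>; \<open>5\<close> is always zero; \<open>6\<close> and \<open>7\<close> for the code of the current path and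
  the end of its range; \<open>8\<close> and \<open>9\<close> likewise for cycles; \<open>10\<close> for the flag that stops \<open>Faithful\<close>; \<open>11\<close>
  for the outcome of a test; \<open>12\<close> for the last digit of the path; \<open>13\<close> to \<open>15\<close> for output; \<open>16\<close> for
  the current power of \<open>D\<close> while the input is read.\<close>

definition nvars :: nat where "nvars = 17"

lemma less_nvars [simp]: "i < 17 \<Longrightarrow> i < nvars"
  by (simp add: nvars_def)

abbreviation env_of :: "(nat \<Rightarrow> nat) \<Rightarrow> nat list" where
  "env_of R \<equiv> map R [0..<nvars]"

lemma nth_env_of [simp]: "i < 17 \<Longrightarrow> env_of R ! i = R i"
  by (simp add: nvars_def del: upt_Suc upt_rec_numeral)

definition assign :: "nat \<Rightarrow> exp \<Rightarrow> com" where
  "assign z e = compile_exp [0..<nvars] nvars e ;; copy_reg z nvars"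

definition visible :: "cond \<Rightarrow> bool" where
  "visible b \<longleftrightarrow> (case b of Eq x y \<Rightarrow> x < nvars \<and> y < nvars | In a \<Rightarrow> True)"

lemma visible_simps [simp]: "visible (Eq x y) \<longleftrightarrow> x < nvars \<and> y < nvars" "visible (In a)"
  by (simp_all add: visible_def)

locale visible_machine =
  fixes w :: "nat list" and L :: nat
  assumes input_fits: "length w \<le> L"
begin

text \<open>Execution up to scratch registers: both states matter only in the registers below \<open>nvars\<close>. In this
  form the effect of a program can be stated as an exact update although scratch values are lost.\<close>

definition performs :: "com \<Rightarrow> state \<Rightarrow> snapshot list \<Rightarrow> state \<Rightarrow> bool" where
  "performs c s sns s' \<longleftrightarrow> (\<forall>R0. (\<forall>x<nvars. R0 x = fst s x) \<and> capped L (R0, snd s) \<longrightarrow>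
     (\<exists>R1. exec w L c (R0, snd s) sns (R1, snd s') \<and> (\<forall>x<nvars. R1 x = fst s' x)))"

lemma holds_visible:
  "visible b \<Longrightarrow> \<forall>x<nvars. R0 x = fst s x \<Longrightarrow> holds w (R0, snd s) b \<longleftrightarrow> holds w s b"
  by (cases s; cases b) auto

lemma performs_Skip: "performs Skip s [] s"
  unfolding performs_def by (blast intro: exec.Skip)

lemma performs_Seq:
  assumes "performs c s t s'" "performs d s' t' s''"
  shows "performs (c ;; d) s (t @ t') s''"
  unfolding performs_def
proof (intro allI impI, elim conjE)
  fix R0 assume R0: "\<forall>x<nvars. R0 x = fst s x" "capped L (R0, snd s)"
  obtain R1 where R1: "exec w L c (R0, snd s) t (R1, snd s')" "\<forall>x<nvars. R1 x = fst s' x"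
    using assms(1) R0 unfolding performs_def by blast
  moreover have "capped L (R1, snd s')" using exec_capped[OF R1(1) input_fits R0(2)] .
  ultimately obtain R2 where "exec w L d (R1, snd s') t' (R2, snd s'')" "\<forall>x<nvars. R2 x = fst s'' x"
    using assms(2) unfolding performs_def by blast
  then show "\<exists>R1. exec w L (c ;; d) (R0, snd s) (t @ t') (R1, snd s'') \<and> (\<forall>x<nvars. R1 x = fst s'' x)"
    using R1(1) exec.Seq by blast
qed

lemma performs_Seq_silent: "performs c s [] s' \<Longrightarrow> performs d s' t' s'' \<Longrightarrow> performs (c ;; d) s t' s''"
  using performs_Seq[of c s "[]"] by simp

lemma performs_If_True: "holds w s b \<Longrightarrow> visible b \<Longrightarrow> performs c s t s' \<Longrightarrow> performs (If b c d) s t s'"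
  unfolding performs_def using holds_visible exec.If_True by blast

lemma performs_If_False: "\<not> holds w s b \<Longrightarrow> visible b \<Longrightarrow> performs d s t s' \<Longrightarrow> performs (If b c d) s t s'"
  unfolding performs_def using holds_visible exec.If_False by blast

lemma performs_Until_True: "holds w s b \<Longrightarrow> visible b \<Longrightarrow> performs (Until b c) s [] s"
  unfolding performs_def using holds_visible exec.Until_True by blast

lemma performs_Until_False:
  assumes "\<not> holds w s b" "visible b" "performs c s t s'" "performs (Until b c) s' t' s''"
  shows "performs (Until b c) s (t @ t') s''"
  unfolding performs_def
proof (intro allI impI, elim conjE)
  fix R0 assume R0: "\<forall>x<nvars. R0 x = fst s x" "capped L (R0, snd s)"
  obtain R1 where R1: "exec w L c (R0, snd s) t (R1, snd s')" "\<forall>x<nvars. R1 x = fst s' x"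
    using assms(3) R0 unfolding performs_def by blast
  moreover have "capped L (R1, snd s')" using exec_capped[OF R1(1) input_fits R0(2)] .
  ultimately obtain R2 where "exec w L (Until b c) (R1, snd s') t' (R2, snd s'')" "\<forall>x<nvars. R2 x = fst s'' x"
    using assms(4) unfolding performs_def by blast
  then show "\<exists>R1. exec w L (Until b c) (R0, snd s) (t @ t') (R1, snd s'') \<and> (\<forall>x<nvars. R1 x = fst s'' x)"
    using R1(1) exec.Until_False assms(1) holds_visible[OF assms(2) R0(1)] by blast
qed

lemma performs_assign:
  assumes "z < nvars" "below (2 ^ L) (env_of R) e" "eval_exp (env_of R) e = v"
  shows "performs (assign z e) (R, p, W) [] (R(z := v), p, W)"
  unfolding performs_def
proof (intro allI impI, elim conjE)
  fix R0 assume "\<forall>x<nvars. R0 x = fst (R, p, W) x" and cap: "capped L (R0, snd (R, p, W))"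
  then have R0: "\<forall>x<nvars. R0 x = R x" "\<forall>r. R0 r < 2 ^ L" by simp_all
  have env: "env_of R0 = env_of R" using R0(1) by simp
  have "\<forall>x \<in> set [0..<nvars]. x < nvars" "below (2 ^ L) (env_of R0) e"
    using assms(2) unfolding env by simp_all
  then obtain R1 where R1: "exec w L (compile_exp [0..<nvars] nvars e) (R0, p, W) [] (R1, p, W)"
    "\<forall>x<nvars. R1 x = R0 x" "R1 nvars = eval_exp (env_of R0) e" "\<forall>r. R1 r < 2 ^ L"
    using exec_compile_exp(1)[where R = R0 and p = p and W = W and w = w] R0(2) by blast
  have "exec w L (copy_reg z nvars) (R1, p, W) [] (R1(z := R1 nvars), p, W)"
    using assms(1) R1(4) by (intro exec_copy_reg) auto
  then have "exec w L (assign z e) (R0, p, W) [] (R1(z := R1 nvars), p, W)"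
    unfolding assign_def using R1(1) exec_Seq_silent by blast
  moreover have "R1 nvars = v" using R1(3) assms(3) env by simp
  ultimately show "\<exists>R1. exec w L (assign z e) (R0, snd (R, p, W)) [] (R1, snd (R(z := v), p, W)) \<and>
      (\<forall>x<nvars. R1 x = fst (R(z := v), p, W) x)"
    using R0(1) R1(2) by (intro exI[of _ "R1(z := R1 nvars)"]) simp
qed

lemma performs_keep:
  assumes "\<And>R0. \<forall>x<nvars. R0 x = R x \<Longrightarrow> exec w L c (R0, p, W) t (R0, p', W')"
  shows "performs c (R, p, W) t (R, p', W')"
  unfolding performs_def fst_conv snd_conv using assms by blast

lemma performs_EmitReg:
  assumes "r < nvars" "length (W t) + length (bits (R r)) \<le> L"
  shows "performs (EmitReg t r) (R, p, W) [] (R, p, W(t := W t @ bits (R r)))"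
proof (rule performs_keep)
  fix R0 assume "\<forall>x<nvars. R0 x = R x"
  then have "R0 r = R r" using assms(1) by simp
  then show "exec w L (EmitReg t r) (R0, p, W) [] (R0, p, W(t := W t @ bits (R r)))"
    using exec.EmitReg[of W t R0 r L w p] assms(2) by simp
qed

lemma performs_Emit: "0 < a \<Longrightarrow> length (W t) < L \<Longrightarrow> performs (Emit t a) (R, p, W) [] (R, p, W(t := W t @ [a]))"
  by (rule performs_keep, rule exec.Emit)

lemma performs_Clear: "performs (Clear t) (R, p, W) [] (R, p, W(t := []))"
  by (rule performs_keep, rule exec.Clear)

lemma performs_Next: "p < int (length w) \<Longrightarrow> performs Next (R, p, W) [] (R, p + 1, W)"
  by (rule performs_keep, rule exec.Next)

lemma performs_Prev: "0 \<le> p \<Longrightarrow> performs Prev (R, p, W) [] (R, p - 1, W)"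
  by (rule performs_keep, rule exec.Prev)

lemma performs_Mark:
  assumes "shows_snapshot (R, p, W) sn" "pt = snapshot_point sn"
  shows "performs (Mark pt) (R, p, W) [sn] (R, p, W)"
proof (rule performs_keep)
  fix R0 assume R0: "\<forall>x<nvars. R0 x = R x"
  then have "R0 0 = R 0" by simp
  then have "shows_snapshot (R0, p, W) sn" using assms(1) by (cases sn) auto
  then show "exec w L (Mark pt) (R0, p, W) [sn] (R0, p, W)" unfolding assms(2) by (rule exec.Mark)
qed

end

lemma assign_wf [simp]: "z < 17 \<Longrightarrow> scoped nvars e \<Longrightarrow> com_wf (assign z e)"
  using compile_exp_wf(1)[of "[0..<nvars]" nvars e]
  by (auto simp: assign_def copy_reg_def cond_wf_def nvars_def simp del: upt_rec_numeral upt_Suc)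

lemma mark_count_assign [simp]: "mark_count pt (assign z e) = 0"
  by (simp add: assign_def copy_reg_def)


section \<open>Writing a path on an output tape\<close>

text \<open>The digits of the code are taken from below and the output grows to the left, so the last vertex
  is written first, each vertex preceded by its end marker.\<close>

definition emit_loop :: "nat \<Rightarrow> nat \<Rightarrow> com" where
  "emit_loop t x = Until (Eq 13 14)
    (assign 15 (Call digit_exp [Var x, ESuc (Var 1), Var 13]) ;;
     If (Eq 15 5) Skip (Emit t 4 ;; assign 15 (Call pred_exp [Var 15]) ;; EmitReg t 15) ;;
     assign 13 (ESuc (Var 13)))"

definition emit :: "nat \<Rightarrow> nat \<Rightarrow> com" where
  "emit t x = Clear t ;; assign 13 EZero ;; assign 14 (ESuc (Var 1)) ;; emit_loop t x"

lemma emit_wf [simp]: "t \<in> {1, 2} \<Longrightarrow> x < 13 \<Longrightarrow> com_wf (emit t x)"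
  by (auto simp: emit_def emit_loop_def cond_wf_def)

lemma mark_count_emit [simp]: "mark_count pt (emit t x) = 0"
  by (simp add: emit_def emit_loop_def)

lemma enc_path_Cons: "rev (enc_path (y # q)) = rev (enc_path q) @ [4] @ bits y"
  by (simp add: enc_path_def bits_def)

lemma enc_path_append: "enc_path (p @ q) = enc_path p @ enc_path q"
  by (simp add: enc_path_def)

text \<open>Every intermediate output is shorter than the final one, which \<open>enc_fits\<close> bounds.\<close>

lemma length_enc_path_drop: "length (enc_path (drop j p)) \<le> length (enc_path p)"
  using enc_path_append[of "take j p" "drop j p"] by (metis append_take_drop_id le_add2 length_append)

locale procedure_numbers = numbers n D X L + visible_machine w L
  for n D X L :: nat and w :: "nat list" +
  assumes enc_fits: "codable (Suc n) p \<Longrightarrow> length p \<le> Suc n \<Longrightarrow> length (enc_path p) \<le> L"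
begin

lemma code_less: "codable (Suc n) p \<Longrightarrow> code_of n p < Suc n ^ Suc n"
  using padded_code_less[of "Suc n" p "Suc n"] by simp

lemma performs_emit_loop:
  assumes "t \<in> {1, 2}" "x < 13" "codable (Suc n) p" "length p \<le> Suc n"
    and "R 1 = n" "R 5 = 0" "R x = code_of n p" "R 14 = Suc n" "R 13 \<le> Suc n"
    and "W t = rev (enc_path (drop (Suc n - R 13) p))"
  shows "\<exists>R'. performs (emit_loop t x) (R, pos, W) [] (R', pos, W(t := rev (enc_path p))) \<and>
    (\<forall>r<nvars. r \<notin> {13, 14, 15} \<longrightarrow> R' r = R r)"
  using assms(5-)
proof (induction "Suc n - R 13" arbitrary: R W)
  case 0
  then have "W(t := rev (enc_path p)) = W" by auto
  moreover have "performs (emit_loop t x) (R, pos, W) [] (R, pos, W)"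
    unfolding emit_loop_def using 0 by (intro performs_Until_True) auto
  ultimately show ?case by (intro exI[of _ R]) auto
next
  case (Suc d)
  let ?i = "R 13"
  let ?d = "digit (R x) (Suc n) ?i"
  have i: "?i \<le> n" using Suc.hyps(2) by linarith
  have x17: "x < 17" "x \<noteq> 13" "x \<noteq> 15" using assms(2) by auto
  define R1 where "R1 = R(15 := ?d)"
  have 1: "performs (assign 15 (Call digit_exp [Var x, ESuc (Var 1), Var 13])) (R, pos, W) [] (R1, pos, W)"
    unfolding R1_def
    using below_digit_x[of "R x" ?i] code_less[OF assms(3)] i Suc.prems small x17
    by (intro performs_assign) auto
  have dig: "?d = (if n - ?i < length p then Suc (p ! (n - ?i)) else 0)"
    using digit_code_of[OF assms(3) i] Suc.prems by simp
  have "\<exists>R2. performs (If (Eq 15 5) Skip (Emit t 4 ;; assign 15 (Call pred_exp [Var 15]) ;; EmitReg t 15))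
      (R1, pos, W) [] (R2, pos, W(t := rev (enc_path (drop (n - ?i) p)))) \<and>
      (\<forall>r<nvars. r \<notin> {15} \<longrightarrow> R2 r = R r)"
  proof (cases "n - ?i < length p")
    case False
    then have "W(t := rev (enc_path (drop (n - ?i) p))) = W"
      using Suc.prems by (auto simp: Suc_diff_le i)
    moreover have "performs (If (Eq 15 5) Skip (Emit t 4 ;; assign 15 (Call pred_exp [Var 15]) ;; EmitReg t 15))
      (R1, pos, W) [] (R1, pos, W)"
      using False dig Suc.prems by (intro performs_If_True performs_Skip) (auto simp: R1_def)
    ultimately show ?thesis by (intro exI[of _ R1]) (auto simp: R1_def)
  next
    case True
    let ?y = "p ! (n - ?i)"
    have dr: "drop (n - ?i) p = ?y # drop (Suc n - ?i) p"
      using True i by (simp add: Cons_nth_drop_Suc Suc_diff_le)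
    have out: "rev (enc_path (drop (n - ?i) p)) = (W t @ [4]) @ bits ?y"
      unfolding dr enc_path_Cons using Suc.prems by simp
    have len: "length (W t) + Suc (length (bits ?y)) \<le> L"
      using arg_cong[OF out, of length] length_enc_path_drop[of "n - ?i" p] enc_fits[OF assms(3,4)] by simp
    let ?W1 = "W(t := W t @ [4])" and ?R2 = "R1(15 := ?y)"
    have e1: "performs (Emit t 4) (R1, pos, W) [] (R1, pos, ?W1)" using len by (intro performs_Emit) auto
    have e2: "performs (assign 15 (Call pred_exp [Var 15])) (R1, pos, ?W1) [] (?R2, pos, ?W1)"
      using True dig by (intro performs_assign) (auto simp: R1_def below_pred)
    have e3: "performs (EmitReg t 15) (?R2, pos, ?W1) [] (?R2, pos, ?W1(t := ?W1 t @ bits (?R2 15)))"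
      using len by (intro performs_EmitReg) auto
    have eq: "?W1(t := ?W1 t @ bits (?R2 15)) = W(t := rev (enc_path (drop (n - ?i) p)))"
      using out by simp
    have "performs (Emit t 4 ;; assign 15 (Call pred_exp [Var 15]) ;; EmitReg t 15) (R1, pos, W) []
        (?R2, pos, W(t := rev (enc_path (drop (n - ?i) p))))"
      by (rule performs_Seq_silent[OF e1 performs_Seq_silent[OF e2 e3[unfolded eq]]])
    then have "performs (If (Eq 15 5) Skip (Emit t 4 ;; assign 15 (Call pred_exp [Var 15]) ;; EmitReg t 15))
      (R1, pos, W) [] (?R2, pos, W(t := rev (enc_path (drop (n - ?i) p))))"
      using True dig Suc.prems by (intro performs_If_False) (auto simp: R1_def)
    then show ?thesis by (intro exI[of _ ?R2]) (auto simp: R1_def)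
  qed
  then obtain R2 where R2: "performs (If (Eq 15 5) Skip (Emit t 4 ;; assign 15 (Call pred_exp [Var 15]) ;; EmitReg t 15))
      (R1, pos, W) [] (R2, pos, W(t := rev (enc_path (drop (n - ?i) p))))"
    "\<forall>r<nvars. r \<notin> {15} \<longrightarrow> R2 r = R r" by blast
  let ?W2 = "W(t := rev (enc_path (drop (n - ?i) p)))"
  define R3 where "R3 = R2(13 := Suc ?i)"
  have vis: "R2 1 = n" "R2 5 = 0" "R2 x = code_of n p" "R2 14 = Suc n" "R2 13 = ?i"
    using R2(2) Suc.prems x17 by auto
  have 3: "performs (assign 13 (ESuc (Var 13))) (R2, pos, ?W2) [] (R3, pos, ?W2)"
    unfolding R3_def using vis i small by (intro performs_assign) auto
  have body: "performs (assign 15 (Call digit_exp [Var x, ESuc (Var 1), Var 13]) ;;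
     If (Eq 15 5) Skip (Emit t 4 ;; assign 15 (Call pred_exp [Var 15]) ;; EmitReg t 15) ;;
     assign 13 (ESuc (Var 13))) (R, pos, W) [] (R3, pos, ?W2)"
    by (rule performs_Seq_silent[OF 1 performs_Seq_silent[OF R2(1) 3]])
  have "\<exists>R'. performs (emit_loop t x) (R3, pos, ?W2) [] (R', pos, ?W2(t := rev (enc_path p))) \<and>
    (\<forall>r<nvars. r \<notin> {13, 14, 15} \<longrightarrow> R' r = R3 r)"
    using vis x17 i Suc.hyps(2) by (intro Suc.hyps(1)) (auto simp: R3_def)
  then obtain R' where R': "performs (emit_loop t x) (R3, pos, ?W2) [] (R', pos, W(t := rev (enc_path p)))"
    "\<forall>r<nvars. r \<notin> {13, 14, 15} \<longrightarrow> R' r = R3 r" by auto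
  have "performs (emit_loop t x) (R, pos, W) ([] @ []) (R', pos, W(t := rev (enc_path p)))"
    unfolding emit_loop_def
    using body R'(1) Suc.hyps(2) Suc.prems by (intro performs_Until_False) (auto simp: emit_loop_def)
  then show ?case using R'(2) R2(2) by (intro exI[of _ R']) (auto simp: R3_def)
qed

lemma performs_emit:
  assumes "t \<in> {1, 2}" "x < 13" "codable (Suc n) p" "length p \<le> Suc n"
    and "R 1 = n" "R 5 = 0" "R x = code_of n p"
  obtains R' where "performs (emit t x) (R, pos, W) [] (R', pos, W(t := rev (enc_path p)))"
    "\<forall>r<nvars. r \<notin> {13, 14, 15} \<longrightarrow> R' r = R r"
proof -
  let ?W1 = "W(t := [])" and ?R2 = "R(13 := 0, 14 := Suc n)"
  have 1: "performs (Clear t) (R, pos, W) [] (R, pos, ?W1)" by (rule performs_Clear)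
  have 2: "performs (assign 13 EZero) (R, pos, ?W1) [] (R(13 := 0), pos, ?W1)" by (intro performs_assign) auto
  have 3: "performs (assign 14 (ESuc (Var 1))) (R(13 := 0), pos, ?W1) [] (?R2, pos, ?W1)"
    using assms small by (intro performs_assign) auto
  have "drop (Suc n) p = []" using assms(4) by simp
  then obtain R' where "performs (emit_loop t x) (?R2, pos, ?W1) [] (R', pos, ?W1(t := rev (enc_path p)))"
    "\<forall>r<nvars. r \<notin> {13, 14, 15} \<longrightarrow> R' r = ?R2 r"
    using performs_emit_loop[OF assms(1-4), of ?R2 ?W1 pos] assms by (auto simp: enc_path_def)
  then show thesis
    using that[of R'] performs_Seq_silent[OF 1 performs_Seq_silent[OF 2 performs_Seq_silent[OF 3]]] by (auto simp: emit_def)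
qed

end

section \<open>The loops of the procedure\<close>

text \<open>The loops of the procedure run over lists, those of the program over intervals of codes. The
  following rule relates them: \<open>f\<close> and \<open>t\<close> are the effect and the trace of one item of the list, \<open>g\<close> is
  its code, and codes that fail the test \<open>P\<close> change nothing that the invariant can see.\<close>

fun scan_trace :: "('q \<Rightarrow> 's \<Rightarrow> 's) \<Rightarrow> ('q \<Rightarrow> 's \<Rightarrow> 't list) \<Rightarrow> 's \<Rightarrow> 'q list \<Rightarrow> 't list" where
  "scan_trace f t s [] = []"
| "scan_trace f t s (q # qs) = t q s @ scan_trace f t (f q s) qs"

lemma (in visible_machine) performs_scan:
  assumes miss: "\<And>c s R W. c < hi \<Longrightarrow> R a = c \<Longrightarrow> R b = hi \<Longrightarrow> Inv s R W \<Longrightarrow> \<not> P c \<Longrightarrow>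
      \<exists>R' W'. performs step (R, pos, W) [] (R', pos, W') \<and> R' a = Suc c \<and> R' b = hi \<and> Inv s R' W'"
    and hit: "\<And>q s R W. q \<in> set items \<Longrightarrow> g q < hi \<Longrightarrow> R a = g q \<Longrightarrow> R b = hi \<Longrightarrow> Inv s R W \<Longrightarrow> P (g q) \<Longrightarrow>
      \<exists>R' W'. performs step (R, pos, W) (t q s) (R', pos, W') \<and> R' a = Suc (g q) \<and> R' b = hi \<and> Inv (f q s) R' W'"
    and vis: "a < nvars" "b < nvars"
    and start: "Inv s R W" "R a = c" "R b = hi" "c \<le> hi" "filter P [c..<hi] = map g items"
  shows "\<exists>R' W'. performs (Until (Eq a b) step) (R, pos, W) (scan_trace f t s items) (R', pos, W') \<and>
    Inv (fold f items s) R' W'"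
proof -
  have "\<exists>R' W'. performs (Until (Eq a b) step) (R, pos, W) (scan_trace f t s qs) (R', pos, W') \<and>
    Inv (fold f qs s) R' W'"
    if "Inv s R W" "R a = c" "R b = hi" "c \<le> hi" "filter P [c..<hi] = map g qs" "set qs \<subseteq> set items"
    for qs s R W c
    using that
  proof (induction "hi - c" arbitrary: qs s R W c)
    case 0
    then have "qs = []" by simp
    moreover have "performs (Until (Eq a b) step) (R, pos, W) [] (R, pos, W)"
      using 0 vis by (intro performs_Until_True) auto
    ultimately show ?case using 0 by (metis scan_trace.simps(1) fold_simps(1))
  next
    case (Suc d)
    then have c: "c < hi" "d = hi - Suc c" by auto
    have up: "[c..<hi] = c # [Suc c..<hi]" using c by (simp add: upt_conv_Cons)
    have ne: "\<not> holds w (R, pos, W) (Eq a b)" "visible (Eq a b)" using Suc.prems c vis by auto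
    show ?case
    proof (cases "P c")
      case False
      then have rest: "filter P [Suc c..<hi] = map g qs" using Suc.prems(5) up by simp
      obtain R1 W1 where R1: "performs step (R, pos, W) [] (R1, pos, W1)" "R1 a = Suc c" "R1 b = hi" "Inv s R1 W1"
        using miss[OF c(1) Suc.prems(2,3,1) False] by blast
      obtain R2 W2 where R2: "performs (Until (Eq a b) step) (R1, pos, W1) (scan_trace f t s qs) (R2, pos, W2)"
        "Inv (fold f qs s) R2 W2"
        using Suc.hyps(1)[OF c(2) R1(4,2,3) _ rest Suc.prems(6)] c(1) by (metis Suc_leI)
      have "performs (Until (Eq a b) step) (R, pos, W) ([] @ scan_trace f t s qs) (R2, pos, W2)"
        by (rule performs_Until_False[OF ne R1(1) R2(1)])
      then show ?thesis using R2(2) by (metis append_Nil)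
    next
      case True
      then obtain q qs' where qs: "qs = q # qs'" "g q = c" "filter P [Suc c..<hi] = map g qs'"
        using Suc.prems(5) up by (cases qs) auto
      have q: "q \<in> set items" "set qs' \<subseteq> set items" "g q < hi" "R a = g q" "P (g q)"
        using Suc.prems(2,6) qs c(1) True by auto
      obtain R1 W1 where R1: "performs step (R, pos, W) (t q s) (R1, pos, W1)" "R1 a = Suc c" "R1 b = hi"
        "Inv (f q s) R1 W1"
        using hit[OF q(1,3,4) Suc.prems(3,1) q(5)] qs(2) by blast
      obtain R2 W2 where R2: "performs (Until (Eq a b) step) (R1, pos, W1) (scan_trace f t (f q s) qs') (R2, pos, W2)"
        "Inv (fold f qs' (f q s)) R2 W2"
        using Suc.hyps(1)[OF c(2) R1(4,2,3) _ qs(3) q(2)] c(1) by (metis Suc_leI)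
      have "performs (Until (Eq a b) step) (R, pos, W) (t q s @ scan_trace f t (f q s) qs') (R2, pos, W2)"
        by (rule performs_Until_False[OF ne R1(1) R2(1)])
      then show ?thesis using R2(2) qs(1) by (metis scan_trace.simps(2) fold_simps(2))
    qed
  qed
  from this[OF start] show ?thesis by simp
qed

text \<open>The codes of sequences that start with a given vertex form the interval between two such numbers.\<close>

definition "bound_exp e = Call mul_exp [e, Call pow_exp [ESuc (Var 1), Var 1]]"

definition "walk_a_exp r = Call walk_exp [Var 1, Var 2, Var 3, EZero, Var r]"
definition "walk_b_exp r = Call walk_exp [Var 1, Var 2, Var 3, Call mul_exp [Var 1, Var 1], Var r]"

text \<open>A halt inside nested loops is simulated by the flag in register \<open>10\<close>: once it is set, the remaining
  rounds do nothing.\<close>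

definition "cycle_step =
  If (Eq 10 5)
    (assign 11 (Call cycle_ok_exp [Var 1, Var 2, Var 3, Var 8]) ;;
     If (Eq 11 5) Skip
       (emit 2 8 ;; Mark At_Faithful_Cycle ;;
        assign 10 (IfEq (Call mod_exp [walk_b_exp 8, walk_a_exp 8]) EZero EZero EOne)))
    Skip ;;
  assign 8 (ESuc (Var 8))"

definition "path_step =
  If (Eq 10 5)
    (assign 11 (Call path_ok_exp [Var 1, Var 2, Var 3, Var 6]) ;;
     If (Eq 11 5) Skip
       (emit 1 6 ;; Mark At_Faithful_Path ;;
        assign 12 (Call last_exp [Var 1, Var 6]) ;;
        assign 8 (bound_exp (Var 12)) ;; assign 9 (bound_exp (ESuc (Var 12))) ;;
        Until (Eq 8 9) cycle_step))
    Skip ;;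
  assign 6 (ESuc (Var 6))"

definition "order_step =
  assign 11 (Call path_ok_exp [Var 1, Var 2, Var 3, Var 6]) ;;
  If (Eq 11 5) Skip
    (emit 1 6 ;; Mark At_Order_Path ;; assign 0 (Call lcm_exp [Var 0, walk_a_exp 6, walk_b_exp 6])) ;;
  assign 6 (ESuc (Var 6))"

definition "start_range =
  assign 6 (bound_exp (ESuc (Var 4))) ;; assign 7 (bound_exp (ESuc (ESuc (Var 4))))"

definition "order_com =
  start_range ;; Until (Eq 6 7) path_step ;;
  If (Eq 10 5) (assign 0 EOne ;; start_range ;; Until (Eq 6 7) order_step) (assign 0 EZero)"

lemma order_com_wf: "com_wf order_com"
  by (simp add: order_com_def start_range_def path_step_def cycle_step_def order_step_def cond_wf_def
      bound_exp_def walk_a_exp_def walk_b_exp_def)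

lemma order_com_marks:
  "mark_count pt order_com = (if pt = At_Order_Return then 0 else 1)"
  by (cases pt) (simp_all add: order_com_def start_range_def path_step_def cycle_step_def order_step_def)

lemma quotient_in_Ints_iff:
  fixes a b :: int
  assumes "b \<noteq> 0"
  shows "(of_int a / of_int b :: rat) \<in> \<int> \<longleftrightarrow> b dvd a"
proof
  assume "(of_int a / of_int b :: rat) \<in> \<int>"
  then obtain k :: int where "(of_int a / of_int b :: rat) = of_int k" by (auto elim: Ints_cases)
  then have "(of_int a :: rat) = of_int (k * b)" using assms by (simp add: field_simps)
  then have "a = k * b" by (simp only: of_int_eq_iff)
  then show "b dvd a" by simp
next
  assume "b dvd a"
  then obtain k where "a = b * k" by auto
  then show "(of_int a / of_int b :: rat) \<in> \<int>" using assms by simp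
qed

text \<open>The number \<open>X\<close> represents the pair: digits \<open>0, \<dots>, n * n - 1\<close> are the entries of \<open>A\<close> by rows, the next
  \<open>n * n\<close> digits those of \<open>B\<close> without signs.\<close>

locale procedure = procedure_numbers n D X L w + katsura n A B
  for n D X L :: nat and w :: "nat list" and A B :: "int mat" +
  fixes v :: nat
  assumes v: "v < n"
    and entry_a: "u < n \<Longrightarrow> u' < n \<Longrightarrow> digit X D (u * n + u') = a_entry u u'"
    and entry_b: "u < n \<Longrightarrow> u' < n \<Longrightarrow> digit X D (n * n + (u * n + u')) = b_entry u u'"
begin

lemma walk_prod_cong:
  assumes "x < Suc n ^ Suc n" "\<And>u u'. u < n \<Longrightarrow> u' < n \<Longrightarrow> f u u' = g u u'"
  shows "walk_prod n f x = walk_prod n g x"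
  unfolding walk_prod_def using assms(2) digit_x[OF assms(1)] by (intro prod.cong) auto

lemma walk_a: "x < Suc n ^ Suc n \<Longrightarrow> walk_prod n (\<lambda>u u'. digit X D (u * n + u')) x = walk_prod n a_entry x"
  by (rule walk_prod_cong) (simp_all add: entry_a)

lemma walk_b:
  "x < Suc n ^ Suc n \<Longrightarrow> walk_prod n (\<lambda>u u'. digit X D (n * n + (u * n + u'))) x = walk_prod n b_entry x"
  by (rule walk_prod_cong) (simp_all add: entry_b)

definition globals :: "(nat \<Rightarrow> nat) \<Rightarrow> bool" where
  "globals R \<longleftrightarrow> R 1 = n \<and> R 2 = D \<and> R 3 = X \<and> R 4 = v \<and> R 5 = 0"

definition frame :: "nat set \<Rightarrow> (nat \<Rightarrow> nat) \<Rightarrow> (nat \<Rightarrow> nat) \<Rightarrow> bool" where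
  "frame S R R' \<longleftrightarrow> (\<forall>r<nvars. r \<notin> S \<longrightarrow> R' r = R r)"

lemma frame_refl [simp]: "frame S R R"
  by (simp add: frame_def)

lemma frame_trans: "frame S R R' \<Longrightarrow> frame S' R' R'' \<Longrightarrow> S \<subseteq> T \<Longrightarrow> S' \<subseteq> T \<Longrightarrow> frame T R R''"
  unfolding frame_def subset_iff by metis

lemma frame_upd: "r \<in> S \<Longrightarrow> frame S R R' \<Longrightarrow> frame S R (R'(r := y))"
  by (auto simp: frame_def)

lemma frame_globals: "frame S R R' \<Longrightarrow> S \<inter> {1, 2, 3, 4, 5} = {} \<Longrightarrow> globals R \<Longrightarrow> globals R'"
  by (auto simp: frame_def globals_def)

lemma path_ok_eval: "x < Suc n ^ Suc n \<Longrightarrow> eval_exp [n, D, X, x] path_ok_exp = of_bool (path_ok x)"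
  by (simp add: path_ok_exp_def path_ok_def walk_b)

lemma cycle_ok_eval: "x < Suc n ^ Suc n \<Longrightarrow> eval_exp [n, D, X, x] cycle_ok_exp = of_bool (cycle_ok x)"
  by (simp add: cycle_ok_exp_def cycle_ok_def walk_a)

lemma performs_path_ok:
  assumes "globals R" "R 6 < Suc n ^ Suc n"
  shows "performs (assign 11 (Call path_ok_exp [Var 1, Var 2, Var 3, Var 6])) (R, p, W) []
    (R(11 := of_bool (path_ok (R 6))), p, W)"
  using assms below_path_ok[OF assms(2)] path_ok_eval[OF assms(2)]
  by (intro performs_assign) (simp_all add: globals_def numeral_2_eq_2)

lemma performs_cycle_ok:
  assumes "globals R" "R 8 < Suc n ^ Suc n"
  shows "performs (assign 11 (Call cycle_ok_exp [Var 1, Var 2, Var 3, Var 8])) (R, p, W) []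
    (R(11 := of_bool (cycle_ok (R 8))), p, W)"
  using assms below_cycle_ok[OF assms(2)] cycle_ok_eval[OF assms(2)]
  by (intro performs_assign) (simp_all add: globals_def numeral_2_eq_2)

lemma performs_bound:
  assumes "z < nvars" "R 1 = n" "below (2 ^ L) (env_of R) e" "eval_exp (env_of R) e \<le> Suc n"
  shows "performs (assign z (bound_exp e)) (R, p, W) [] (R(z := eval_exp (env_of R) e * Suc n ^ n), p, W)"
proof -
  have "eval_exp (env_of R) e * Suc n ^ n \<le> Suc n * Suc n ^ n" using assms(4) by (rule mult_right_mono) simp
  also have "\<dots> = Suc n ^ Suc n" by simp
  also have "\<dots> < 2 ^ L" by (rule base_pow_less) simp
  finally have "eval_exp (env_of R) e * Suc n ^ n < 2 ^ L" .
  then show ?thesis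
    using assms small base_pow_less[of n]
    by (intro performs_assign) (auto simp: bound_exp_def intro!: below_mul below_pow)
qed

lemma walk_exps:
  assumes "globals R" "r < 17" "R r < Suc n ^ Suc n"
  shows "below (2 ^ L) (env_of R) (walk_a_exp r)" "eval_exp (env_of R) (walk_a_exp r) = walk_prod n a_entry (R r)"
    "below (2 ^ L) (env_of R) (walk_b_exp r)" "eval_exp (env_of R) (walk_b_exp r) = walk_prod n b_entry (R r)"
  using assms below_walk[OF assms(3), of 0] below_walk[OF assms(3), of "n * n"] small
    walk_a[OF assms(3)] walk_b[OF assms(3)]
  by (auto simp: walk_a_exp_def walk_b_exp_def globals_def numeral_2_eq_2 intro!: below_mul)

definition bad_cycle :: "path \<Rightarrow> bool" where
  "bad_cycle c \<longleftrightarrow> (of_int (path_prod B c) / of_int (path_prod A c) :: rat) \<notin> \<int>"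

text \<open>Signs do not affect divisibility, so the quotient test reduces to natural numbers.\<close>

lemma bad_cycle_iff:
  assumes "simple_cycle A c"
  shows "bad_cycle c \<longleftrightarrow> walk_prod n b_entry (code_of n c) mod walk_prod n a_entry (code_of n c) \<noteq> 0"
proof -
  note bd = simple_cycle_bounds[OF assms]
  have cd: "codable (Suc n) c" "length c \<le> Suc n" using bd codable_iff by auto
  have "walk_prod n a_entry (code_of n c) \<noteq> 0"
    unfolding walk_prod_pos_iff[OF cd]
  proof (intro allI impI)
    fix i assume i: "Suc i < length c"
    have "A $$ (c ! i, c ! Suc i) \<noteq> 0" using assms i by (simp add: simple_cycle_iff is_path_iff)
    then show "a_entry (c ! i) (c ! Suc i) \<noteq> 0"
      using a_entry_ne[of "c ! i" "c ! Suc i"] nth_less[OF bd(2)] i by simp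
  qed
  moreover have a: "int (walk_prod n a_entry (code_of n c)) = path_prod A c"
    unfolding walk_prod_code_of[OF cd] by (rule path_prod_a[OF bd(2)])
  moreover have b: "int (walk_prod n b_entry (code_of n c)) = \<bar>path_prod B c\<bar>"
    unfolding walk_prod_code_of[OF cd] by (rule path_prod_b)
  ultimately have "bad_cycle c \<longleftrightarrow> \<not> path_prod A c dvd path_prod B c"
    unfolding bad_cycle_def by (subst quotient_in_Ints_iff) auto
  also have "\<dots> \<longleftrightarrow> \<not> int (walk_prod n a_entry (code_of n c)) dvd int (walk_prod n b_entry (code_of n c))"
    unfolding a b by simp
  finally show ?thesis by (simp add: mod_eq_0_iff_dvd)
qed

abbreviation cycle_frame :: "nat set" where "cycle_frame \<equiv> {8, 10, 11, 13, 14, 15}"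
abbreviation path_frame :: "nat set" where "path_frame \<equiv> {6, 8, 9, 10, 11, 12, 13, 14, 15}"

lemma performs_increment:
  assumes "z < 17" "R z < Suc n ^ Suc n"
  shows "performs (assign z (ESuc (Var z))) (R, p, W) [] (R(z := Suc (R z)), p, W)"
  using assms base_pow_less[of "Suc n"] by (intro performs_assign) auto

definition cycle_inv :: "(nat \<Rightarrow> nat) \<Rightarrow> (nat \<Rightarrow> nat list) \<Rightarrow> bool \<Rightarrow> (nat \<Rightarrow> nat) \<Rightarrow> (nat \<Rightarrow> nat list) \<Rightarrow> bool" where
  "cycle_inv R0 W0 s R W \<longleftrightarrow> frame cycle_frame R0 R \<and> W 1 = W0 1 \<and> (R 10 = 0 \<longleftrightarrow> \<not> s)"

lemma cycle_step_stopped: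
  assumes "globals R0" "cycle_inv R0 W0 True R W" "R 8 < Suc n ^ Suc n"
  shows "\<exists>R' W'. performs cycle_step (R, pos, W) [] (R', pos, W') \<and> R' 8 = Suc (R 8) \<and> R' 9 = R 9 \<and>
    cycle_inv R0 W0 True R' W'"
proof -
  have g: "globals R" using assms(1,2) frame_globals by (auto simp: cycle_inv_def)
  have "performs (If (Eq 10 5) c Skip) (R, pos, W) [] (R, pos, W)" for c
    using assms(2) g by (intro performs_If_False performs_Skip) (auto simp: cycle_inv_def globals_def)
  from performs_Seq_silent[OF this performs_increment[of 8 R pos W]] assms(3)
  have "performs cycle_step (R, pos, W) [] (R(8 := Suc (R 8)), pos, W)" by (simp add: cycle_step_def)
  then show ?thesis
    using assms(2) by (intro exI[of _ "R(8 := Suc (R 8))"] exI[of _ W]) (auto simp: cycle_inv_def frame_upd)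
qed

lemma cycle_step_miss:
  assumes "globals R0" "cycle_inv R0 W0 s R W" "R 8 < Suc n ^ Suc n" "\<not> cycle_ok (R 8)"
  shows "\<exists>R' W'. performs cycle_step (R, pos, W) [] (R', pos, W') \<and> R' 8 = Suc (R 8) \<and> R' 9 = R 9 \<and>
    cycle_inv R0 W0 s R' W'"
proof (cases s)
  case True
  then show ?thesis using cycle_step_stopped[of R0 W0 R W pos] assms by simp
next
  case False
  have g: "globals R" using assms(1,2) frame_globals by (auto simp: cycle_inv_def)
  let ?R1 = "R(11 := 0)"
  have 1: "performs (assign 11 (Call cycle_ok_exp [Var 1, Var 2, Var 3, Var 8])) (R, pos, W) [] (?R1, pos, W)"
    using performs_cycle_ok[OF g assms(3)] assms(4) by simp
  have 2: "performs (If (Eq 11 5) Skip c) (?R1, pos, W) [] (?R1, pos, W)" for c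
    using g by (intro performs_If_True performs_Skip) (auto simp: globals_def)
  have 3: "performs (If (Eq 10 5) (assign 11 (Call cycle_ok_exp [Var 1, Var 2, Var 3, Var 8]) ;; If (Eq 11 5) Skip c) Skip)
      (R, pos, W) [] (?R1, pos, W)" for c
    by (rule performs_If_True[OF _ _ performs_Seq_silent[OF 1 2]])
      (use assms(2) False g in \<open>auto simp: cycle_inv_def globals_def\<close>)
  have 4: "performs (assign 8 (ESuc (Var 8))) (?R1, pos, W) [] (?R1(8 := Suc (R 8)), pos, W)"
    using performs_increment[of 8 ?R1 pos W] assms(3) by simp
  have "performs cycle_step (R, pos, W) [] (?R1(8 := Suc (R 8)), pos, W)"
    unfolding cycle_step_def by (rule performs_Seq_silent[OF 3 4])
  then show ?thesis
    using assms(2) by (intro exI[of _ "?R1(8 := Suc (R 8))"] exI[of _ W]) (auto simp: cycle_inv_def frame_upd)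
qed

lemma cycle_step_hit:
  assumes "globals R0" "cycle_inv R0 W0 s R W" "R 8 < Suc n ^ Suc n" "cycle_ok (R 8)"
    and q: "simple_cycle A q" "R 8 = code_of n q" and p: "rev (W0 1) = enc_path p"
  shows "\<exists>R' W'. performs cycle_step (R, pos, W) (if s then [] else [Faithful_Cycle p q]) (R', pos, W') \<and>
    R' 8 = Suc (R 8) \<and> R' 9 = R 9 \<and> cycle_inv R0 W0 (s \<or> bad_cycle q) R' W'"
proof (cases s)
  case True
  then show ?thesis using cycle_step_stopped[of R0 W0 R W pos] assms by simp
next
  case False
  have g: "globals R" using assms(1,2) frame_globals by (auto simp: cycle_inv_def)
  have cd: "codable (Suc n) q" "length q \<le> Suc n" using simple_cycle_bounds[OF q(1)] codable_iff by auto
  let ?R1 = "R(11 := 1)"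
  have 1: "performs (assign 11 (Call cycle_ok_exp [Var 1, Var 2, Var 3, Var 8])) (R, pos, W) [] (?R1, pos, W)"
    using performs_cycle_ok[OF g assms(3)] assms(4) by simp
  obtain R2 where R2: "performs (emit 2 8) (?R1, pos, W) [] (R2, pos, W(2 := rev (enc_path q)))"
    "\<forall>r<nvars. r \<notin> {13, 14, 15} \<longrightarrow> R2 r = ?R1 r"
    using performs_emit[of 2 8 q ?R1 pos W] cd g q(2) by (auto simp: globals_def)
  let ?W2 = "W(2 := rev (enc_path q))"
  have 2: "performs (Mark At_Faithful_Cycle) (R2, pos, ?W2) [Faithful_Cycle p q] (R2, pos, ?W2)"
    using assms(2) p by (intro performs_Mark) (auto simp: cycle_inv_def)
  have g2: "globals R2" "R2 8 = R 8" "R2 9 = R 9" using R2(2) g by (auto simp: globals_def)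
  let ?f = "if walk_prod n b_entry (R 8) mod walk_prod n a_entry (R 8) = 0 then 0 else 1"
  let ?R3 = "R2(10 := ?f)"
  have lt: "R2 8 < Suc n ^ Suc n" using assms(3) g2(2) by simp
  note we = walk_exps[OF g2(1) _ lt, simplified]
  have "walk_prod n b_entry (R 8) < 2 ^ L"
    using walk_less[OF assms(3), of "n * n"] walk_b[OF assms(3)] by simp
  then have 3: "performs (assign 10 (IfEq (Call mod_exp [walk_b_exp 8, walk_a_exp 8]) EZero EZero EOne))
      (R2, pos, ?W2) [] (?R3, pos, ?W2)"
    using we g2(2) small by (intro performs_assign) (auto intro: below_mod)
  have 4: "performs (emit 2 8 ;; Mark At_Faithful_Cycle ;;
        assign 10 (IfEq (Call mod_exp [walk_b_exp 8, walk_a_exp 8]) EZero EZero EOne))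
      (?R1, pos, W) [Faithful_Cycle p q] (?R3, pos, ?W2)"
    using performs_Seq_silent[OF R2(1) performs_Seq[OF 2 3]] by simp
  have 5: "performs (If (Eq 11 5) Skip (emit 2 8 ;; Mark At_Faithful_Cycle ;;
        assign 10 (IfEq (Call mod_exp [walk_b_exp 8, walk_a_exp 8]) EZero EZero EOne)))
      (?R1, pos, W) [Faithful_Cycle p q] (?R3, pos, ?W2)"
    by (rule performs_If_False[OF _ _ 4]) (use g in \<open>auto simp: globals_def\<close>)
  have 6: "performs (If (Eq 10 5) (assign 11 (Call cycle_ok_exp [Var 1, Var 2, Var 3, Var 8]) ;;
        If (Eq 11 5) Skip (emit 2 8 ;; Mark At_Faithful_Cycle ;;
        assign 10 (IfEq (Call mod_exp [walk_b_exp 8, walk_a_exp 8]) EZero EZero EOne))) Skip)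
      (R, pos, W) [Faithful_Cycle p q] (?R3, pos, ?W2)"
    by (rule performs_If_True[OF _ _ performs_Seq_silent[OF 1 5]])
      (use assms(2) False g in \<open>auto simp: cycle_inv_def globals_def\<close>)
  have 7: "performs (assign 8 (ESuc (Var 8))) (?R3, pos, ?W2) [] (?R3(8 := Suc (R 8)), pos, ?W2)"
    using performs_increment[of 8 ?R3 pos ?W2] assms(3) g2(2) by simp
  have run: "performs cycle_step (R, pos, W) [Faithful_Cycle p q] (?R3(8 := Suc (R 8)), pos, ?W2)"
    unfolding cycle_step_def using performs_Seq[OF 6 7] by simp
  have "frame cycle_frame R0 R2"
    using assms(2) R2(2) by (auto simp: cycle_inv_def frame_def)
  then have "cycle_inv R0 W0 (bad_cycle q) (?R3(8 := Suc (R 8))) ?W2"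
    using assms(2) bad_cycle_iff[OF q(1)] q(2) by (auto simp: cycle_inv_def frame_upd)
  then show ?thesis
    using run False g2 by (intro exI[of _ "?R3(8 := Suc (R 8))"] exI[of _ ?W2]) auto
qed

text \<open>The accumulated flag \<open>s\<close> plays the role of the early exit of \<open>faithful_cycle_loop\<close>.\<close>

lemma cycle_scan:
  "scan_trace (\<lambda>q s. s \<or> bad_cycle q) (\<lambda>q s. if s then [] else [Faithful_Cycle p q]) s cs =
     (if s then [] else fst (faithful_cycle_loop A B p cs))"
  "fold (\<lambda>q s. s \<or> bad_cycle q) cs s \<longleftrightarrow> s \<or> snd (faithful_cycle_loop A B p cs)"
  by (induction cs arbitrary: s) (auto simp: bad_cycle_def Let_def case_prod_beta)

lemma performs_cycle_loop:
  assumes "globals R" "R 10 = 0" "u < n" "R 8 = Suc u * Suc n ^ n" "R 9 = Suc (Suc u) * Suc n ^ n"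
    and p: "rev (W 1) = enc_path p"
  shows "\<exists>R' W'. performs (Until (Eq 8 9) cycle_step) (R, pos, W)
      (fst (faithful_cycle_loop A B p (simple_cycles A u))) (R', pos, W') \<and>
    cycle_inv R W (snd (faithful_cycle_loop A B p (simple_cycles A u))) R' W'"
proof -
  let ?cs = "simple_cycles A u" and ?hi = "Suc (Suc u) * Suc n ^ n"
  have hi: "?hi \<le> Suc n ^ Suc n" using interval_bound[OF assms(3)] .
  have cyc: "simple_cycle A q" if "q \<in> set ?cs" for q
    using that finite_simple_cycles[of A u] by (simp add: simple_cycles_def)
  have "\<exists>R' W'. performs (Until (Eq 8 9) cycle_step) (R, pos, W)
      (scan_trace (\<lambda>q s. s \<or> bad_cycle q) (\<lambda>q s. if s then [] else [Faithful_Cycle p q]) False ?cs) (R', pos, W') \<and>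
    cycle_inv R W (fold (\<lambda>q s. s \<or> bad_cycle q) ?cs False) R' W'"
  proof (rule performs_scan[where P = cycle_ok and g = "code_of n" and hi = ?hi and c = "Suc u * Suc n ^ n"])
    fix c s R1 W1
    assume h: "c < ?hi" "R1 8 = c" "R1 9 = ?hi" "cycle_inv R W s R1 W1" "\<not> cycle_ok c"
    then have "R1 8 < Suc n ^ Suc n" using hi by linarith
    from cycle_step_miss[OF assms(1) h(4) this] h(2,3,5)
    show "\<exists>R' W'. performs cycle_step (R1, pos, W1) [] (R', pos, W') \<and> R' 8 = Suc c \<and> R' 9 = ?hi \<and> cycle_inv R W s R' W'"
      by metis
  next
    fix q s R1 W1
    assume h: "q \<in> set ?cs" "code_of n q < ?hi" "R1 8 = code_of n q" "R1 9 = ?hi" "cycle_inv R W s R1 W1"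
      "cycle_ok (code_of n q)"
    then have "R1 8 < Suc n ^ Suc n" using hi by linarith
    from cycle_step_hit[OF assms(1) h(5) this _ cyc[OF h(1)] h(3) p] h(3,4,6)
    show "\<exists>R' W'. performs cycle_step (R1, pos, W1) (if s then [] else [Faithful_Cycle p q]) (R', pos, W') \<and>
        R' 8 = Suc (code_of n q) \<and> R' 9 = ?hi \<and> cycle_inv R W (s \<or> bad_cycle q) R' W'"
      by metis
  next
    show "filter cycle_ok [Suc u * Suc n ^ n..<?hi] = map (code_of n) ?cs" by (rule cycle_codes[OF assms(3)])
    show "cycle_inv R W False R W" using assms(2) by (simp add: cycle_inv_def)
  qed (use assms in auto)
  moreover have "scan_trace (\<lambda>q s. s \<or> bad_cycle q) (\<lambda>q s. if s then [] else [Faithful_Cycle p q]) False ?cs =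
      fst (faithful_cycle_loop A B p ?cs)"
    "fold (\<lambda>q s. s \<or> bad_cycle q) ?cs False = snd (faithful_cycle_loop A B p ?cs)"
    using cycle_scan[where p = p and s = False and cs = ?cs] by simp_all
  ultimately show ?thesis by (simp only:)
qed

definition cycles_of :: "path \<Rightarrow> snapshot list \<times> bool" where
  "cycles_of p = faithful_cycle_loop A B p (simple_cycles A (path_source p))"

definition path_inv :: "(nat \<Rightarrow> nat) \<Rightarrow> bool \<Rightarrow> (nat \<Rightarrow> nat) \<Rightarrow> (nat \<Rightarrow> nat list) \<Rightarrow> bool" where
  "path_inv R0 s R W \<longleftrightarrow> frame path_frame R0 R \<and> (R 10 = 0 \<longleftrightarrow> \<not> s)"

lemma path_inv_globals: "globals R0 \<Longrightarrow> path_inv R0 s R W \<Longrightarrow> globals R"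
  using frame_globals by (auto simp: path_inv_def)

lemma path_step_stopped:
  assumes "globals R0" "path_inv R0 True R W" "R 6 < Suc n ^ Suc n"
  shows "\<exists>R' W'. performs path_step (R, pos, W) [] (R', pos, W') \<and> R' 6 = Suc (R 6) \<and> R' 7 = R 7 \<and>
    path_inv R0 True R' W'"
proof -
  have g: "globals R" using assms(1,2) by (rule path_inv_globals)
  have "performs (If (Eq 10 5) c Skip) (R, pos, W) [] (R, pos, W)" for c
    using assms(2) g by (intro performs_If_False performs_Skip) (auto simp: path_inv_def globals_def)
  from performs_Seq_silent[OF this performs_increment[of 6 R pos W]] assms(3)
  have "performs path_step (R, pos, W) [] (R(6 := Suc (R 6)), pos, W)" by (simp add: path_step_def)
  then show ?thesis
    using assms(2) by (intro exI[of _ "R(6 := Suc (R 6))"] exI[of _ W]) (auto simp: path_inv_def frame_upd)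
qed

lemma path_step_miss:
  assumes "globals R0" "path_inv R0 s R W" "R 6 < Suc n ^ Suc n" "\<not> path_ok (R 6)"
  shows "\<exists>R' W'. performs path_step (R, pos, W) [] (R', pos, W') \<and> R' 6 = Suc (R 6) \<and> R' 7 = R 7 \<and>
    path_inv R0 s R' W'"
proof (cases s)
  case True
  then show ?thesis using path_step_stopped[of R0 R W pos] assms by simp
next
  case False
  have g: "globals R" using assms(1,2) by (rule path_inv_globals)
  let ?R1 = "R(11 := 0)"
  have 1: "performs (assign 11 (Call path_ok_exp [Var 1, Var 2, Var 3, Var 6])) (R, pos, W) [] (?R1, pos, W)"
    using performs_path_ok[OF g assms(3)] assms(4) by simp
  have 2: "performs (If (Eq 11 5) Skip c) (?R1, pos, W) [] (?R1, pos, W)" for c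
    using g by (intro performs_If_True performs_Skip) (auto simp: globals_def)
  have 3: "performs (If (Eq 10 5) (assign 11 (Call path_ok_exp [Var 1, Var 2, Var 3, Var 6]) ;; If (Eq 11 5) Skip c) Skip)
      (R, pos, W) [] (?R1, pos, W)" for c
    by (rule performs_If_True[OF _ _ performs_Seq_silent[OF 1 2]])
      (use assms(2) False g in \<open>auto simp: path_inv_def globals_def\<close>)
  have 4: "performs (assign 6 (ESuc (Var 6))) (?R1, pos, W) [] (?R1(6 := Suc (R 6)), pos, W)"
    using performs_increment[of 6 ?R1 pos W] assms(3) by simp
  have "performs path_step (R, pos, W) [] (?R1(6 := Suc (R 6)), pos, W)"
    unfolding path_step_def by (rule performs_Seq_silent[OF 3 4])
  then show ?thesis
    using assms(2) by (intro exI[of _ "?R1(6 := Suc (R 6))"] exI[of _ W]) (auto simp: path_inv_def frame_upd)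
qed

lemma path_step_hit:
  assumes "globals R0" "path_inv R0 s R W" "R 6 < Suc n ^ Suc n" "path_ok (R 6)"
    and p: "simple_path A p" "R 6 = code_of n p"
  shows "\<exists>R' W'. performs path_step (R, pos, W) (if s then [] else Faithful_Path p # fst (cycles_of p)) (R', pos, W') \<and>
    R' 6 = Suc (R 6) \<and> R' 7 = R 7 \<and> path_inv R0 (s \<or> snd (cycles_of p)) R' W'"
proof (cases s)
  case True
  then show ?thesis using path_step_stopped[of R0 R W pos] assms by simp
next
  case False
  have g: "globals R" using assms(1,2) by (rule path_inv_globals)
  note bd = simple_path_bounds[OF p(1)]
  have cd: "codable (Suc n) p" "length p \<le> Suc n" using bd codable_iff by auto
  have u: "last p < n" using bd by (metis last_in_set lessThan_iff subsetD)
  let ?R1 = "R(11 := 1)"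
  have 1: "performs (assign 11 (Call path_ok_exp [Var 1, Var 2, Var 3, Var 6])) (R, pos, W) [] (?R1, pos, W)"
    using performs_path_ok[OF g assms(3)] assms(4) by simp
  let ?W2 = "W(1 := rev (enc_path p))"
  obtain R2 where R2: "performs (emit 1 6) (?R1, pos, W) [] (R2, pos, ?W2)"
    "\<forall>r<nvars. r \<notin> {13, 14, 15} \<longrightarrow> R2 r = ?R1 r"
    using performs_emit[of 1 6 p ?R1 pos W] cd g p(2) by (auto simp: globals_def)
  have g2: "globals R2" "R2 6 = R 6" "R2 7 = R 7" "R2 10 = 0"
    using R2(2) g assms(2) False by (auto simp: globals_def path_inv_def)
  have n2: "R2 1 = n" using g2(1) by (simp add: globals_def)
  have 2: "performs (Mark At_Faithful_Path) (R2, pos, ?W2) [Faithful_Path p] (R2, pos, ?W2)"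
    by (intro performs_Mark) auto
  define R3 where "R3 = R2(12 := Suc (last p))"
  have 3: "performs (assign 12 (Call last_exp [Var 1, Var 6])) (R2, pos, ?W2) [] (R3, pos, ?W2)"
    unfolding R3_def
    using n2 g2(2) p(2) last_digit_code_of[OF cd bd(1)] below_last[OF assms(3)]
    by (intro performs_assign) auto
  define R4 where "R4 = R3(8 := Suc (last p) * Suc n ^ n)"
  have 4: "performs (assign 8 (bound_exp (Var 12))) (R3, pos, ?W2) [] (R4, pos, ?W2)"
    using performs_bound[of 8 R3 "Var 12" pos ?W2] n2 u by (simp add: R4_def R3_def)
  define R5 where "R5 = R4(9 := Suc (Suc (last p)) * Suc n ^ n)"
  have 5: "performs (assign 9 (bound_exp (ESuc (Var 12)))) (R4, pos, ?W2) [] (R5, pos, ?W2)"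
    using performs_bound[of 9 R4 "ESuc (Var 12)" pos ?W2] n2 u small by (simp add: R5_def R4_def R3_def)
  have g5: "globals R5" "R5 10 = 0" "R5 8 = Suc (last p) * Suc n ^ n" "R5 9 = Suc (Suc (last p)) * Suc n ^ n"
    using g2 by (auto simp: R5_def R4_def R3_def globals_def)
  obtain R6 W6 where R6: "performs (Until (Eq 8 9) cycle_step) (R5, pos, ?W2) (fst (cycles_of p)) (R6, pos, W6)"
    "cycle_inv R5 ?W2 (snd (cycles_of p)) R6 W6"
    using performs_cycle_loop[OF g5(1,2) u g5(3,4), of ?W2 p pos] by (auto simp: cycles_of_def path_source_def)
  let ?c = "emit 1 6 ;; Mark At_Faithful_Path ;; assign 12 (Call last_exp [Var 1, Var 6]) ;;
        assign 8 (bound_exp (Var 12)) ;; assign 9 (bound_exp (ESuc (Var 12))) ;; Until (Eq 8 9) cycle_step"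
  have 6: "performs ?c (?R1, pos, W) (Faithful_Path p # fst (cycles_of p)) (R6, pos, W6)"
    using performs_Seq_silent[OF R2(1) performs_Seq[OF 2 performs_Seq_silent[OF 3 performs_Seq_silent[OF 4 performs_Seq_silent[OF 5 R6(1)]]]]]
    by simp
  have 7: "performs (If (Eq 11 5) Skip ?c) (?R1, pos, W) (Faithful_Path p # fst (cycles_of p)) (R6, pos, W6)"
    by (rule performs_If_False[OF _ _ 6]) (use g in \<open>auto simp: globals_def\<close>)
  have 8: "performs (If (Eq 10 5) (assign 11 (Call path_ok_exp [Var 1, Var 2, Var 3, Var 6]) ;; If (Eq 11 5) Skip ?c) Skip)
      (R, pos, W) (Faithful_Path p # fst (cycles_of p)) (R6, pos, W6)"
    by (rule performs_If_True[OF _ _ performs_Seq_silent[OF 1 7]])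
      (use assms(2) False g in \<open>auto simp: path_inv_def globals_def\<close>)
  have f6: "frame cycle_frame R5 R6" "R6 10 = 0 \<longleftrightarrow> \<not> snd (cycles_of p)" using R6(2) by (auto simp: cycle_inv_def)
  then have r6: "R6 6 = R 6" "R6 7 = R 7" using g2 by (auto simp: frame_def R5_def R4_def R3_def)
  have 9: "performs (assign 6 (ESuc (Var 6))) (R6, pos, W6) [] (R6(6 := Suc (R 6)), pos, W6)"
    using performs_increment[of 6 R6 pos W6] assms(3) r6 by simp
  have run: "performs path_step (R, pos, W) (Faithful_Path p # fst (cycles_of p)) (R6(6 := Suc (R 6)), pos, W6)"
    unfolding path_step_def using performs_Seq[OF 8 9] by simp
  have "frame path_frame R0 R5"
    using assms(2) R2(2) by (auto simp: path_inv_def frame_def R5_def R4_def R3_def)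
  then have "frame path_frame R0 R6" by (rule frame_trans[OF _ f6(1)]) auto
  then have "path_inv R0 (snd (cycles_of p)) (R6(6 := Suc (R 6))) W6"
    using f6(2) by (auto simp: path_inv_def frame_upd)
  then show ?thesis
    using run False r6 by (intro exI[of _ "R6(6 := Suc (R 6))"] exI[of _ W6]) auto
qed

lemma path_scan:
  "scan_trace (\<lambda>p s. s \<or> snd (cycles_of p)) (\<lambda>p s. if s then [] else Faithful_Path p # fst (cycles_of p)) s ps =
     (if s then [] else fst (faithful_path_loop A B ps))"
  "fold (\<lambda>p s. s \<or> snd (cycles_of p)) ps s \<longleftrightarrow> s \<or> snd (faithful_path_loop A B ps)"
  by (induction ps arbitrary: s) (auto simp: cycles_of_def Let_def case_prod_beta)

abbreviation lo where "lo \<equiv> Suc v * Suc n ^ n"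
abbreviation hi where "hi \<equiv> Suc (Suc v) * Suc n ^ n"

lemma loop_paths_simple: "p \<in> set (loop_paths A B v) \<Longrightarrow> simple_path A p \<and> path_prod B p \<noteq> 0"
  using finite_simple_paths[of A v] by (auto simp: loop_paths_def simple_paths_def)

lemma performs_path_loop:
  assumes "globals R" "R 10 = 0" "R 6 = lo" "R 7 = hi"
  shows "\<exists>R' W'. performs (Until (Eq 6 7) path_step) (R, pos, W) (fst (faithful_run A B v)) (R', pos, W') \<and>
    path_inv R (snd (faithful_run A B v)) R' W'"
proof -
  let ?ps = "loop_paths A B v"
  have hib: "hi \<le> Suc n ^ Suc n" using interval_bound[OF v] .
  have "\<exists>R' W'. performs (Until (Eq 6 7) path_step) (R, pos, W)
      (scan_trace (\<lambda>p s. s \<or> snd (cycles_of p)) (\<lambda>p s. if s then [] else Faithful_Path p # fst (cycles_of p))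
        False ?ps) (R', pos, W') \<and>
    path_inv R (fold (\<lambda>p s. s \<or> snd (cycles_of p)) ?ps False) R' W'"
  proof (rule performs_scan[where P = path_ok and g = "code_of n" and hi = hi and c = lo])
    fix c s R1 W1
    assume h: "c < hi" "R1 6 = c" "R1 7 = hi" "path_inv R s R1 W1" "\<not> path_ok c"
    then have "R1 6 < Suc n ^ Suc n" using hib by linarith
    from path_step_miss[OF assms(1) h(4) this] h(2,3,5)
    show "\<exists>R' W'. performs path_step (R1, pos, W1) [] (R', pos, W') \<and> R' 6 = Suc c \<and> R' 7 = hi \<and> path_inv R s R' W'"
      by metis
  next
    fix p s R1 W1
    assume h: "p \<in> set ?ps" "code_of n p < hi" "R1 6 = code_of n p" "R1 7 = hi" "path_inv R s R1 W1"
      "path_ok (code_of n p)"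
    then have "R1 6 < Suc n ^ Suc n" using hib by linarith
    from path_step_hit[OF assms(1) h(5) this _ _ h(3)] loop_paths_simple[OF h(1)] h(3,4,6)
    show "\<exists>R' W'. performs path_step (R1, pos, W1) (if s then [] else Faithful_Path p # fst (cycles_of p)) (R', pos, W') \<and>
        R' 6 = Suc (code_of n p) \<and> R' 7 = hi \<and> path_inv R (s \<or> snd (cycles_of p)) R' W'"
      by metis
  next
    show "filter path_ok [lo..<hi] = map (code_of n) ?ps" by (rule path_codes[OF v])
    show "path_inv R False R W" using assms(2) by (simp add: path_inv_def)
  qed (use assms in auto)
  moreover have "scan_trace (\<lambda>p s. s \<or> snd (cycles_of p)) (\<lambda>p s. if s then [] else Faithful_Path p # fst (cycles_of p))
        False ?ps = fst (faithful_run A B v)"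
    "fold (\<lambda>p s. s \<or> snd (cycles_of p)) ?ps False = snd (faithful_run A B v)"
    using path_scan[where s = False and ps = ?ps] by (simp_all add: faithful_run_def)
  ultimately show ?thesis by (simp only:)
qed


text \<open>Every denominator divides the product of all nonzero entries of \<open>A\<close>, because a
  simple path uses an edge at most once.\<close>

definition entry_product :: nat where
  "entry_product = (\<Prod>(u, u') \<in> {..<n} \<times> {..<n}. max 1 (a_entry u u'))"

lemma entry_product_le: "entry_product \<le> D ^ (n * n)"
proof -
  have "max 1 (a_entry u u') \<le> D" if "u < n" "u' < n" for u u'
    using digit_less[of D X "u * n + u'"] entry_a[OF that] D by simp
  then have "entry_product \<le> (\<Prod>e \<in> {..<n} \<times> {..<n}. D)"
    unfolding entry_product_def by (intro prod_mono) auto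
  then show ?thesis by simp
qed

lemma walk_dvd_entry_product:
  assumes "simple_path A p"
  shows "walk_prod n a_entry (code_of n p) dvd entry_product" "0 < walk_prod n a_entry (code_of n p)"
proof -
  note bd = simple_path_bounds[OF assms]
  have cd: "codable (Suc n) p" "length p \<le> Suc n" using bd codable_iff by auto
  let ?I = "{..<length p - 1}" and ?e = "\<lambda>i. (p ! i, p ! Suc i)"
  have inj: "inj_on ?e ?I" using bd(4) by (auto simp: inj_on_def nth_eq_iff_index_eq)
  have pos: "0 < a_entry (p ! i) (p ! Suc i)" if "i \<in> ?I" for i
  proof -
    have "A $$ (p ! i, p ! Suc i) \<noteq> 0" using assms that by (simp add: simple_path_iff is_path_iff)
    then show ?thesis using a_entry_ne[of "p ! i" "p ! Suc i"] nth_less[OF bd(2)] that by simp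
  qed
  have "(\<Prod>i\<in>?I. a_entry (p ! i) (p ! Suc i)) = (\<Prod>i\<in>?I. case ?e i of (u, u') \<Rightarrow> max 1 (a_entry u u'))"
    using pos by (intro prod.cong) (auto simp: max_def Suc_le_eq)
  also have "\<dots> = (\<Prod>(u, u') \<in> ?e ` ?I. max 1 (a_entry u u'))"
    using prod.reindex[OF inj, of "\<lambda>(u, u'). max 1 (a_entry u u')"] by (simp add: comp_def)
  also have "\<dots> dvd entry_product"
    unfolding entry_product_def using nth_less[OF bd(2)] by (intro prod_dvd_prod_subset) auto
  finally show "walk_prod n a_entry (code_of n p) dvd entry_product"
    unfolding walk_prod_code_of[OF cd] .
  show "0 < walk_prod n a_entry (code_of n p)"
    unfolding walk_prod_code_of[OF cd] using pos by (intro prod_pos) auto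
qed

definition reduced :: "path \<Rightarrow> nat" where
  "reduced p = walk_prod n a_entry (code_of n p) div
     gcd (walk_prod n a_entry (code_of n p)) (walk_prod n b_entry (code_of n p))"

text \<open>The invariant \<open>N dvd entry_product\<close> bounds \<open>N\<close> by \<open>D ^ (n * n)\<close> throughout the loop.\<close>

lemma lcm_reduced:
  assumes "simple_path A p" "N dvd entry_product" "0 < N"
  shows "lcm N (reduced p) dvd entry_product" "0 < lcm N (reduced p)" "lcm N (reduced p) \<le> D ^ (n * n)"
proof -
  let ?a = "walk_prod n a_entry (code_of n p)" and ?b = "walk_prod n b_entry (code_of n p)"
  have a: "?a dvd entry_product" "0 < ?a" using walk_dvd_entry_product[OF assms(1)] .
  have "gcd ?a ?b * reduced p = ?a" unfolding reduced_def by (rule dvd_mult_div_cancel) simp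
  then have r: "reduced p dvd ?a" "reduced p \<noteq> 0" using a(2) by (metis dvd_triv_right, metis mult_0_right less_irrefl)
  then show d: "lcm N (reduced p) dvd entry_product" using a(1) assms(2) by (meson dvd_trans lcm_least)
  show "0 < lcm N (reduced p)" using r assms(3) by (simp add: lcm_pos_nat)
  have "0 < entry_product" unfolding entry_product_def by (intro prod_pos) auto
  then show "lcm N (reduced p) \<le> D ^ (n * n)"
    using d entry_product_le by (meson dvd_imp_le le_trans)
qed

abbreviation order_frame :: "nat set" where "order_frame \<equiv> {0, 6, 11, 13, 14, 15}"

definition order_inv :: "(nat \<Rightarrow> nat) \<Rightarrow> nat \<Rightarrow> (nat \<Rightarrow> nat) \<Rightarrow> (nat \<Rightarrow> nat list) \<Rightarrow> bool" where
  "order_inv R0 N R W \<longleftrightarrow> frame order_frame R0 R \<and> R 0 = N \<and> 0 < N \<and> N dvd entry_product"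

lemma order_inv_globals: "globals R0 \<Longrightarrow> order_inv R0 s R W \<Longrightarrow> globals R"
  using frame_globals by (auto simp: order_inv_def)

lemma order_step_miss:
  assumes "globals R0" "order_inv R0 N R W" "R 6 < Suc n ^ Suc n" "\<not> path_ok (R 6)"
  shows "\<exists>R' W'. performs order_step (R, pos, W) [] (R', pos, W') \<and> R' 6 = Suc (R 6) \<and> R' 7 = R 7 \<and>
    order_inv R0 N R' W'"
proof -
  have g: "globals R" using assms(1,2) by (rule order_inv_globals)
  let ?R1 = "R(11 := 0)"
  have 1: "performs (assign 11 (Call path_ok_exp [Var 1, Var 2, Var 3, Var 6])) (R, pos, W) [] (?R1, pos, W)"
    using performs_path_ok[OF g assms(3)] assms(4) by simp
  have 2: "performs (If (Eq 11 5) Skip c) (?R1, pos, W) [] (?R1, pos, W)" for c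
    using g by (intro performs_If_True performs_Skip) (auto simp: globals_def)
  have 3: "performs (assign 6 (ESuc (Var 6))) (?R1, pos, W) [] (?R1(6 := Suc (R 6)), pos, W)"
    using performs_increment[of 6 ?R1 pos W] assms(3) by simp
  have "performs order_step (R, pos, W) [] (?R1(6 := Suc (R 6)), pos, W)"
    unfolding order_step_def by (rule performs_Seq_silent[OF 1 performs_Seq_silent[OF 2 3]])
  then show ?thesis
    using assms(2) by (intro exI[of _ "?R1(6 := Suc (R 6))"] exI[of _ W]) (auto simp: order_inv_def frame_upd)
qed

lemma order_step_hit:
  assumes "globals R0" "order_inv R0 N R W" "R 6 < Suc n ^ Suc n" "path_ok (R 6)"
    and p: "simple_path A p" "R 6 = code_of n p"
  shows "\<exists>R' W'. performs order_step (R, pos, W) [Order_Path p (int N)] (R', pos, W') \<and>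
    R' 6 = Suc (R 6) \<and> R' 7 = R 7 \<and> order_inv R0 (lcm N (reduced p)) R' W'"
proof -
  have g: "globals R" using assms(1,2) by (rule order_inv_globals)
  note bd = simple_path_bounds[OF p(1)]
  have cd: "codable (Suc n) p" "length p \<le> Suc n" using bd codable_iff by auto
  have N: "R 0 = N" "0 < N" "N dvd entry_product" using assms(2) by (auto simp: order_inv_def)
  let ?a = "walk_prod n a_entry (R 6)" and ?b = "walk_prod n b_entry (R 6)"
  have red: "reduced p = ?a div gcd ?a ?b" using p(2) by (simp add: reduced_def)
  have ab: "0 < ?a" "0 < ?b"
    using walk_dvd_entry_product(2)[OF p(1)] p(2) assms(4) by (auto simp: path_ok_def)
  have lc: "lcm N (?a div gcd ?a ?b) \<le> D ^ (n * n)" using lcm_reduced(3)[OF p(1) N(3,2)] red by simp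
  have "?b \<le> D ^ n" using walk_le[OF assms(3), of "n * n"] walk_b[OF assms(3)] by simp
  then have "lcm N (?a div gcd ?a ?b) * ?b \<le> D ^ (n * n) * D ^ n" using lc by (intro mult_le_mono)
  also have "\<dots> = D ^ (n * n + n)" by (simp add: power_add)
  also have "\<dots> < 2 ^ L" by (rule D_pow_less) simp
  \<comment> \<open>The largest number that the search computes is a candidate multiplied by \<open>B\<^sub>p\<close>.\<close>
  finally have cap: "lcm N (?a div gcd ?a ?b) * ?b < 2 ^ L" .
  let ?R1 = "R(11 := 1)"
  have 1: "performs (assign 11 (Call path_ok_exp [Var 1, Var 2, Var 3, Var 6])) (R, pos, W) [] (?R1, pos, W)"
    using performs_path_ok[OF g assms(3)] assms(4) by simp
  let ?W2 = "W(1 := rev (enc_path p))"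
  obtain R2 where R2: "performs (emit 1 6) (?R1, pos, W) [] (R2, pos, ?W2)"
    "\<forall>r<nvars. r \<notin> {13, 14, 15} \<longrightarrow> R2 r = ?R1 r"
    using performs_emit[of 1 6 p ?R1 pos W] cd g p(2) by (auto simp: globals_def)
  have g2: "globals R2" "R2 6 = R 6" "R2 7 = R 7" "R2 0 = N"
    using R2(2) g N by (auto simp: globals_def)
  have 2: "performs (Mark At_Order_Path) (R2, pos, ?W2) [Order_Path p (int N)] (R2, pos, ?W2)"
    using g2(4) by (intro performs_Mark) auto
  define R3 where "R3 = R2(0 := lcm N (reduced p))"
  have lt: "R2 6 < Suc n ^ Suc n" using assms(3) g2(2) by simp
  note we = walk_exps[OF g2(1) _ lt, simplified]
  have 3: "performs (assign 0 (Call lcm_exp [Var 0, walk_a_exp 6, walk_b_exp 6])) (R2, pos, ?W2) [] (R3, pos, ?W2)"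
    unfolding R3_def
    using we g2(2,4) below_lcm[OF N(2) ab cap] lcm_search_eq[OF N(2) ab] red
    by (intro performs_assign) auto
  let ?c = "emit 1 6 ;; Mark At_Order_Path ;; assign 0 (Call lcm_exp [Var 0, walk_a_exp 6, walk_b_exp 6])"
  have 4: "performs ?c (?R1, pos, W) [Order_Path p (int N)] (R3, pos, ?W2)"
    using performs_Seq_silent[OF R2(1) performs_Seq[OF 2 3]] by simp
  have 5: "performs (If (Eq 11 5) Skip ?c) (?R1, pos, W) [Order_Path p (int N)] (R3, pos, ?W2)"
    by (rule performs_If_False[OF _ _ 4]) (use g in \<open>auto simp: globals_def\<close>)
  have 6: "performs (assign 6 (ESuc (Var 6))) (R3, pos, ?W2) [] (R3(6 := Suc (R 6)), pos, ?W2)"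
    using performs_increment[of 6 R3 pos ?W2] assms(3) g2 by (simp add: R3_def)
  have run: "performs order_step (R, pos, W) [Order_Path p (int N)] (R3(6 := Suc (R 6)), pos, ?W2)"
    unfolding order_step_def using performs_Seq_silent[OF 1 performs_Seq[OF 5 6]] by simp
  have "frame order_frame R0 R3"
    using assms(2) R2(2) by (auto simp: order_inv_def frame_def R3_def)
  then have "order_inv R0 (lcm N (reduced p)) (R3(6 := Suc (R 6))) ?W2"
    using lcm_reduced[OF p(1) N(3,2)] by (auto simp: order_inv_def frame_upd R3_def)
  then show ?thesis
    using run g2 by (intro exI[of _ "R3(6 := Suc (R 6))"] exI[of _ ?W2]) (auto simp: R3_def)
qed

lemma int_lcm_reduced:
  assumes "simple_path A p"
  shows "int (lcm N (reduced p)) =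
    lcm (int N) (path_prod A p div gcd (path_prod A p) \<bar>path_prod B p\<bar>)"
proof -
  note bd = simple_path_bounds[OF assms]
  have cd: "codable (Suc n) p" "length p \<le> Suc n" using bd codable_iff by auto
  have "path_prod A p = int (walk_prod n a_entry (code_of n p))"
    unfolding walk_prod_code_of[OF cd] by (rule path_prod_a[OF bd(2), symmetric])
  moreover have "\<bar>path_prod B p\<bar> = int (walk_prod n b_entry (code_of n p))"
    unfolding walk_prod_code_of[OF cd] by (rule path_prod_b[symmetric])
  ultimately show ?thesis
    by (simp only: reduced_def gcd_int_int_eq lcm_int_int_eq zdiv_int[symmetric])
qed

lemma order_scan:
  assumes "\<forall>p \<in> set ps. simple_path A p"
  shows "scan_trace (\<lambda>p N. lcm N (reduced p)) (\<lambda>p N. [Order_Path p (int N)]) N ps = fst (order_loop A B (int N) ps)"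
    and "int (fold (\<lambda>p N. lcm N (reduced p)) ps N) = snd (order_loop A B (int N) ps)"
  using assms
  by (induction ps arbitrary: N) (simp_all add: int_lcm_reduced Let_def case_prod_beta)

lemma performs_order_loop:
  assumes "globals R" "R 0 = 1" "R 6 = lo" "R 7 = hi"
  shows "\<exists>R' W'. performs (Until (Eq 6 7) order_step) (R, pos, W) (fst (order_loop A B 1 (loop_paths A B v))) (R', pos, W') \<and>
    int (R' 0) = snd (order_loop A B 1 (loop_paths A B v))"
proof -
  let ?ps = "loop_paths A B v"
  have hib: "hi \<le> Suc n ^ Suc n" using interval_bound[OF v] .
  have "\<exists>R' W'. performs (Until (Eq 6 7) order_step) (R, pos, W)
      (scan_trace (\<lambda>p N. lcm N (reduced p)) (\<lambda>p N. [Order_Path p (int N)]) 1 ?ps) (R', pos, W') \<and>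
    order_inv R (fold (\<lambda>p N. lcm N (reduced p)) ?ps 1) R' W'"
  proof (rule performs_scan[where P = path_ok and g = "code_of n" and hi = hi and c = lo])
    fix c s R1 W1
    assume h: "c < hi" "R1 6 = c" "R1 7 = hi" "order_inv R s R1 W1" "\<not> path_ok c"
    then have "R1 6 < Suc n ^ Suc n" using hib by linarith
    from order_step_miss[OF assms(1) h(4) this] h(2,3,5)
    show "\<exists>R' W'. performs order_step (R1, pos, W1) [] (R', pos, W') \<and> R' 6 = Suc c \<and> R' 7 = hi \<and> order_inv R s R' W'"
      by metis
  next
    fix p N R1 W1
    assume h: "p \<in> set ?ps" "code_of n p < hi" "R1 6 = code_of n p" "R1 7 = hi" "order_inv R N R1 W1"
      "path_ok (code_of n p)"
    then have "R1 6 < Suc n ^ Suc n" using hib by linarith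
    from order_step_hit[OF assms(1) h(5) this _ _ h(3)] loop_paths_simple[OF h(1)] h(3,4,6)
    show "\<exists>R' W'. performs order_step (R1, pos, W1) [Order_Path p (int N)] (R', pos, W') \<and>
        R' 6 = Suc (code_of n p) \<and> R' 7 = hi \<and> order_inv R (lcm N (reduced p)) R' W'"
      by metis
  next
    show "filter path_ok [lo..<hi] = map (code_of n) ?ps" by (rule path_codes[OF v])
    show "order_inv R 1 R W" using assms(2) by (simp add: order_inv_def)
  qed (use assms in auto)
  moreover have "\<forall>p \<in> set ?ps. simple_path A p" using loop_paths_simple by blast
  ultimately show ?thesis
    using order_scan[of ?ps 1] by (auto simp: order_inv_def)
qed

lemma performs_start_range:
  assumes "globals R"
  shows "performs start_range (R, pos, W) [] (R(6 := lo, 7 := hi), pos, W)"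
proof -
  have 1: "performs (assign 6 (bound_exp (ESuc (Var 4)))) (R, pos, W) [] (R(6 := lo), pos, W)"
    using performs_bound[of 6 R "ESuc (Var 4)" pos W] assms v small by (simp add: globals_def)
  have 2: "performs (assign 7 (bound_exp (ESuc (ESuc (Var 4))))) (R(6 := lo), pos, W) [] (R(6 := lo, 7 := hi), pos, W)"
    using performs_bound[of 7 "R(6 := lo)" "ESuc (ESuc (Var 4))" pos W] assms v small by (simp add: globals_def)
  show ?thesis unfolding start_range_def by (rule performs_Seq_silent[OF 1 2])
qed

lemma performs_order_com:
  assumes "globals R" "R 10 = 0"
  shows "\<exists>sns R' W'. performs order_com (R, pos, W) sns (R', pos, W') \<and>
    order_trace A B v = sns @ [Order_Return (int (R' 0))] \<and> order_value A B v = int (R' 0)"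
proof -
  \<comment> \<open>The first loop is \<open>Faithful\<close>; it leaves its answer in register \<open>10\<close>, which selects between \<open>0\<close> and the second loop.\<close>
  let ?R1 = "R(6 := lo, 7 := hi)"
  have g1: "globals ?R1" using assms(1) by (simp add: globals_def)
  note 1 = performs_start_range[OF assms(1), of pos W]
  obtain R2 W2 where R2: "performs (Until (Eq 6 7) path_step) (?R1, pos, W) (fst (faithful_run A B v)) (R2, pos, W2)"
    "path_inv ?R1 (snd (faithful_run A B v)) R2 W2"
    using performs_path_loop[OF g1, of pos W] assms(2) by auto
  have g2: "globals R2" using path_inv_globals[OF g1 R2(2)] .
  let ?c = "assign 0 EOne ;; start_range ;; Until (Eq 6 7) order_step"
  show ?thesis
  proof (cases "snd (faithful_run A B v)")
    case True
    have 3: "performs (assign 0 EZero) (R2, pos, W2) [] (R2(0 := 0), pos, W2)" by (intro performs_assign) auto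
    have 4: "performs (If (Eq 10 5) ?c (assign 0 EZero)) (R2, pos, W2) [] (R2(0 := 0), pos, W2)"
      by (rule performs_If_False[OF _ _ 3]) (use R2(2) g2 True in \<open>auto simp: path_inv_def globals_def\<close>)
    have "performs order_com (R, pos, W) (fst (faithful_run A B v)) (R2(0 := 0), pos, W2)"
      unfolding order_com_def using performs_Seq_silent[OF 1 performs_Seq[OF R2(1) 4]] by simp
    then show ?thesis
      using True
      by (intro exI[of _ "fst (faithful_run A B v)"] exI[of _ "R2(0 := 0)"] exI[of _ W2])
        (simp add: order_trace_def order_value_def order_run_def case_prod_beta)
  next
    case False
    have 3: "performs (assign 0 EOne) (R2, pos, W2) [] (R2(0 := 1), pos, W2)" using small by (intro performs_assign) auto
    let ?R4 = "(R2(0 := 1))(6 := lo, 7 := hi)"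
    have g3: "globals (R2(0 := 1))" using g2 by (simp add: globals_def)
    note 4 = performs_start_range[OF g3, of pos W2]
    have g4: "globals ?R4" using g2 by (simp add: globals_def)
    obtain R5 W5 where R5: "performs (Until (Eq 6 7) order_step) (?R4, pos, W2)
        (fst (order_loop A B 1 (loop_paths A B v))) (R5, pos, W5)"
      "int (R5 0) = snd (order_loop A B 1 (loop_paths A B v))"
      using performs_order_loop[OF g4, of pos W2] by auto
    have 5: "performs ?c (R2, pos, W2) (fst (order_loop A B 1 (loop_paths A B v))) (R5, pos, W5)"
      by (rule performs_Seq_silent[OF 3 performs_Seq_silent[OF 4 R5(1)]])
    have 6: "performs (If (Eq 10 5) ?c (assign 0 EZero)) (R2, pos, W2)
        (fst (order_loop A B 1 (loop_paths A B v))) (R5, pos, W5)"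
      by (rule performs_If_True[OF _ _ 5]) (use R2(2) g2 False in \<open>auto simp: path_inv_def globals_def\<close>)
    have "performs order_com (R, pos, W)
        (fst (faithful_run A B v) @ fst (order_loop A B 1 (loop_paths A B v))) (R5, pos, W5)"
      unfolding order_com_def using performs_Seq_silent[OF 1 performs_Seq[OF R2(1) 6]] by simp
    then show ?thesis
      using False R5(2)
      by (intro exI[of _ "fst (faithful_run A B v) @ fst (order_loop A B 1 (loop_paths A B v))"]
          exI[of _ R5] exI[of _ W5])
        (simp add: order_trace_def order_value_def order_run_def case_prod_beta)
  qed
qed

end

section \<open>Reading the input\<close>

text \<open>The input is read twice. The first pass doubles register \<open>2\<close> for every symbol to obtain the base \<open>D\<close>,
  and the head returns to the first symbol.\<close>

definition "measure_com =
  assign 2 EOne ;; Until (In 0) (assign 2 (Call add_exp [Var 2, Var 2]) ;; Next) ;;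
  Prev ;; Until (In 0) Prev ;; Next"

text \<open>Signs and the marks at the end of a matrix are skipped: the dimension is known from the rows, and
  entries are recorded by their absolute values.\<close>

definition "symbol_com =
  If (In 1) (assign 4 (Call add_exp [Var 4, Var 4]))
  (If (In 2) (assign 4 (ESuc (Call add_exp [Var 4, Var 4])))
  (If (In 4) (assign 3 (Call add_exp [Var 3, Call mul_exp [Var 4, Var 16]]) ;;
              assign 16 (Call mul_exp [Var 16, Var 2]) ;; assign 4 EZero)
  (If (In 5) (assign 1 (ESuc (Var 1))) Skip)))"

text \<open>The end of a row is marked once for each row of both matrices, so the count of these marks is
  \<open>2 * n\<close>. The register of the current number is reset by the end marker of an entry; the vertex \<open>v\<close>
  has no end marker, so it remains there after the last symbol.\<close>

definition "parse_com =
  measure_com ;; assign 16 EOne ;; Until (In 0) (symbol_com ;; Next) ;;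
  assign 1 (Call div_exp [Var 1, ESuc EOne])"

lemma parse_com_wf: "com_wf parse_com"
  by (simp add: parse_com_def measure_com_def symbol_com_def cond_wf_def)

lemma parse_com_marks: "mark_count pt parse_com = 0"
  by (simp add: parse_com_def measure_com_def symbol_com_def)

type_synonym scan_state = "nat \<times> nat \<times> nat \<times> nat"

text \<open>The components are the number of rows so far, the digits collected in base \<open>D\<close>, the number being
  read, and the power of \<open>D\<close> for the next digit.\<close>

fun scan_symbol :: "nat \<Rightarrow> scan_state \<Rightarrow> nat \<Rightarrow> scan_state" where
  "scan_symbol D (n, X, v, q) s =
    (if s = 1 then (n, X, v + v, q)
     else if s = 2 then (n, X, Suc (v + v), q)
     else if s = 4 then (n, X + v * q, 0, q * D)
     else if s = 5 then (Suc n, X, v, q)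
     else (n, X, v, q))"

definition scan_regs :: "nat \<Rightarrow> scan_state \<Rightarrow> nat \<Rightarrow> nat" where
  "scan_regs D st = (case st of (n, X, v, q) \<Rightarrow> (\<lambda>_. 0)(1 := n, 2 := D, 3 := X, 4 := v, 16 := q))"

text \<open>After \<open>j\<close> symbols the current number is below \<open>2 ^ j\<close>, hence a digit in base \<open>D\<close>; this bounds every
  intermediate value of the second pass for arbitrary input words.\<close>

lemma scan_invariant:
  assumes "foldl (scan_symbol D) (0, 0, 0, 1) u = (n, X, v, q)" "2 ^ length u \<le> D"
  shows "n \<le> length u \<and> v < 2 ^ length u \<and> X < q \<and> (\<exists>c \<le> length u. q = D ^ c)"
  using assms
proof (induction u arbitrary: n X v q rule: rev_induct)
  case Nil
  then show ?case by auto
next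
  case (snoc s u)
  obtain n' X' v' q' where st: "foldl (scan_symbol D) (0, 0, 0, 1) u = (n', X', v', q')"
    by (metis prod_cases4)
  have "0 < (2::nat) ^ length u" "2 * 2 ^ length u \<le> D" using snoc.prems(2) by auto
  then have D: "2 ^ length u \<le> D" "0 < D" by linarith+
  then have ih: "n' \<le> length u" "v' < 2 ^ length u" "X' < q'" "\<exists>c \<le> length u. q' = D ^ c"
    using snoc.IH[OF st] by auto
  then obtain c where c: "c \<le> length u" "q' = D ^ c" by blast
  have new: "(n, X, v, q) = scan_symbol D (n', X', v', q') s" using snoc.prems(1) st by simp
  have "X' + v' * q' < q' * D"
  proof -
    have "Suc v' \<le> D" using ih(2) D(1) by linarith
    then have "Suc v' * q' \<le> D * q'" by (rule mult_right_mono) simp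
    then show ?thesis using ih(3) by (simp add: mult.commute)
  qed
  moreover have "\<exists>c \<le> Suc (length u). q' * D = D ^ c" using c by (intro exI[of _ "Suc c"]) auto
  moreover have "\<exists>c \<le> Suc (length u). q' = D ^ c" using c by (intro exI[of _ c]) auto
  ultimately show ?case using new ih D by (auto split: if_splits)
qed

context visible_machine
begin

lemma word_at_nth: "i < length w \<Longrightarrow> word_at 0 w (int i) = w ! i"
  by (simp add: word_at_def)

lemma word_at_end: "word_at 0 w (int (length w)) = 0" "word_at 0 w (- 1) = 0"
  by (simp_all add: word_at_def)

lemma performs_measure:
  assumes nb: "0 \<notin> set w" and len: "length w < L"
  shows "performs measure_com (\<lambda>_. 0, 0, W) [] ((\<lambda>_. 0)(2 := 2 ^ length w), 0, W)"
proof -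
  let ?R = "\<lambda>i. (\<lambda>_ :: nat. 0 :: nat)(2 := (2 :: nat) ^ i)"
  have sym: "w ! i \<noteq> 0" if "i < length w" for i using nth_nonblank[OF nb that] by simp
  have fits: "(2::nat) ^ i < 2 ^ L" if "i \<le> length w" for i using that len by simp
  have one: "1 < (2 :: nat) ^ L" using fits[of 0] by simp
  have 1: "performs (assign 2 EOne) (\<lambda>_. 0, 0, W) [] (?R 0, 0, W)"
    using one by (intro performs_assign) auto
  have forward: "performs (Until (In 0) (assign 2 (Call add_exp [Var 2, Var 2]) ;; Next)) (?R i, int i, W) []
      (?R (length w), int (length w), W)" if "i \<le> length w" for i
    using that
  proof (induction "length w - i" arbitrary: i)
    case 0
    then have i: "i = length w" by simp
    show ?case unfolding i by (rule performs_Until_True) (simp_all add: word_at_end)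
  next
    case (Suc d)
    then have i: "i < length w" by simp
    have "performs (assign 2 (Call add_exp [Var 2, Var 2])) (?R i, int i, W) [] ((?R i)(2 := 2 ^ Suc i), int i, W)"
      using fits[of "Suc i"] i by (intro performs_assign) (auto intro!: below_add)
    moreover have "(?R i)(2 := 2 ^ Suc i) = ?R (Suc i)" by simp
    ultimately have a: "performs (assign 2 (Call add_exp [Var 2, Var 2])) (?R i, int i, W) [] (?R (Suc i), int i, W)"
      by (simp only:)
    have b: "performs Next (?R (Suc i), int i, W) [] (?R (Suc i), int (Suc i), W)"
      using performs_Next[of "int i" "?R (Suc i)" W] i by (simp add: add.commute)
    have c: "performs (Until (In 0) (assign 2 (Call add_exp [Var 2, Var 2]) ;; Next)) (?R (Suc i), int (Suc i), W) []
      (?R (length w), int (length w), W)" by (rule Suc.hyps(1)) (use Suc.hyps(2) i in auto)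
    have "\<not> holds w (?R i, int i, W) (In 0)" using sym[OF i] i by (simp add: word_at_nth)
    from performs_Until_False[OF this _ performs_Seq_silent[OF a b] c] show ?case by simp
  qed
  define F where "F = ?R (length w)"
  have 2: "performs Prev (F, int (length w), W) [] (F, int (length w) - 1, W)" by (rule performs_Prev) simp
  have rewind: "performs (Until (In 0) Prev) (F, int i - 1, W) [] (F, - 1, W)" if "i \<le> length w" for i
    using that
  proof (induction i)
    case 0
    have e: "int 0 - 1 = - 1" by simp
    show ?case unfolding e by (rule performs_Until_True) (simp_all add: word_at_end)
  next
    case (Suc i)
    have "\<not> holds w (F, int (Suc i) - 1, W) (In 0)" using sym[of i] Suc.prems by (simp add: word_at_nth)
    moreover have "performs Prev (F, int (Suc i) - 1, W) [] (F, int i - 1, W)"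
      using performs_Prev[of "int i" F W] by simp
    moreover have "performs (Until (In 0) Prev) (F, int i - 1, W) [] (F, - 1, W)" using Suc by simp
    ultimately show ?case using performs_Until_False[of "(F, int (Suc i) - 1, W)" "In 0" Prev "[]"] by fastforce
  qed
  have 3: "performs (Until (In 0) Prev) (F, int (length w) - 1, W) [] (F, - 1, W)" using rewind by blast
  have 4: "performs Next (F, - 1, W) [] (F, 0, W)" using performs_Next[of "- 1" F W] by simp
  have f0: "performs (Until (In 0) (assign 2 (Call add_exp [Var 2, Var 2]) ;; Next)) (?R 0, 0, W) []
      (F, int (length w), W)" using forward[of 0] by (simp add: F_def)
  have "performs measure_com (\<lambda>_. 0, 0, W) [] (F, 0, W)"
    unfolding measure_com_def
    by (rule performs_Seq_silent[OF 1 performs_Seq_silent[OF f0 performs_Seq_silent[OF 2 performs_Seq_silent[OF 3 4]]]])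
  then show ?thesis by (simp only: F_def)
qed

lemma performs_symbol:
  assumes st: "foldl (scan_symbol D) (0, 0, 0, 1) (take i w) = st" and i: "i < length w"
    and D: "D = 2 ^ length w" "D ^ length w < 2 ^ L" and len: "length w < L"
  shows "performs symbol_com (scan_regs D st, int i, W) [] (scan_regs D (scan_symbol D st (w ! i)), int i, W)"
proof -
  obtain n X v q where eq: "st = (n, X, v, q)" by (metis prod_cases4)
  let ?R = "scan_regs D st"
  have ti: "length (take i w) = i" using i by simp
  have "(2::nat) ^ i \<le> D" unfolding D(1) using i by (intro power_increasing) auto
  then have inv: "n \<le> i" "v < 2 ^ i" "X < q" "\<exists>c \<le> i. q = D ^ c"
    using scan_invariant[of D "take i w" n X v q] st eq ti by auto
  then obtain c where c: "c \<le> i" "q = D ^ c" by blast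
  have D0: "0 < D" "D \<le> 2 ^ L" using D(1) len by auto
  have "Suc (v + v) < 2 ^ Suc i" using inv(2) by simp
  also have "(2::nat) ^ Suc i \<le> 2 ^ L" using i len by (intro power_increasing) auto
  finally have v2: "Suc (v + v) < 2 ^ L" .
  have "D ^ Suc c \<le> D ^ length w" using c(1) i D0(1) by (intro power_increasing) auto
  then have qD: "q * D < 2 ^ L" using D(2) c(2) by (simp add: mult.commute)
  have "Suc v \<le> D" using inv(2) \<open>2 ^ i \<le> D\<close> by linarith
  then have "Suc v * q \<le> D * q" by (rule mult_right_mono) simp
  then have Xq: "X + v * q < 2 ^ L" "v * q < 2 ^ L" using inv(3) qD by (simp_all add: mult.commute)
  have "Suc n \<le> length w" using inv(1) i by simp
  also have "\<dots> < 2 ^ L" using less_exp[of L] len by linarith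
  finally have n1: "Suc n < 2 ^ L" .
  have R: "?R 1 = n" "?R 2 = D" "?R 3 = X" "?R 4 = v" "?R 16 = q" "?R (Suc 0) = n" "?R (Suc (Suc 0)) = D"
    by (auto simp: scan_regs_def eq)
  have sym: "holds w (R, int i, W) (In a) \<longleftrightarrow> w ! i = a" for R a using i by (simp add: word_at_nth)
  consider "w ! i = 1" | "w ! i = 2" | "w ! i = 4" | "w ! i = 5" | "w ! i \<notin> {1, 2, 4, 5}" by blast
  then show ?thesis
  proof cases
    case 1
    have "performs (assign 4 (Call add_exp [Var 4, Var 4])) (?R, int i, W) [] (?R(4 := v + v), int i, W)"
      using R v2 by (intro performs_assign) (auto intro!: below_add)
    note asg = this
    have "?R(4 := v + v) = scan_regs D (scan_symbol D st (w ! i))"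
      using 1 by (auto simp: scan_regs_def eq fun_eq_iff)
    note prev = asg[unfolded this]
    show ?thesis unfolding symbol_com_def by (rule performs_If_True[OF _ _ prev]) (use 1 sym in auto)
  next
    case 2
    have "performs (assign 4 (ESuc (Call add_exp [Var 4, Var 4]))) (?R, int i, W) [] (?R(4 := Suc (v + v)), int i, W)"
      using R v2 by (intro performs_assign) (auto intro!: below_add)
    note asg = this
    have "?R(4 := Suc (v + v)) = scan_regs D (scan_symbol D st (w ! i))"
      using 2 by (auto simp: scan_regs_def eq fun_eq_iff)
    note prev = asg[unfolded this]
    have "performs (If (In 2) (assign 4 (ESuc (Call add_exp [Var 4, Var 4]))) d) (?R, int i, W) []
        (scan_regs D (scan_symbol D st (w ! i)), int i, W)" for d
      by (rule performs_If_True[OF _ _ prev]) (use 2 sym in auto)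
    note prev = this
    show ?thesis unfolding symbol_com_def by (rule performs_If_False[OF _ _ prev]) (use 2 sym in auto)
  next
    case 3
    let ?R1 = "?R(3 := X + v * q)" and ?R2 = "?R(3 := X + v * q, 16 := q * D)"
    have a: "performs (assign 3 (Call add_exp [Var 3, Call mul_exp [Var 4, Var 16]])) (?R, int i, W) [] (?R1, int i, W)"
      using R Xq by (intro performs_assign) (auto intro!: below_add below_mul)
    have b: "performs (assign 16 (Call mul_exp [Var 16, Var 2])) (?R1, int i, W) [] (?R2, int i, W)"
      using R qD by (intro performs_assign) (auto intro!: below_mul)
    have c: "performs (assign 4 EZero) (?R2, int i, W) [] (?R2(4 := 0), int i, W)"
      by (intro performs_assign) auto
    have "?R2(4 := 0) = scan_regs D (scan_symbol D st (w ! i))"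
      using 3 by (auto simp: scan_regs_def eq fun_eq_iff)
    then have "performs (assign 3 (Call add_exp [Var 3, Call mul_exp [Var 4, Var 16]]) ;;
        assign 16 (Call mul_exp [Var 16, Var 2]) ;; assign 4 EZero) (?R, int i, W) []
        (scan_regs D (scan_symbol D st (w ! i)), int i, W)"
      using performs_Seq_silent[OF a performs_Seq_silent[OF b c]] by (simp only:)
    note prev = this
    have "performs (If (In 4) (assign 3 (Call add_exp [Var 3, Call mul_exp [Var 4, Var 16]]) ;;
        assign 16 (Call mul_exp [Var 16, Var 2]) ;; assign 4 EZero) d) (?R, int i, W) []
        (scan_regs D (scan_symbol D st (w ! i)), int i, W)" for d
      by (rule performs_If_True[OF _ _ prev]) (use 3 sym in auto)
    note prev = this
    have "performs (If (In 2) d' (If (In 4) (assign 3 (Call add_exp [Var 3, Call mul_exp [Var 4, Var 16]]) ;;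
        assign 16 (Call mul_exp [Var 16, Var 2]) ;; assign 4 EZero) d)) (?R, int i, W) []
        (scan_regs D (scan_symbol D st (w ! i)), int i, W)" for d d'
      by (rule performs_If_False[OF _ _ prev]) (use 3 sym in auto)
    note prev = this
    show ?thesis unfolding symbol_com_def by (rule performs_If_False[OF _ _ prev]) (use 3 sym in auto)
  next
    case 4
    have "performs (assign 1 (ESuc (Var 1))) (?R, int i, W) [] (?R(1 := Suc n), int i, W)"
      using R n1 by (intro performs_assign) auto
    note asg = this
    have "?R(1 := Suc n) = scan_regs D (scan_symbol D st (w ! i))"
      using 4 by (auto simp: scan_regs_def eq fun_eq_iff)
    note prev = asg[unfolded this]
    have "performs (If (In 5) (assign 1 (ESuc (Var 1))) d) (?R, int i, W) []
        (scan_regs D (scan_symbol D st (w ! i)), int i, W)" for d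
      by (rule performs_If_True[OF _ _ prev]) (use 4 sym in auto)
    note prev = this
    have "performs (If (In 4) d' (If (In 5) (assign 1 (ESuc (Var 1))) d)) (?R, int i, W) []
        (scan_regs D (scan_symbol D st (w ! i)), int i, W)" for d d'
      by (rule performs_If_False[OF _ _ prev]) (use 4 sym in auto)
    note prev = this
    have "performs (If (In 2) d'' (If (In 4) d' (If (In 5) (assign 1 (ESuc (Var 1))) d))) (?R, int i, W) []
        (scan_regs D (scan_symbol D st (w ! i)), int i, W)" for d d' d''
      by (rule performs_If_False[OF _ _ prev]) (use 4 sym in auto)
    note prev = this
    show ?thesis unfolding symbol_com_def by (rule performs_If_False[OF _ _ prev]) (use 4 sym in auto)
  next
    case 5
    have "scan_regs D (scan_symbol D st (w ! i)) = ?R" using 5 by (simp add: eq)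
    then show ?thesis
      unfolding symbol_com_def using 5 sym
      by (simp only:) (rule performs_If_False performs_Skip | simp add: word_at_nth[OF i] del: word_at_nth)+
  qed
qed

lemma performs_parse:
  assumes nb: "0 \<notin> set w" and ne: "w \<noteq> []" and D: "D = 2 ^ length w" "D ^ length w < 2 ^ L"
    and len: "length w < L" and fin: "foldl (scan_symbol D) (0, 0, 0, 1) w = (2 * n, X, v, q)"
  shows "performs parse_com (\<lambda>_. 0, 0, W) [] (scan_regs D (n, X, v, q), int (length w), W)"
proof -
  let ?st = "\<lambda>i. foldl (scan_symbol D) (0, 0, 0, 1) (take i w)"
  have one: "1 < (2 :: nat) ^ L" using len by (intro one_less_power) auto
  have "performs (assign 16 EOne) ((\<lambda>_. 0)(2 := 2 ^ length w), 0, W) [] ((\<lambda>_. 0)(2 := 2 ^ length w, 16 := 1), 0, W)"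
    using one by (intro performs_assign) auto
  moreover have "(\<lambda>_. 0)(2 := 2 ^ length w, 16 := 1) = scan_regs D (?st 0)"
    by (auto simp: scan_regs_def D(1) fun_eq_iff)
  ultimately have s2: "performs (assign 16 EOne) ((\<lambda>_. 0)(2 := 2 ^ length w), 0, W) [] (scan_regs D (?st 0), int 0, W)"
    by simp
  have loop: "performs (Until (In 0) (symbol_com ;; Next)) (scan_regs D (?st i), int i, W) []
      (scan_regs D (?st (length w)), int (length w), W)" if "i \<le> length w" for i
    using that
  proof (induction "length w - i" arbitrary: i)
    case 0
    then have i: "i = length w" by simp
    show ?case unfolding i by (rule performs_Until_True) (simp_all add: word_at_end)
  next
    case (Suc d)
    then have i: "i < length w" by simp
    have st: "scan_symbol D (?st i) (w ! i) = ?st (Suc i)" using i by (simp add: take_Suc_conv_app_nth)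
    have a: "performs symbol_com (scan_regs D (?st i), int i, W) [] (scan_regs D (?st (Suc i)), int i, W)"
      using performs_symbol[OF refl i D len, of W] unfolding st .
    have b: "performs Next (scan_regs D (?st (Suc i)), int i, W) [] (scan_regs D (?st (Suc i)), int (Suc i), W)"
      using performs_Next[of "int i" "scan_regs D (?st (Suc i))" W] i by (simp add: add.commute)
    have c: "performs (Until (In 0) (symbol_com ;; Next)) (scan_regs D (?st (Suc i)), int (Suc i), W) []
      (scan_regs D (?st (length w)), int (length w), W)" by (rule Suc.hyps(1)) (use Suc.hyps(2) i in auto)
    have "\<not> holds w (scan_regs D (?st i), int i, W) (In 0)"
      using nth_nonblank[OF nb i] i by (simp add: word_at_nth)
    from performs_Until_False[OF this _ performs_Seq_silent[OF a b] c] show ?case by simp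
  qed
  have 3: "performs (Until (In 0) (symbol_com ;; Next)) (scan_regs D (?st 0), int 0, W) []
      (scan_regs D (2 * n, X, v, q), int (length w), W)" using loop[of 0] fin by simp
  have "2 * n \<le> length w" using scan_invariant[OF fin] D(1) by simp
  then have n: "2 * n < 2 ^ L" using less_exp[of L] len by linarith
  have half: "2 * n div Suc (Suc 0) = n"
    by (metis nonzero_mult_div_cancel_left numeral_2_eq_2 zero_neq_numeral)
  have "scan_regs D (2 * n, X, v, q) 1 = 2 * n" "scan_regs D (2 * n, X, v, q) (Suc 0) = 2 * n"
    by (simp_all add: scan_regs_def)
  moreover have "(2::nat) ^ 2 \<le> 2 ^ L" using len ne by (intro power_increasing) (cases w, auto)
  then have "Suc (Suc 0) < 2 ^ L" by simp
  ultimately have "performs (assign 1 (Call div_exp [Var 1, ESuc EOne])) (scan_regs D (2 * n, X, v, q), int (length w), W) []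
      ((scan_regs D (2 * n, X, v, q))(1 := n), int (length w), W)"
    using n one half by (intro performs_assign) (auto intro!: below_div)
  moreover have "(scan_regs D (2 * n, X, v, q))(1 := n) = scan_regs D (n, X, v, q)"
    by (auto simp: scan_regs_def fun_eq_iff)
  ultimately have 4: "performs (assign 1 (Call div_exp [Var 1, ESuc EOne])) (scan_regs D (2 * n, X, v, q), int (length w), W) []
      (scan_regs D (n, X, v, q), int (length w), W)" by (simp only:)
  show ?thesis
    unfolding parse_com_def
    by (rule performs_Seq_silent[OF performs_measure[OF nb len] performs_Seq_silent[OF s2 performs_Seq_silent[OF 3 4]]])
qed

end

text \<open>The entries are collected with the least significant digit first.\<close>

primrec from_digits :: "nat \<Rightarrow> nat list \<Rightarrow> nat" where
  "from_digits D [] = 0"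
| "from_digits D (e # es) = e + D * from_digits D es"

lemma from_digits_append:
  "from_digits D (xs @ ys) = from_digits D xs + D ^ length xs * from_digits D ys"
  by (induction xs) (auto simp: algebra_simps)

lemma from_digits_less: "\<forall>e \<in> set es. e < D \<Longrightarrow> from_digits D es < D ^ length es"
proof (induction es)
  case (Cons e es)
  then have "Suc (from_digits D es) * D \<le> D ^ length es * D" by (intro mult_right_mono) auto
  then show ?case using Cons.prems by (simp add: algebra_simps)
qed simp

lemma digit_from_digits:
  "\<forall>e \<in> set es. e < D \<Longrightarrow> i < length es \<Longrightarrow> digit (from_digits D es) D i = es ! i"
proof (induction es arbitrary: i)
  case (Cons e es)
  then have D: "0 < D" "e < D" by auto
  show ?case
  proof (cases i)
    case 0
    then show ?thesis using D by (simp add: digit_def)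
  next
    case (Suc j)
    have "(e + D * from_digits D es) div D ^ Suc j = (e + D * from_digits D es) div D div D ^ j"
      by (simp add: div_mult2_eq)
    also have "(e + D * from_digits D es) div D = from_digits D es" using D by simp
    finally show ?thesis using Cons Suc by (simp add: digit_def)
  qed
qed simp

lemma scan_nat: "foldl (scan_symbol D) (n, X, 0, q) (enc_nat m) = (n, X, m, q)"
proof (induction m rule: less_induct)
  case (less m)
  show ?case
  proof (cases "m < 2")
    case True
    then consider "m = 0" | "m = 1" by linarith
    then show ?thesis by cases (simp_all add: enc_nat.simps)
  next
    case False
    then have e: "enc_nat m = enc_nat (m div 2) @ [m mod 2 + 1]" by (simp add: enc_nat.simps[of m])
    have "m mod 2 = 0 \<or> m mod 2 = 1" by linarith
    moreover have "m div 2 + m div 2 + m mod 2 = m" by presburger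
    ultimately show ?thesis unfolding e using less[of "m div 2"] False by auto
  qed
qed

lemma scan_int: "foldl (scan_symbol D) (n, X, 0, q) (enc_int k @ [4]) = (n, X + nat \<bar>k\<bar> * q, 0, q * D)"
  by (simp add: enc_int_def scan_nat)

lemma scan_entries:
  "foldl (scan_symbol D) (n, X, 0, q) (concat (map (\<lambda>k. enc_int k @ [4]) ks)) =
    (n, X + q * from_digits D (map (\<lambda>k. nat \<bar>k\<bar>) ks), 0, q * D ^ length ks)"
proof (induction ks arbitrary: X q)
  case (Cons k ks)
  have e: "concat (map (\<lambda>k. enc_int k @ [4]) (k # ks)) =
      (enc_int k @ [4]) @ concat (map (\<lambda>k. enc_int k @ [4]) ks)" by simp
  show ?case
    unfolding e by (subst foldl_append, simp only: scan_int Cons) (simp add: algebra_simps)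
qed simp

definition mat_entries :: "int mat \<Rightarrow> nat list" where
  "mat_entries A = concat (map (\<lambda>r. map (\<lambda>k. nat \<bar>k\<bar>) (list_of_vec r)) (rows A))"

lemma scan_rows:
  "foldl (scan_symbol D) (n, X, 0, q)
     (concat (map (\<lambda>r. concat (map (\<lambda>k. enc_int k @ [4]) (list_of_vec r)) @ [5]) rs)) =
   (n + length rs, X + q * from_digits D (concat (map (\<lambda>r. map (\<lambda>k. nat \<bar>k\<bar>) (list_of_vec r)) rs)), 0,
    q * D ^ length (concat (map (\<lambda>r. map (\<lambda>k. nat \<bar>k\<bar>) (list_of_vec r)) rs)))"
proof (induction rs arbitrary: n X q)
  case (Cons r rs)
  have "foldl (scan_symbol D) (n, X, 0, q) (concat (map (\<lambda>k. enc_int k @ [4]) (list_of_vec r)) @ [5]) =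
      (Suc n, X + q * from_digits D (map (\<lambda>k. nat \<bar>k\<bar>) (list_of_vec r)), 0, q * D ^ length (list_of_vec r))"
    by (simp add: scan_entries del: length_list_of_vec)
  then show ?case using Cons
    by (simp add: from_digits_append power_add algebra_simps del: length_list_of_vec)
qed simp

lemma scan_mat:
  "foldl (scan_symbol D) (n, X, 0, q) (enc_mat A) =
   (n + dim_row A, X + q * from_digits D (mat_entries A), 0, q * D ^ length (mat_entries A))"
  by (simp add: enc_mat_def scan_rows mat_entries_def)

lemma scan_input:
  "foldl (scan_symbol D) (0, 0, 0, 1) (enc_input A B v) =
    (dim_row A + dim_row B, from_digits D (mat_entries A @ mat_entries B), v,
     D ^ length (mat_entries A @ mat_entries B))"
  by (simp add: enc_input_def enc_pair_def scan_mat scan_nat from_digits_append power_add)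

lemma nth_concat_uniform:
  assumes "\<forall>xs \<in> set xss. length xs = m" "i < length xss" "j < m"
  shows "concat xss ! (i * m + j) = xss ! i ! j"
  using assms
proof (induction xss arbitrary: i)
  case (Cons xs xss)
  then show ?case by (cases i) (auto simp: nth_append)
qed simp

lemma mat_entries:
  assumes "M \<in> carrier_mat n n"
  shows "length (mat_entries M) = n * n"
    and "u < n \<Longrightarrow> u' < n \<Longrightarrow> mat_entries M ! (u * n + u') = nat \<bar>M $$ (u, u')\<bar>"
proof -
  let ?rows = "map (\<lambda>r. map (\<lambda>k. nat \<bar>k\<bar>) (list_of_vec r)) (rows M)"
  have u: "\<forall>xs \<in> set ?rows. length xs = n" using assms by (auto simp: rows_def)
  have "length (concat xss) = length xss * n" if "\<forall>xs \<in> set xss. length xs = n" for xss :: "nat list list"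
    using that by (induction xss) auto
  from this[OF u] show "length (mat_entries M) = n * n" using assms by (simp add: mat_entries_def)
  show "mat_entries M ! (u * n + u') = nat \<bar>M $$ (u, u')\<bar>" if "u < n" "u' < n"
  proof -
    have "mat_entries M ! (u * n + u') = ?rows ! u ! u'"
      unfolding mat_entries_def using assms that by (intro nth_concat_uniform[OF u]) auto
    also have "\<dots> = nat \<bar>M $$ (u, u')\<bar>" using assms that by (simp add: list_of_vec_index)
    finally show ?thesis .
  qed
qed

section \<open>The complete machine\<close>

definition "program = parse_com ;; order_com"

lemma program_wf: "com_wf program"
  by (simp add: program_def parse_com_wf order_com_wf)

lemma program_marks: "mark_count pt program = (if pt = At_Order_Return then 0 else 1)"
  by (simp add: program_def parse_com_marks order_com_marks)

lemma length_enc_nat: "m < 2 ^ j \<Longrightarrow> 1 \<le> j \<Longrightarrow> length (enc_nat m) \<le> j"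
  using length_bits[of m j] by (simp add: bits_def)

lemma less_power_length_enc_nat: "m < 2 ^ length (enc_nat m)"
proof (induction m rule: less_induct)
  case (less m)
  show ?case
  proof (cases "m < 2")
    case True
    then show ?thesis by (simp add: enc_nat.simps)
  next
    case False
    then have e: "length (enc_nat m) = Suc (length (enc_nat (m div 2)))" by (simp add: enc_nat.simps[of m])
    have "m div 2 < 2 ^ length (enc_nat (m div 2))" using less[of "m div 2"] False by simp
    then show ?thesis unfolding e by simp
  qed
qed

lemma length_enc_path:
  assumes "\<forall>v \<in> set p. v < n" "0 < n"
  shows "length (enc_path p) \<le> length p * Suc n"
  using assms(1)
proof (induction p)
  case (Cons v p)
  have "v < 2 ^ n" using Cons.prems less_exp[of n] by (auto intro: less_trans)
  then have "length (enc_nat v) \<le> n" using assms(2) by (intro length_enc_nat) auto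
  then show ?case using Cons by (simp add: enc_path_def)
qed (simp add: enc_path_def)

lemma enc_nat_nonblank: "0 \<notin> set (enc_nat m)"
  using bits_nonblank[of m] by (simp add: bits_def)

lemma enc_mat_nonblank: "0 \<notin> set (enc_mat M)"
  using enc_nat_nonblank by (auto simp: enc_mat_def enc_int_def)

lemma length_le_concat: "xs \<in> set xss \<Longrightarrow> length xs \<le> length (concat xss)"
  by (induction xss) auto

lemma mat_entries_enc:
  assumes "e \<in> set (mat_entries M)"
  shows "length (enc_nat e) \<le> length (enc_mat M)"
proof -
  obtain r k where rk: "r \<in> set (rows M)" "k \<in> set (list_of_vec r)" "e = nat \<bar>k\<bar>"
    using assms by (auto simp: mat_entries_def)
  have "length (enc_nat e) \<le> length (enc_int k @ [4])" using rk(3) by (simp add: enc_int_def)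
  also have "\<dots> \<le> length (concat (map (\<lambda>k. enc_int k @ [4]) (list_of_vec r)))"
    using rk(2) by (intro length_le_concat) auto
  also have "\<dots> \<le> length (concat (map (\<lambda>k. enc_int k @ [4]) (list_of_vec r)) @ [5])" by simp
  also have "\<dots> \<le> length (concat (map (\<lambda>r. concat (map (\<lambda>k. enc_int k @ [4]) (list_of_vec r)) @ [5]) (rows M)))"
    using rk(1) by (intro length_le_concat) auto
  also have "\<dots> \<le> length (enc_mat M)" by (simp add: enc_mat_def)
  finally show ?thesis .
qed

lemma length_mat_entries: "length (mat_entries M) \<le> length (enc_mat M)"
proof -
  have 1: "length ks \<le> length (concat (map (\<lambda>k. enc_int k @ [4]) ks))" for ks
    by (induction ks) auto
  have "length (concat (map (\<lambda>r. map (\<lambda>k. nat \<bar>k\<bar>) (list_of_vec r)) rs)) \<le>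
      length (concat (map (\<lambda>r. concat (map (\<lambda>k. enc_int k @ [4]) (list_of_vec r)) @ [5]) rs))" for rs
  proof (induction rs)
    case (Cons r rs)
    then show ?case using 1[of "list_of_vec r"] by simp
  qed simp
  then show ?thesis by (simp add: mat_entries_def enc_mat_def le_Suc_eq)
qed

lemma (in visible_machine) performs_exec:
  "performs c (R, p, W) sns (R', p', W') \<Longrightarrow> capped L (R, p, W) \<Longrightarrow>
    \<exists>R1. exec w L c (R, p, W) sns (R1, p', W') \<and> R1 0 = R' 0"
  unfolding performs_def fst_conv snd_conv using less_nvars[of 0] by fastforce

lemma index_bound:
  fixes u u' n :: nat
  assumes "u < n" "u' < n"
  shows "u * n + u' < n * n"
proof -
  have "u * n + u' < Suc u * n" using assms(2) by simp
  also have "\<dots> \<le> n * n" using assms(1) by (intro mult_le_mono1) simp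
  finally show ?thesis .
qed

text \<open>With \<open>m\<close> for the size, \<open>2 * n * n \<le> m\<close> because both encodings have a symbol for each entry, and the
  input has length at most \<open>2 * m\<close>. Thus \<open>D\<close> is at most \<open>2 ^ (2 * m)\<close>, its powers with
  exponents up to \<open>2 * m\<close> are at most \<open>2 ^ (4 * m * m)\<close>, and the codes are smaller still; \<open>L\<close> exceeds
  all these exponents.\<close>

lemma program_execution:
  assumes kp: "katsura_pair n A B" and v: "v < n"
    and L: "L = 10 * (pair_size A B + 1) ^ 2"
  obtains sns R p W where "exec (enc_input A B v) L program (\<lambda>_. 0, 0, \<lambda>_. []) sns (R, p, W)"
    "order_trace A B v = sns @ [Order_Return (int (R 0))]" "order_value A B v = int (R 0)"
    "length (enc_input A B v) \<le> L" "1 \<le> L"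
proof -
  let ?w = "enc_input A B v" and ?m = "pair_size A B"
  define D where "D = (2::nat) ^ length ?w"
  define es where "es = mat_entries A @ mat_entries B"
  define X where "X = from_digits D es"
  have n: "0 < n" and cA: "A \<in> carrier_mat n n" and cB: "B \<in> carrier_mat n n"
    using kp by (auto simp: katsura_pair_def)
  have les: "length es = 2 * n * n" using mat_entries(1)[OF cA] mat_entries(1)[OF cB] by (simp add: es_def)
  have m: "?m = length (enc_mat A) + length (enc_mat B)" by (simp add: pair_size_def enc_pair_def)
  have nn: "2 * (n * n) \<le> ?m"
    using length_mat_entries[of A] length_mat_entries[of B] mat_entries(1)[OF cA] mat_entries(1)[OF cB] m by simp
  have "n \<le> n * n" using n by simp
  then have nm: "2 * n \<le> ?m" using nn by linarith
  have "v < 2 ^ n" using v less_exp[of n] by linarith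
  then have "length (enc_nat v) \<le> n" using n by (intro length_enc_nat) auto
  then have lw: "length ?w \<le> 2 * ?m" using nm by (simp add: enc_input_def pair_size_def)
  have L': "L = 10 * (?m * ?m) + 20 * ?m + 10" unfolding L by (simp add: power2_eq_square algebra_simps)
  have "length ?w * length ?w \<le> 2 * ?m * (2 * ?m)" using lw by (intro mult_le_mono)
  then have lw2: "length ?w * length ?w < L" "length ?w < L" using lw L' by simp_all
  have ne: "?w \<noteq> []" by (simp add: enc_input_def enc_pair_def enc_mat_def)
  then have lpos: "1 \<le> length ?w" by (cases ?w) auto
  have D1: "1 < D" unfolding D_def using lpos by (intro one_less_power) auto
  have "length ?w * (2 * n * n + n) \<le> 2 * ?m * (2 * ?m)"
    using lw nn nm by (intro mult_le_mono) (simp_all add: mult.assoc)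
  then have "length ?w * (2 * n * n + n) < L" using L' by simp
  then have Dpow: "D ^ (2 * n * n + n) < 2 ^ L" unfolding D_def power_mult[symmetric] by simp
  have small: "\<forall>e \<in> set es. e < D"
  proof
    fix e assume "e \<in> set es"
    then have "length (enc_nat e) \<le> length ?w"
      using mat_entries_enc[of e A] mat_entries_enc[of e B] by (auto simp: es_def enc_input_def enc_pair_def)
    then have "(2::nat) ^ length (enc_nat e) \<le> D" unfolding D_def by (intro power_increasing) auto
    then show "e < D" using less_power_length_enc_nat[of e] by linarith
  qed
  have "X < D ^ (2 * n * n)" using from_digits_less[OF small] les by (simp add: X_def)
  also have "\<dots> \<le> D ^ (2 * n * n + n)" using D1 by (intro power_increasing) auto
  finally have X: "X < 2 ^ L" using Dpow by linarith
  have "Suc n \<le> 2 ^ n" using less_exp[of n] by (simp add: Suc_le_eq)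
  then have "Suc n ^ Suc (Suc n) \<le> (2 ^ n) ^ Suc (Suc n)" by (rule power_mono) simp
  also have "\<dots> = 2 ^ (n * Suc (Suc n))" by (simp only: power_mult[symmetric])
  also have "\<dots> < 2 ^ L" using nn nm L' by simp
  finally have base: "Suc n ^ Suc (Suc n) < 2 ^ L" .
  interpret procedure n D X L ?w A B v
  proof
    show "length (enc_path p) \<le> L" if "codable (Suc n) p" "length p \<le> Suc n" for p
    proof -
      have "length (enc_path p) \<le> length p * Suc n"
        using that(1) n by (intro length_enc_path) (auto simp: codable_def)
      also have "\<dots> \<le> Suc n * Suc n" using that(2) by (rule mult_le_mono1)
      also have "\<dots> \<le> L" using nn nm L' by simp
      finally show ?thesis .
    qed
    show "digit X D (u * n + u') = katsura.a_entry A u u'" if "u < n" "u' < n" for u u'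
    proof -
      have i: "u * n + u' < n * n" using index_bound that by blast
      have "digit X D (u * n + u') = es ! (u * n + u')"
        unfolding X_def using small i les by (intro digit_from_digits) auto
      also have "\<dots> = nat \<bar>A $$ (u, u')\<bar>"
        using mat_entries[OF cA] that i by (simp add: es_def nth_append)
      also have "\<dots> = nat (A $$ (u, u'))" using kp that by (simp add: katsura_pair_def)
      finally show ?thesis using kp by (simp add: katsura.a_entry_def katsura_def)
    qed
    show "digit X D (n * n + (u * n + u')) = katsura.b_entry B u u'" if "u < n" "u' < n" for u u'
    proof -
      have i: "u * n + u' < n * n" using index_bound that by blast
      have "digit X D (n * n + (u * n + u')) = es ! (n * n + (u * n + u'))"
        unfolding X_def using small i les by (intro digit_from_digits) auto
      also have "\<dots> = nat \<bar>B $$ (u, u')\<bar>"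
        using mat_entries[OF cA] mat_entries[OF cB] that i by (simp add: es_def nth_append)
      finally show ?thesis using kp by (simp add: katsura.b_entry_def katsura_def)
    qed
  qed (use n D1 X Dpow base lw2 kp v in auto)
  have nb: "0 \<notin> set ?w"
    using enc_mat_nonblank enc_nat_nonblank by (auto simp: enc_input_def enc_pair_def)
  have scan: "foldl (scan_symbol D) (0, 0, 0, 1) ?w = (2 * n, X, v, D ^ length es)"
    using cA cB scan_input[of D A B v] by (simp add: X_def es_def)
  have Dw: "D ^ length ?w < 2 ^ L" unfolding D_def power_mult[symmetric] using lw2(1) by simp
  let ?R = "scan_regs D (n, X, v, D ^ length es)"
  have parse: "performs parse_com (\<lambda>_. 0, 0, \<lambda>_. []) [] (?R, int (length ?w), \<lambda>_. [])"
    using performs_parse[OF nb ne D_def Dw lw2(2) scan] .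
  have "globals ?R" "?R 10 = 0" by (simp_all add: globals_def scan_regs_def)
  then obtain sns R' p W where run: "performs order_com (?R, int (length ?w), \<lambda>_. []) sns (R', p, W)"
    "order_trace A B v = sns @ [Order_Return (int (R' 0))]" "order_value A B v = int (R' 0)"
    using performs_order_com[of ?R "int (length ?w)" "\<lambda>_. []"] by blast
  have "performs program (\<lambda>_. 0, 0, \<lambda>_. []) sns (R', p, W)"
    unfolding program_def by (rule performs_Seq_silent[OF parse run(1)])
  moreover have "capped L (\<lambda>_. 0, 0, \<lambda>_. [])" by simp
  ultimately obtain R where "exec ?w L program (\<lambda>_. 0, 0, \<lambda>_. []) sns (R, p, W)" "R 0 = R' 0"
    using performs_exec by blast
  moreover have "1 \<le> L" "length ?w \<le> L" using lw2 L' by simp_all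
  ultimately show thesis using that[of sns R p W] run(2,3) by simp
qed

theorem proposition7p4:
  shows "(\<exists>(M :: tm) (mark :: point \<Rightarrow> nat) (P :: nat poly).
            tm_wf M \<and> 4 \<le> tapes M \<and> 7 \<le> symbols M \<and>
            inj mark \<and> mark At_Order_Return = halt M \<and>
            (\<forall>(n :: nat) (A :: int mat) (B :: int mat) (v :: nat).
               katsura_pair n A B \<and> v < n \<longrightarrow>
               (\<exists>T. tm_halts_at M (enc_input A B v) T \<and>
                    tm_executes M mark (enc_input A B v) T (order_trace A B v) \<and>
                    tape_holds (snd (tm_config M (enc_input A B v) T) ! 3) (enc_int (order_value A B v)) \<and>
                    tm_space M (enc_input A B v) T \<le> poly P (pair_size A B))))
       \<and> (\<exists>Q :: nat poly. \<forall>(n :: nat) (A :: int mat) (B :: int mat) (v :: nat).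
            katsura_pair n A B \<and> v < n \<longrightarrow> int_size (order_value A B v) \<le> poly Q (pair_size A B))"
proof
  \<comment> \<open>Three tapes for input and output and one tape for each register up to \<open>max_reg program\<close>.\<close>
  define k where "k = max_reg program + 4"
  define code where "code = compile program 0 @ [IMark At_Order_Return]"
  let ?M = "machine k code" and ?mark = "mark_state code"
  let ?P = "smult k [:23, 40, 20:] :: nat poly"
  have k: "max_reg program + 3 < k" by (simp add: k_def)
  have sim: "simulation w L k code" if "1 \<le> L" "length w \<le> L" for w L
    unfolding code_def by (rule simulation_compile[OF program_wf k program_marks that])
  \<comment> \<open>Well-formedness and the states of the marks depend on the code alone, so any input will do here.\<close>
  note any = sim[of 1 "[]", simplified]
  have wf: "tm_wf ?M"
    using any k by (intro machine_wf) (auto simp: simulation_def)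
  have size: "4 \<le> tapes ?M" "7 \<le> symbols ?M" by (simp_all add: machine_def k_def)
  have mark: "inj ?mark" "?mark At_Order_Return = halt ?M"
    using simulation.mark_inj[OF any] simulation.mark_halt[OF any] .
  have run: "\<exists>T. tm_halts_at ?M (enc_input A B v) T \<and>
      tm_executes ?M ?mark (enc_input A B v) T (order_trace A B v) \<and>
      tape_holds (snd (tm_config ?M (enc_input A B v) T) ! 3) (enc_int (order_value A B v)) \<and>
      tm_space ?M (enc_input A B v) T \<le> poly ?P (pair_size A B)"
    if inst: "katsura_pair n A B" "v < n" for n A B v
  proof -
    define L where "L = 10 * (pair_size A B + 1) ^ 2"
    obtain sns R p W where ex: "exec (enc_input A B v) L program (\<lambda>_. 0, 0, \<lambda>_. []) sns (R, p, W)"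
      and tr: "order_trace A B v = sns @ [Order_Return (int (R 0))]" and val: "order_value A B v = int (R 0)"
      and L: "length (enc_input A B v) \<le> L" "1 \<le> L"
      using program_execution[OF inst L_def] by blast
    obtain T where T: "tm_halts_at ?M (enc_input A B v) T"
      "tm_executes ?M ?mark (enc_input A B v) T (sns @ [Order_Return (int (R 0))])"
      "tape_holds (snd (tm_config ?M (enc_input A B v) T) ! 3) (enc_int (int (R 0)))"
      "tm_space ?M (enc_input A B v) T \<le> k * (2 * L + 3)"
      using simulation.machine_executes[OF sim[OF L(2,1)] ex program_wf k code_def] by blast
    have "k * (2 * L + 3) = poly ?P (pair_size A B)"
      by (simp add: L_def power2_eq_square algebra_simps)
    then show ?thesis using T tr val by auto
  qed
  show "\<exists>(M :: tm) (mark :: point \<Rightarrow> nat) (P :: nat poly).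
            tm_wf M \<and> 4 \<le> tapes M \<and> 7 \<le> symbols M \<and>
            inj mark \<and> mark At_Order_Return = halt M \<and>
            (\<forall>(n :: nat) (A :: int mat) (B :: int mat) (v :: nat).
               katsura_pair n A B \<and> v < n \<longrightarrow>
               (\<exists>T. tm_halts_at M (enc_input A B v) T \<and>
                    tm_executes M mark (enc_input A B v) T (order_trace A B v) \<and>
                    tape_holds (snd (tm_config M (enc_input A B v) T) ! 3) (enc_int (order_value A B v)) \<and>
                    tm_space M (enc_input A B v) T \<le> poly P (pair_size A B)))"
  proof (rule exI[of _ ?M], rule exI[of _ ?mark], rule exI[of _ ?P], intro conjI)
    show "\<forall>n A B v. katsura_pair n A B \<and> v < n \<longrightarrow>
        (\<exists>T. tm_halts_at ?M (enc_input A B v) T \<and>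
          tm_executes ?M ?mark (enc_input A B v) T (order_trace A B v) \<and>
          tape_holds (snd (tm_config ?M (enc_input A B v) T) ! 3) (enc_int (order_value A B v)) \<and>
          tm_space ?M (enc_input A B v) T \<le> poly ?P (pair_size A B))"
    proof (intro allI impI, elim conjE)
      fix n A B v assume "katsura_pair n A B" "v < n"
      then show "\<exists>T. tm_halts_at ?M (enc_input A B v) T \<and>
          tm_executes ?M ?mark (enc_input A B v) T (order_trace A B v) \<and>
          tape_holds (snd (tm_config ?M (enc_input A B v) T) ! 3) (enc_int (order_value A B v)) \<and>
          tm_space ?M (enc_input A B v) T \<le> poly ?P (pair_size A B)"
        by (rule run)
    qed
  qed (fact wf size mark)+
next
  have "int_size (order_value A B v) \<le> poly [:10, 20, 10:] (pair_size A B)"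
    if inst: "katsura_pair n A B" "v < n" for n A B v
  proof -
    define L where "L = 10 * (pair_size A B + 1) ^ 2"
    obtain sns R p W where ex: "exec (enc_input A B v) L program (\<lambda>_. 0, 0, \<lambda>_. []) sns (R, p, W)"
      and "order_trace A B v = sns @ [Order_Return (int (R 0))]" and val: "order_value A B v = int (R 0)"
      and L: "length (enc_input A B v) \<le> L" "1 \<le> L"
      using program_execution[OF inst L_def] by blast
    \<comment> \<open>The result stands in a register, and registers stay below \<open>2 ^ L\<close>.\<close>
    have "capped L (R, p, W)" using exec_capped[OF ex L(1)] by simp
    then have "length (bits (R 0)) \<le> L" using L(2) by (intro length_bits) auto
    then have "int_size (order_value A B v) \<le> L" by (simp add: val int_size_def enc_int_def bits_def)
    then show ?thesis by (simp add: L_def power2_eq_square algebra_simps)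
  qed
  then show "\<exists>Q :: nat poly. \<forall>(n :: nat) (A :: int mat) (B :: int mat) (v :: nat).
            katsura_pair n A B \<and> v < n \<longrightarrow> int_size (order_value A B v) \<le> poly Q (pair_size A B)"
    by blast
qed

end
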